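(* Let $X_1,X_2,\ldots$ be i.i.d. exponentially distributed random variables with density $\lambda e^{-\lambda x}$, $x\ge 0$, for some $\lambda>0$ (the null hypothesis $H_0$), and let $D_n^{(2)}$ be the statistic and $\delta_2^2$ the constant defined in the context. Then for $a>0$ $$\lim_{n\to\infty} n^{-1}\ln P_{H_0}\left(D_n^{(2)}>a\right)=-f_2(a),$$ where the function $f_2$ is continuous for sufficiently small $a>0$, and moreover $$f_2(a)=(8\delta_2^2)^{-1}a^2(1+o(1))\quad\text{as } a\to0,$$ where numerically $(8\delta_2^2)^{-1}\approx 5.595$.
   Context: For $t\ge 0$ and a sample $X_1,\ldots,X_n$ put $$H_n^{(2)}(t)=\frac1{n^2}\sum_{i_1,i_2=1}^n \mathbf 1\{\max(X_{i_1},X_{i_2})<t\},$$ $$G_n^{(2)}(t)=\frac1{2n^2}\sum_{i_1,i_2=1}^n\left[\mathbf 1\{X_{i_1}+\tfrac{X_{i_2}}{2}<t\}+\mathbf 1\{\tfrac{X_{i_1}}{2}+X_{i_2}<t\}\right],$$ and $D_n^{(2)}=\sup_{t\ge0}\left|H_n^{(2)}(t)-G_n^{(2)}(t)\right|$. The distribution of $D_n^{(2)}$ under $H_0$ does not depend on $\lambda$. $P_{H_0}$ denotes probability when the $X_i$ are i.i.d. exponential. The convention $\ln 0=-\infty$ is used, so $f_2$ may take the value $+\infty$ for large $a$. With $F(x)=1-e^{-x}$, let $$\xi_2(s;t)=\mathbf 1\{s<t\}F(t)-\tfrac12\mathbf 1\{s<t\}F(2(t-s))-\tfrac12\mathbf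 1\{s<2t\}F(t-s/2),$$ which for standard exponential (rate 1) independent $X,Y$ is the conditional expectation given $X=s$ of the kernel $\mathbf 1\{\max(X,Y)<t\}-\frac12\left[\mathbf 1\{X+\frac Y2<t\}+\mathbf 1\{\frac X2+Y<t\}\right]$. Let $\delta_2^2(t)=\operatorname{Var}(\xi_2(X;t))$ with $X$ standard exponential; explicitly $$\delta_2^2(t)=\tfrac13e^{-t}-\tfrac54e^{-2t}-\tfrac13e^{-3t}-\tfrac1{12}e^{-4t}-\tfrac23e^{-3t/2}+2e^{-5t/2}+\tfrac12te^{-2t}.$$ Finally $\delta_2^2=\sup_{t\ge0}\delta_2^2(t)\approx0.02234$. *)

theory Defs
  imports "HOL-Probability.Probability" "HOL-Library.Landau_Symbols"
begin

text \<open>A sample of size \<open>n\<close> is the initial segment \<open>x 0, \<dots>, x (n - 1)\<close> of a sequence.\<close>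

definition H2 :: "nat \<Rightarrow> (nat \<Rightarrow> real) \<Rightarrow> real \<Rightarrow> real" where
  "H2 n x t = 1 / real n ^ 2 * (\<Sum>i<n. \<Sum>j<n. of_bool (max (x i) (x j) < t))"

definition G2 :: "nat \<Rightarrow> (nat \<Rightarrow> real) \<Rightarrow> real \<Rightarrow> real" where
  "G2 n x t = 1 / (2 * real n ^ 2) *
     (\<Sum>i<n. \<Sum>j<n. of_bool (x i + x j / 2 < t) + of_bool (x i / 2 + x j < t))"

definition D2 :: "nat \<Rightarrow> (nat \<Rightarrow> real) \<Rightarrow> real" where
  "D2 n x = (SUP t\<in>{0..}. \<bar>H2 n x t - G2 n x t\<bar>)"

text \<open>
  The conditional expectation, given that the first of two independent standard exponential
  variables equals \<open>s\<close>, of the symmetric kernel underlying the difference of \<open>H2\<close> and \<open>G2\<close>.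
  The distribution function \<open>F\<close> is only ever evaluated at nonnegative arguments when \<open>s\<close> and \<open>t\<close>
  are nonnegative: the factors \<open>of_bool\<close> remove the other cases.
\<close>

definition xi2 :: "real \<Rightarrow> real \<Rightarrow> real" where
  "xi2 s t = (let F = (\<lambda>x. 1 - exp (- x)) in
     of_bool (s < t) * F t
     - 1 / 2 * of_bool (s < t) * F (2 * (t - s))
     - 1 / 2 * of_bool (s < 2 * t) * F (t - s / 2))"

definition delta2_sq_at :: "real \<Rightarrow> real" where
  "delta2_sq_at t = prob_space.variance (density lborel (exponential_density 1)) (\<lambda>s. xi2 s t)"

definition delta2_sq :: real where
  "delta2_sq = (SUP t\<in>{0..}. delta2_sq_at t)"

definition ln_ereal :: "real \<Rightarrow> ereal" where
  "ln_ereal p = (if p = 0 then - \<infinity> else ereal (ln p))"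

end

theory Submission
  imports Defs
begin

text \<open>
  Write \<open>F\<close> for the left-continuous distribution function of a probability measure \<open>\<mu>\<close> on the line and
  \<open>Psi \<mu> t = F(t)^2 - (\<mu> \<otimes> \<mu>){(x, y). x + y / 2 < t}\<close>. Since a double sum is symmetric in its two
  indices, the two halves of \<open>G2\<close> agree, and \<open>H2 - G2\<close> is \<open>Psi\<close> of the empirical measure
  (\<open>Psi_emp\<close>). The standard exponential law \<open>Exp1\<close> has \<open>Psi = 0\<close>; rescaling the sample does not change
  \<open>D2\<close>, so every rate \<open>l\<close> reduces to \<open>l = 1\<close>.

  \<^bold>\<open>The limit.\<close> Replacing one factor of the convolution at a time shows that \<open>Psi\<close> is Lipschitz with
  constant 4 for the uniform distance of distribution functions, uniformly in \<open>t\<close>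
  (\<open>Psi_lipschitz\<close>). Cut the line into \<open>k\<close> cells of \<open>Exp1\<close>-mass \<open>1 / k\<close>. Two measures with the same cell
  masses, all at most \<open>\<eta>\<close>, are within \<open>\<eta>\<close> of each other (\<open>lcdf_diff_cells\<close>), so up to a small
  error \<open>Psi\<close> is a function of the word of cells that the sample visits, and words are uniformly
  distributed. The method of types then gives Sanov bounds: above by the number of types
  (\<open>exceed_upper\<close>), below by a change of measure and a Chernoff bound (\<open>exceed_lower\<close>).
  The exponent is \<open>rate \<sigma> a\<close>, the infimum of the relative entropy \<open>KL f\<close> over bounded densities \<open>f\<close>
  with \<open>\<sigma> * Psi > a\<close> for some \<open>t\<close>, taken for each sign \<open>\<sigma>\<close>; the final rate is the minimum of the two.

  \<^bold>\<open>Every level.\<close> The upper bound only sees levels \<open>b < a\<close>, so a limit at \<open>a\<close> needs left continuity of the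
  rate. It comes from \<open>raise_level\<close>: a density of bounded entropy with \<open>\<sigma> * Psi\<close> below its
  largest possible value can be mixed with a little of another density so that the value rises by a fixed
  amount, while the entropy grows by at most \<open>\<eta>\<close>. The largest values are 1 for the sign \<open>+\<close> and
  \<open>1 / 4\<close> for the sign \<open>-\<close>; at and above them the event has probability 0, which settles the level
  \<open>1 / 4\<close>, where the rate of the negative sign jumps to infinity, and the levels \<open>a \<ge> 1\<close>. The same lemma gives
  continuity of both rates below \<open>1 / 4\<close>.

  \<^bold>\<open>Small levels.\<close> For a density \<open>f\<close> of small entropy, \<open>Psi\<close> equals twice the mean of the projection
  \<open>xi2\<close> under \<open>f\<close>, up to an error of the order of the entropy (\<open>Bil_linearization\<close>). Young's inequality
  \<open>x * z \<le> x * ln x - x + exp z\<close>, applied to a multiple of \<open>xi2\<close>, bounds this mean by entropy and variance and gives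
  the lower bound \<open>a^2 / (8 * delta2_sq)\<close>; the densities \<open>1 + \<epsilon> * xi2\<close> at a nearly optimal \<open>t\<close> attain it to
  first order.

  \<^bold>\<open>The constant.\<close> The variance is an explicit polynomial in \<open>y = exp (- t / 2)\<close> plus
  \<open>t * y^4 / 2\<close>. Replacing the logarithm \<open>t = - 2 * ln y\<close> by a tangent bound leaves polynomial inequalities
  in \<open>y\<close>.
\<close>

section \<open>The functional on measures\<close>

text \<open>
  The statistic compares with strict inequalities, which calls for open half-lines and the left-continuous
  version of the distribution function.
\<close>

definition lcdf :: "real measure \<Rightarrow> real \<Rightarrow> real" where
  "lcdf \<mu> x = measure \<mu> {..<x}"

definition Psi :: "real measure \<Rightarrow> real \<Rightarrow> real" where
  "Psi \<mu> t = (lcdf \<mu> t)\<^sup>2 - (\<integral>y. lcdf \<mu> (t - y / 2) \<partial>\<mu>)"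

lemma lcdf_bounds:
  assumes "real_distribution \<mu>"
  shows "0 \<le> lcdf \<mu> x" "lcdf \<mu> x \<le> 1"
proof -
  interpret real_distribution \<mu> by fact
  show "0 \<le> lcdf \<mu> x" "lcdf \<mu> x \<le> 1" by (simp_all add: lcdf_def)
qed

lemma lcdf_mono:
  assumes "real_distribution \<mu>" "x \<le> y"
  shows "lcdf \<mu> x \<le> lcdf \<mu> y"
proof -
  interpret real_distribution \<mu> by fact
  show ?thesis unfolding lcdf_def by (rule finite_measure_mono) (use assms in auto)
qed

lemma lcdf_measurable:
  assumes "real_distribution \<mu>"
  shows "lcdf \<mu> \<in> borel_measurable borel"
  by (rule borel_measurable_mono) (auto intro!: monoI lcdf_mono assms)

lemma integrable_lcdf:
  assumes "real_distribution \<mu>" "real_distribution \<nu>" "g \<in> borel_measurable borel"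
  shows "integrable \<nu> (\<lambda>y. lcdf \<mu> (g y))"
proof -
  interpret \<nu>: real_distribution \<nu> by fact
  note [measurable] = lcdf_measurable[OF assms(1)] assms(3)
  show ?thesis
    by (rule \<nu>.integrable_const_bound[where B=1]) (use lcdf_bounds[OF assms(1)] in auto)
qed

text \<open>
  Both sides are the probability of \<open>x + y / 2 < t\<close> under the product measure,
  integrated in the two possible orders.
\<close>

lemma lcdf_convolution_swap:
  assumes "real_distribution \<mu>" "real_distribution \<nu>"
  shows "(\<integral>y. lcdf \<mu> (t - y / 2) \<partial>\<nu>) = (\<integral>x. lcdf \<nu> (2 * (t - x)) \<partial>\<mu>)"
proof -
  interpret \<mu>: real_distribution \<mu> by fact
  interpret \<nu>: real_distribution \<nu> by fact
  interpret P: pair_prob_space \<mu> \<nu> ..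
  define k :: "real \<Rightarrow> real \<Rightarrow> real" where "k x y = of_bool (x + y / 2 < t)" for x y
  have 1: "lcdf \<mu> (t - y / 2) = (\<integral>x. k x y \<partial>\<mu>)" for y
  proof -
    have "(\<integral>x. k x y \<partial>\<mu>) = (\<integral>x. indicator {..<t - y / 2} x \<partial>\<mu>)"
      by (rule Bochner_Integration.integral_cong) (auto simp: k_def indicator_def)
    then show ?thesis by (simp add: lcdf_def)
  qed
  have 2: "lcdf \<nu> (2 * (t - x)) = (\<integral>y. k x y \<partial>\<nu>)" for x
  proof -
    have "(\<integral>y. k x y \<partial>\<nu>) = (\<integral>y. indicator {..<2 * (t - x)} y \<partial>\<nu>)"
      by (rule Bochner_Integration.integral_cong) (auto simp: k_def indicator_def)
    then show ?thesis by (simp add: lcdf_def)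
  qed
  have "integrable (\<mu> \<Otimes>\<^sub>M \<nu>) (\<lambda>(x, y). k x y)"
    by (rule P.integrable_const_bound[where B=1]) (auto simp: k_def)
  from P.Fubini_integral[OF this] show ?thesis
    by (simp only: 1 2)
qed

text \<open>
  In the convolution term the measure enters twice, once as distribution function and once as integrator.
  \<open>lcdf_convolution_swap\<close> turns the integrator into a distribution function, so both can be
  exchanged at cost \<open>d\<close>; the square costs \<open>2 * d\<close>.
\<close>

lemma Psi_lipschitz:
  assumes "real_distribution \<mu>" "real_distribution \<nu>"
    and d: "\<And>x. \<bar>lcdf \<mu> x - lcdf \<nu> x\<bar> \<le> d"
  shows "\<bar>Psi \<mu> t - Psi \<nu> t\<bar> \<le> 4 * d"
proof -
  interpret \<mu>: real_distribution \<mu> by fact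
  interpret \<nu>: real_distribution \<nu> by fact
  note i = integrable_lcdf[OF assms(1,1)] integrable_lcdf[OF assms(1,2)]
           integrable_lcdf[OF assms(2,1)] integrable_lcdf[OF assms(2,2)]
  have "\<bar>(lcdf \<mu> t)\<^sup>2 - (lcdf \<nu> t)\<^sup>2\<bar> = \<bar>lcdf \<mu> t - lcdf \<nu> t\<bar> * \<bar>lcdf \<mu> t + lcdf \<nu> t\<bar>"
    by (simp add: power2_eq_square abs_mult[symmetric] algebra_simps)
  also have "\<dots> \<le> d * 2"
    using lcdf_bounds[OF assms(1), of t] lcdf_bounds[OF assms(2), of t] d[of t]
    by (intro mult_mono) auto
  finally have A: "\<bar>(lcdf \<mu> t)\<^sup>2 - (lcdf \<nu> t)\<^sup>2\<bar> \<le> d * 2" .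
  have B: "\<bar>\<integral>y. lcdf \<mu> (g y) \<partial>\<rho> - \<integral>y. lcdf \<nu> (g y) \<partial>\<rho>\<bar> \<le> d"
    if "real_distribution \<rho>" and [measurable]: "g \<in> borel_measurable borel" for \<rho> g
  proof -
    interpret \<rho>: real_distribution \<rho> by fact
    have i: "integrable \<rho> (\<lambda>y. lcdf \<mu> (g y))" "integrable \<rho> (\<lambda>y. lcdf \<nu> (g y))"
      by (rule integrable_lcdf; use assms that in simp)+
    have "\<bar>\<integral>y. lcdf \<mu> (g y) \<partial>\<rho> - \<integral>y. lcdf \<nu> (g y) \<partial>\<rho>\<bar> = \<bar>\<integral>y. lcdf \<mu> (g y) - lcdf \<nu> (g y) \<partial>\<rho>\<bar>"
      using i by simp
    also have "\<dots> \<le> (\<integral>y. \<bar>lcdf \<mu> (g y) - lcdf \<nu> (g y)\<bar> \<partial>\<rho>)"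
      by (rule integral_abs_bound)
    also have "\<dots> \<le> (\<integral>y. d \<partial>\<rho>)"
      using i by (intro integral_mono) (auto intro!: d)
    finally show ?thesis using \<rho>.prob_space by simp
  qed
  have C: "\<bar>\<integral>y. lcdf \<mu> (t - y / 2) \<partial>\<mu> - \<integral>y. lcdf \<nu> (t - y / 2) \<partial>\<mu>\<bar> \<le> d"
    by (rule B) (use assms in auto)
  have "\<bar>\<integral>y. lcdf \<mu> (2 * (t - y)) \<partial>\<nu> - \<integral>y. lcdf \<nu> (2 * (t - y)) \<partial>\<nu>\<bar> \<le> d"
    by (rule B) (use assms in auto)
  then have D: "\<bar>\<integral>y. lcdf \<nu> (t - y / 2) \<partial>\<mu> - \<integral>y. lcdf \<nu> (t - y / 2) \<partial>\<nu>\<bar> \<le> d"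
    by (simp add: lcdf_convolution_swap assms)
  show ?thesis unfolding Psi_def using A C D by linarith
qed

lemma Psi_le_1:
  assumes "real_distribution \<mu>"
  shows "\<bar>Psi \<mu> t\<bar> \<le> 1"
proof -
  interpret real_distribution \<mu> by fact
  have "(\<integral>y. lcdf \<mu> (t - y / 2) \<partial>\<mu>) \<le> 1"
    using integral_mono[OF integrable_lcdf[OF assms assms, of "\<lambda>y. t - y / 2"], of "\<lambda>_. 1"]
      lcdf_bounds[OF assms] prob_space by simp
  moreover have "0 \<le> (\<integral>y. lcdf \<mu> (t - y / 2) \<partial>\<mu>)"
    by (simp add: lcdf_bounds[OF assms])
  moreover have "(lcdf \<mu> t)\<^sup>2 \<le> 1" using lcdf_bounds[OF assms, of t] by (simp add: power_le_one)
  ultimately show ?thesis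
    unfolding Psi_def using prob_space zero_le_power2[of "lcdf \<mu> t"] by linarith
qed

text \<open>
  If \<open>x + y / 2 < t\<close> but not both points lie below \<open>t\<close>, then for
  nonnegative points necessarily \<open>t \<le> y < 2 * t\<close> and \<open>x < t / 2\<close>:
  only such pairs contribute to \<open>- Psi\<close>.
\<close>

lemma neg_Psi_le:
  assumes "real_distribution \<mu>" and nn: "lcdf \<mu> 0 = 0" and True: "0 \<le> t"
  shows "- Psi \<mu> t \<le> lcdf \<mu> (t / 2) * (lcdf \<mu> (2 * t) - lcdf \<mu> t)"
proof -
  interpret real_distribution \<mu> by fact
  have z: "lcdf \<mu> x = 0" if "x \<le> 0" for x
    using lcdf_mono[OF assms(1) that] lcdf_bounds(1)[OF assms(1), of x] nn by simp
  have *: "AE y in \<mu>. y \<ge> 0"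
  proof (rule AE_I)
    show "{x \<in> space \<mu>. \<not> 0 \<le> x} \<subseteq> {..<0}" by auto
    show "emeasure \<mu> {..<0} = 0" using nn by (simp add: lcdf_def emeasure_eq_measure)
  qed simp
  have [simp]: "integrable \<mu> (indicator {..<x} :: real \<Rightarrow> real)" for x
    by (simp add: emeasure_eq_measure)
  from * have "AE y in \<mu>. lcdf \<mu> (t - y / 2) \<le> lcdf \<mu> t * indicator {..<t} y
      + lcdf \<mu> (t / 2) * (indicator {..<2 * t} y - indicator {..<t} y)"
  proof eventually_elim
    case (elim y)
    show ?case
      using lcdf_mono[OF assms(1), of "t - y / 2" t] lcdf_mono[OF assms(1), of "t - y / 2" "t / 2"]
        z[of "t - y / 2"] elim True
      by (auto simp: indicator_def)
  qed
  then have "(\<integral>y. lcdf \<mu> (t - y / 2) \<partial>\<mu>) \<le> (\<integral>y. lcdf \<mu> t * indicator {..<t} y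
      + lcdf \<mu> (t / 2) * (indicator {..<2 * t} y - indicator {..<t} y) \<partial>\<mu>)"
    by (intro integral_mono_AE integrable_lcdf assms) auto
  also have "\<dots> = lcdf \<mu> t * lcdf \<mu> t + lcdf \<mu> (t / 2) * (lcdf \<mu> (2 * t) - lcdf \<mu> t)"
    by (simp add: lcdf_def)
  finally show ?thesis by (simp add: Psi_def power2_eq_square)
qed

text \<open>
  The two factors in \<open>neg_Psi_le\<close> are masses of disjoint sets, so their product is at most
  \<open>h * (1 - h)\<close>.
\<close>

lemma neg_Psi_le_quarter:
  assumes "real_distribution \<mu>" and nn: "lcdf \<mu> 0 = 0" and "0 \<le> t"
  shows "- Psi \<mu> t \<le> 1 / 4"
proof -
  define h where "h = lcdf \<mu> (t / 2)"
  have "h \<le> lcdf \<mu> t" unfolding h_def using assms by (intro lcdf_mono) auto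
  then have le: "lcdf \<mu> (2 * t) - lcdf \<mu> t \<le> 1 - h"
    using lcdf_bounds(2)[OF assms(1), of "2*t"] by simp
  have "- Psi \<mu> t \<le> h * (lcdf \<mu> (2 * t) - lcdf \<mu> t)"
    unfolding h_def by (rule neg_Psi_le) fact+
  also have "\<dots> \<le> h * (1 - h)"
    by (rule mult_left_mono[OF le]) (simp add: h_def lcdf_bounds[OF assms(1)])
  also have "\<dots> \<le> 1 / 4"
    using zero_le_power2[of "h - 1/2"] by (simp add: power2_eq_square algebra_simps)
  finally show ?thesis .
qed

section \<open>Bounded densities with respect to the standard exponential law\<close>

abbreviation Exp1 :: "real measure" where
  "Exp1 \<equiv> density lborel (exponential_density 1)"

lemma real_distribution_Exp1: "real_distribution Exp1"
  using prob_space_exponential_density[of 1]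
  by (simp add: real_distribution_def real_distribution_axioms_def)

interpretation Exp1: real_distribution Exp1
  by (rule real_distribution_Exp1)

lemma AE_Exp1_pos: "AE x in Exp1. 0 < x"
proof -
  have "AE x::real in lborel. x \<noteq> 0" by (rule AE_lborel_singleton)
  then show ?thesis
    by (subst AE_density) (auto simp: exponential_density_def elim: eventually_mono)
qed

lemma AE_Exp1_neq: "AE x in Exp1. x \<noteq> a"
proof -
  have "AE x::real in lborel. x \<noteq> a" by (rule AE_lborel_singleton)
  then show ?thesis
    by (subst AE_density) (auto simp: exponential_density_def elim: eventually_mono)
qed

lemma lcdf_Exp1: "lcdf Exp1 x = (if 0 \<le> x then 1 - exp (- x) else 0)"
proof -
  have "measure Exp1 {..<x} = measure Exp1 {..x}"
    by (rule Exp1.finite_measure_eq_AE) (use AE_Exp1_neq[of x] in \<open>auto elim: eventually_mono\<close>)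
  also have "\<dots> = (if 0 \<le> x then 1 - exp (- x) else 0)"
    by (simp add: measure_def emeasure_erlang_density erlang_CDF_0)
  finally show ?thesis by (simp add: lcdf_def)
qed

definition bdd_meas :: "(real \<Rightarrow> real) \<Rightarrow> bool" where
  "bdd_meas g \<longleftrightarrow> g \<in> borel_measurable borel \<and> (\<exists>C. \<forall>x. \<bar>g x\<bar> \<le> C)"

lemma bdd_measI:
  "g \<in> borel_measurable borel \<Longrightarrow> (\<And>x. \<bar>g x\<bar> \<le> C) \<Longrightarrow> bdd_meas g"
  by (auto simp: bdd_meas_def)

lemma bdd_meas_measurable [measurable_dest]: "bdd_meas g \<Longrightarrow> g \<in> borel_measurable borel"
  by (simp add: bdd_meas_def)

lemma bdd_meas_const [simp, intro]: "bdd_meas (\<lambda>_. c)"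
  by (auto simp: bdd_meas_def)

lemma bdd_meas_add [intro]: "bdd_meas f \<Longrightarrow> bdd_meas g \<Longrightarrow> bdd_meas (\<lambda>x. f x + g x)"
  by (fastforce simp: bdd_meas_def intro: order_trans[OF abs_triangle_ineq] add_mono)

lemma bdd_meas_mult [intro]:
  assumes "bdd_meas f" "bdd_meas g" shows "bdd_meas (\<lambda>x. f x * g x)"
proof -
  obtain C D where "\<And>x. \<bar>f x\<bar> \<le> C" "\<And>x. \<bar>g x\<bar> \<le> D" using assms by (auto simp: bdd_meas_def)
  then have "\<bar>f x * g x\<bar> \<le> C * D" for x
    by (subst abs_mult, intro mult_mono) (auto intro: order_trans[OF abs_ge_zero])
  then show ?thesis using assms by (auto intro!: bdd_measI simp: bdd_meas_def)
qed

lemma bdd_meas_uminus [intro]: "bdd_meas f \<Longrightarrow> bdd_meas (\<lambda>x. - f x)"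
  using bdd_meas_mult[of "\<lambda>_. -1" f] by simp

lemma bdd_meas_diff [intro]: "bdd_meas f \<Longrightarrow> bdd_meas g \<Longrightarrow> bdd_meas (\<lambda>x. f x - g x)"
  using bdd_meas_add[of f "\<lambda>x. - g x"] by auto

lemma bdd_meas_divide [intro]: "bdd_meas f \<Longrightarrow> bdd_meas (\<lambda>x. f x / c)"
  using bdd_meas_mult[of f "\<lambda>_. 1 / c"] by simp

lemma bdd_meas_power [intro]: "bdd_meas f \<Longrightarrow> bdd_meas (\<lambda>x. f x ^ n)"
  by (induction n) auto

lemma bdd_meas_indicator [intro]: "A \<in> sets borel \<Longrightarrow> bdd_meas (indicator A)"
  by (rule bdd_measI[where C=1]) (auto simp: indicator_def)

lemma bdd_meas_compose:
  "bdd_meas f \<Longrightarrow> g \<in> borel_measurable borel \<Longrightarrow> bdd_meas (\<lambda>x. f (g x))"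
  by (auto simp: bdd_meas_def intro: measurable_compose)

lemma bdd_meas_exp [intro]:
  assumes "bdd_meas f" shows "bdd_meas (\<lambda>x. exp (f x))"
proof -
  obtain C where "\<And>x. \<bar>f x\<bar> \<le> C" using assms by (auto simp: bdd_meas_def)
  then have "\<bar>exp (f x)\<bar> \<le> exp C" for x by (simp add: abs_le_iff)
  then show ?thesis using assms by (auto intro!: bdd_measI simp: bdd_meas_def)
qed

lemma abs_xlnx_le:
  fixes x :: real
  assumes "0 \<le> x" shows "\<bar>x * ln x\<bar> \<le> x\<^sup>2 + 1"
proof (cases "x = 0")
  case False
  with assms have x: "0 < x" by simp
  have a: "ln x \<le> x - 1" and b: "ln (1 / x) \<le> 1 / x - 1" using x by (auto intro: ln_le_minus_one)
  have "x * ln x \<le> x * (x - 1)" using a x by (intro mult_left_mono) auto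
  moreover have "x * (- ln x) \<le> x * (1 / x - 1)" using b x by (intro mult_left_mono) (auto simp: ln_div)
  moreover have "x * (1 / x - 1) = 1 - x" using x by (simp add: field_simps)
  ultimately show ?thesis using x by (auto simp: abs_le_iff power2_eq_square algebra_simps)
       (smt (verit) mult_nonneg_nonneg)+
qed simp

lemma bdd_meas_xlnx [intro]:
  assumes "bdd_meas f" and nn: "\<And>x. 0 \<le> f x" shows "bdd_meas (\<lambda>x. f x * ln (f x))"
proof -
  obtain C where C: "\<And>x. \<bar>f x\<bar> \<le> C" using assms by (auto simp: bdd_meas_def)
  have "\<bar>f x * ln (f x)\<bar> \<le> C\<^sup>2 + 1" for x
  proof -
    have "(f x)\<^sup>2 \<le> C\<^sup>2" using C[of x] nn[of x] by (intro power_mono) auto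
    then show ?thesis using abs_xlnx_le[OF nn[of x]] by linarith
  qed
  then show ?thesis using assms by (auto intro!: bdd_measI simp: bdd_meas_def)
qed

lemma integrable_bdd_meas [simp, intro]:
  assumes "bdd_meas g" shows "integrable Exp1 g"
proof -
  obtain C where C: "\<And>x. \<bar>g x\<bar> \<le> C" using assms by (auto simp: bdd_meas_def)
  show ?thesis
    by (rule Exp1.integrable_const_bound[where B=C]) (use assms C in \<open>auto simp: bdd_meas_def\<close>)
qed

text \<open>
  The distribution function of the signed measure with density \<open>g\<close>. Signed densities are
  needed because the differences \<open>f - 1\<close> and the projection itself are inserted into the
  quadratic form.
\<close>

definition cd :: "(real \<Rightarrow> real) \<Rightarrow> real \<Rightarrow> real" where
  "cd g x = (\<integral>y. g y * indicator {..<x} y \<partial>Exp1)"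

lemma cd_nonpos_arg:
  assumes "x \<le> 0" shows "cd g x = 0"
proof -
  have "cd g x = (\<integral>y. 0 \<partial>Exp1)" if [measurable]: "g \<in> borel_measurable borel"
    unfolding cd_def using AE_Exp1_pos assms
    by (intro integral_cong_AE) (auto elim!: eventually_mono simp: indicator_def)
  moreover have "cd g x = 0" if "g \<notin> borel_measurable borel"
  proof -
    have "AE y in Exp1. g y * indicator {..<x} y = 0"
      using AE_Exp1_pos assms by (auto elim!: eventually_mono simp: indicator_def)
    then show ?thesis unfolding cd_def by (rule integral_eq_zero_AE)
  qed
  ultimately show ?thesis by auto
qed

lemma cd_measurable [measurable]: "g \<in> borel_measurable borel \<Longrightarrow> cd g \<in> borel_measurable borel"
proof -
  assume [measurable]: "g \<in> borel_measurable borel"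
  have "(\<lambda>x. \<integral>y. g y * of_bool (y < x) \<partial>Exp1) \<in> borel_measurable borel"
    by measurable
  moreover have "cd g = (\<lambda>x. \<integral>y. g y * of_bool (y < x) \<partial>Exp1)"
    by (auto simp: cd_def fun_eq_iff indicator_def intro!: Bochner_Integration.integral_cong)
  ultimately show ?thesis by simp
qed

lemma integral_bound_bdd:
  assumes "bdd_meas g" "\<And>x. \<bar>g x\<bar> \<le> C" shows "\<bar>\<integral>x. g x \<partial>Exp1\<bar> \<le> C"
proof -
  have "\<bar>\<integral>x. g x \<partial>Exp1\<bar> \<le> (\<integral>x. \<bar>g x\<bar> \<partial>Exp1)" by (rule integral_abs_bound)
  also have "\<dots> \<le> (\<integral>x. C \<partial>Exp1)" using assms by (intro integral_mono) auto
  finally show ?thesis using Exp1.prob_space by simp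
qed

lemma cd_bound:
  assumes "bdd_meas g" "\<And>x. \<bar>g x\<bar> \<le> C" shows "\<bar>cd g x\<bar> \<le> C"
proof -
  have "0 \<le> C" using assms(2)[of 0] by simp
  then show ?thesis unfolding cd_def
    by (intro integral_bound_bdd bdd_meas_mult bdd_meas_indicator assms)
       (use assms in \<open>auto simp: indicator_def\<close>)
qed

lemma bdd_meas_cd [intro]:
  assumes g: "bdd_meas g" shows "bdd_meas (cd g)"
proof -
  from g obtain C where C: "\<And>x. \<bar>g x\<bar> \<le> C" by (auto simp: bdd_meas_def)
  show ?thesis using cd_bound[OF g C] cd_measurable[OF bdd_meas_measurable[OF g]] by (rule_tac bdd_measI)
qed

lemma cd_lin:
  assumes "bdd_meas f" "bdd_meas g"
  shows "cd (\<lambda>x. a * f x + b * g x) x = a * cd f x + b * cd g x"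
proof -
  have [simp]: "integrable Exp1 (\<lambda>y. f y * indicator {..<x} y)"
       "integrable Exp1 (\<lambda>y. g y * indicator {..<x} y)"
    by (intro integrable_bdd_meas bdd_meas_mult bdd_meas_indicator assms; simp)+
  have "cd (\<lambda>x. a * f x + b * g x) x
      = (\<integral>y. a * (f y * indicator {..<x} y) + b * (g y * indicator {..<x} y) \<partial>Exp1)"
    by (simp add: cd_def algebra_simps)
  then show ?thesis by (simp add: cd_def)
qed

text \<open>
  The version of \<open>lcdf_convolution_swap\<close> for signed densities; it makes the bilinear form
  symmetric.
\<close>

lemma cd_swap:
  assumes g: "bdd_meas g" and h: "bdd_meas h"
  shows "(\<integral>y. h y * cd g (t - y / 2) \<partial>Exp1) = (\<integral>x. g x * cd h (2 * (t - x)) \<partial>Exp1)"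
proof -
  interpret P: pair_prob_space Exp1 Exp1 ..
  note [measurable] = bdd_meas_measurable[OF g] bdd_meas_measurable[OF h]
  obtain C D where C: "\<And>x. \<bar>g x\<bar> \<le> C" and D: "\<And>x. \<bar>h x\<bar> \<le> D"
    using g h by (auto simp: bdd_meas_def)
  define k :: "real \<Rightarrow> real \<Rightarrow> real" where "k x y = g x * (h y * of_bool (x + y / 2 < t))" for x y
  have 1: "h y * cd g (t - y / 2) = (\<integral>x. k x y \<partial>Exp1)" for y
  proof -
    have "h y * cd g (t - y / 2) = (\<integral>x. h y * (g x * indicator {..<t - y / 2} x) \<partial>Exp1)"
      unfolding cd_def by (rule integral_mult_right_zero[symmetric])
    also have "\<dots> = (\<integral>x. k x y \<partial>Exp1)"
      by (rule Bochner_Integration.integral_cong) (auto simp: k_def indicator_def)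
    finally show ?thesis .
  qed
  have 2: "g x * cd h (2 * (t - x)) = (\<integral>y. k x y \<partial>Exp1)" for x
  proof -
    have "g x * cd h (2 * (t - x)) = (\<integral>y. g x * (h y * indicator {..<2 * (t - x)} y) \<partial>Exp1)"
      unfolding cd_def by (rule integral_mult_right_zero[symmetric])
    also have "\<dots> = (\<integral>y. k x y \<partial>Exp1)"
      by (rule Bochner_Integration.integral_cong) (auto simp: k_def indicator_def)
    finally show ?thesis .
  qed
  have "\<bar>k x y\<bar> \<le> C * D" for x y
  proof -
    have "\<bar>g x\<bar> * \<bar>h y * of_bool (x + y / 2 < t)\<bar> \<le> C * D"
      using C D by (intro mult_mono) (auto intro: order_trans[OF abs_ge_zero])
    then show ?thesis by (simp add: k_def abs_mult)
  qed
  then have "integrable (Exp1 \<Otimes>\<^sub>M Exp1) (\<lambda>(x, y). k x y)"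
    by (intro P.integrable_const_bound[where B="C * D"]) (auto simp: k_def)
  then have "(\<integral>y. \<integral>x. k x y \<partial>Exp1 \<partial>Exp1) = (\<integral>x. \<integral>y. k x y \<partial>Exp1 \<partial>Exp1)"
    by (rule P.Fubini_integral)
  then show ?thesis
    unfolding 1 2 .
qed

lemma bdd_meas_cd_compose [intro]:
  assumes "bdd_meas g" "h \<in> borel_measurable borel" shows "bdd_meas (\<lambda>s. cd g (h s))"
  by (rule bdd_meas_compose[OF bdd_meas_cd]) fact+

text \<open>
  Polarization of \<open>Psi\<close>: \<open>Bil t\<close> is the symmetric bilinear form with
  \<open>Psi = Bil t f f\<close> for the law with density \<open>f\<close> (\<open>Psi_law\<close>),
  and \<open>Xi t g\<close> is the function that represents \<open>Bil t g\<close> in its second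
  argument. For \<open>g = 1\<close> it is \<open>xi2\<close> (\<open>xi2_eq_Xi\<close>). The factors
  that \<open>xi2\<close> needs in front of the other two terms are absent here because
  \<open>cd g\<close> vanishes at nonpositive arguments.
\<close>

definition Xi :: "real \<Rightarrow> (real \<Rightarrow> real) \<Rightarrow> real \<Rightarrow> real" where
  "Xi t g s = indicator {..<t} s * cd g t - cd g (2 * (t - s)) / 2 - cd g (t - s / 2) / 2"

definition Bil :: "real \<Rightarrow> (real \<Rightarrow> real) \<Rightarrow> (real \<Rightarrow> real) \<Rightarrow> real" where
  "Bil t g h = (\<integral>s. h s * Xi t g s \<partial>Exp1)"

lemma bdd_meas_Xi [intro]: "bdd_meas g \<Longrightarrow> bdd_meas (Xi t g)"
proof -
  assume g: "bdd_meas g"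
  have "bdd_meas (\<lambda>s. indicator {..<t} s * cd g t - cd g (2 * (t - s)) / 2 - cd g (t - s / 2) / 2)"
    by (intro bdd_meas_diff bdd_meas_mult bdd_meas_indicator bdd_meas_const bdd_meas_divide
        bdd_meas_cd_compose g) auto
  then show ?thesis by (simp add: Xi_def[abs_def])
qed

lemma integral_diff_halves:
  assumes "bdd_meas f" "bdd_meas g" "bdd_meas h"
  shows "(\<integral>x. f x - g x / 2 - h x / 2 \<partial>Exp1)
    = (\<integral>x. f x \<partial>Exp1) - (\<integral>x. g x \<partial>Exp1) / 2 - (\<integral>x. h x \<partial>Exp1) / 2"
  using assms[THEN integrable_bdd_meas] by simp

lemma Bil_expand:
  assumes g: "bdd_meas g" and h: "bdd_meas h"
  shows "Bil t g h = cd h t * cd g t - (\<integral>s. h s * cd g (2 * (t - s)) \<partial>Exp1) / 2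
            - (\<integral>s. h s * cd g (t - s / 2) \<partial>Exp1) / 2"
proof -
  define u v w where "u s = (h s * indicator {..<t} s) * cd g t"
    and "v s = h s * cd g (2 * (t - s))" and "w s = h s * cd g (t - s / 2)" for s
  have b: "bdd_meas u" unfolding u_def
    by (intro bdd_meas_mult bdd_meas_indicator bdd_meas_const h) simp
  have c: "bdd_meas v" unfolding v_def
    by (intro bdd_meas_mult bdd_meas_cd_compose g h) simp
  have d: "bdd_meas w" unfolding w_def
    by (intro bdd_meas_mult bdd_meas_cd_compose g h) simp
  have "Bil t g h = (\<integral>s. u s - v s / 2 - w s / 2 \<partial>Exp1)"
    unfolding Bil_def Xi_def u_def v_def w_def
    by (rule Bochner_Integration.integral_cong) (auto simp: right_diff_distrib)
  also have "\<dots> = (\<integral>s. u s \<partial>Exp1) - (\<integral>s. v s \<partial>Exp1) / 2 - (\<integral>s. w s \<partial>Exp1) / 2"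
    by (rule integral_diff_halves) fact+
  also have "(\<integral>s. u s \<partial>Exp1) = cd h t * cd g t"
    unfolding u_def cd_def by (rule integral_mult_left_zero)
  finally show ?thesis unfolding v_def w_def .
qed

lemma Bil_commute:
  assumes g: "bdd_meas g" and h: "bdd_meas h"
  shows "Bil t g h = Bil t h g"
  unfolding Bil_expand[OF g h] Bil_expand[OF h g] cd_swap[OF g h] cd_swap[OF h g]
  by simp

lemma bdd_meas_lin: "bdd_meas f \<Longrightarrow> bdd_meas g \<Longrightarrow> bdd_meas (\<lambda>x. a * f x + b * g x)"
  by (intro bdd_meas_add bdd_meas_mult bdd_meas_const)

lemma Bil_lin:
  assumes "bdd_meas f" "bdd_meas g" "bdd_meas h"
  shows "Bil t h (\<lambda>x. a * f x + b * g x) = a * Bil t h f + b * Bil t h g"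
proof -
  have [simp]: "integrable Exp1 (\<lambda>s. f s * Xi t h s)" "integrable Exp1 (\<lambda>s. g s * Xi t h s)"
    by (intro integrable_bdd_meas bdd_meas_mult bdd_meas_Xi assms)+
  have "Bil t h (\<lambda>x. a * f x + b * g x) = (\<integral>s. a * (f s * Xi t h s) + b * (g s * Xi t h s) \<partial>Exp1)"
    by (simp add: Bil_def algebra_simps)
  then show ?thesis by (simp add: Bil_def)
qed

lemma Bil_quad:
  assumes f: "bdd_meas f" and g: "bdd_meas g"
  shows "Bil t (\<lambda>x. a * f x + b * g x) (\<lambda>x. a * f x + b * g x)
      = a\<^sup>2 * Bil t f f + 2 * a * b * Bil t f g + b\<^sup>2 * Bil t g g"
proof -
  have fg: "bdd_meas (\<lambda>x. a * f x + b * g x)" using f g by (rule bdd_meas_lin)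
  show ?thesis
    unfolding Bil_lin[OF f g fg] Bil_commute[OF fg f] Bil_commute[OF fg g]
      Bil_lin[OF f g f] Bil_lin[OF f g g] Bil_commute[OF g f]
    by (simp add: power2_eq_square algebra_simps)
qed

definition dens :: "(real \<Rightarrow> real) \<Rightarrow> bool" where
  "dens f \<longleftrightarrow> bdd_meas f \<and> (\<forall>x. 0 \<le> f x) \<and> (\<integral>x. f x \<partial>Exp1) = 1"

lemma densD:
  assumes "dens f"
  shows "bdd_meas f" "f \<in> borel_measurable borel" "\<And>x. 0 \<le> f x" "(\<integral>x. f x \<partial>Exp1) = 1"
    "integrable Exp1 f"
  using assms by (auto simp: dens_def)

definition law :: "(real \<Rightarrow> real) \<Rightarrow> real measure" where
  "law f = density Exp1 f"

lemma real_distribution_law: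
  assumes "dens f" shows "real_distribution (law f)"
proof -
  note d = densD[OF assms]
  have "emeasure (law f) UNIV = (\<integral>\<^sup>+x. f x \<partial>Exp1)"
    unfolding law_def using d(2) by (subst emeasure_density) (auto)
  also have "\<dots> = 1" using d by (subst nn_integral_eq_integral) auto
  finally have "prob_space (law f)" by (intro prob_spaceI) (simp add: law_def)
  then show ?thesis by (simp add: real_distribution_def real_distribution_axioms_def law_def)
qed

lemma integral_law:
  assumes "dens f" "h \<in> borel_measurable borel"
  shows "(\<integral>x. h x \<partial>law f) = (\<integral>x. f x * h x \<partial>Exp1)"
  unfolding law_def using densD[OF assms(1)] assms(2)
  by (subst integral_density) auto

lemma lcdf_law: "dens f \<Longrightarrow> lcdf (law f) x = cd f x"
  using integral_law[of f "indicator {..<x}"] real_distribution.space_eq_univ[OF real_distribution_law]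
  by (simp add: lcdf_def cd_def)

lemma measure_law: "dens f \<Longrightarrow> A \<in> sets borel \<Longrightarrow> measure (law f) A = (\<integral>x. f x * indicator A x \<partial>Exp1)"
  using integral_law[of f "indicator A"] real_distribution.space_eq_univ[OF real_distribution_law]
  by simp

lemma Psi_law:
  assumes "dens f" shows "Psi (law f) t = Bil t f f"
proof -
  note d = densD[OF assms]
  have "(\<integral>y. lcdf (law f) (t - y / 2) \<partial>law f) = (\<integral>y. f y * cd f (t - y / 2) \<partial>Exp1)"
    unfolding lcdf_law[OF assms]
    by (rule integral_law[OF assms]) (use d in measurable)
  then show ?thesis
    unfolding Psi_def Bil_expand[OF d(1) d(1)] cd_swap[OF d(1) d(1)] lcdf_law[OF assms]
    by (simp add: power2_eq_square)
qed

lemma cd_dens: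
  assumes "dens f"
  shows "0 \<le> cd f x" "cd f x \<le> 1" "x \<le> y \<Longrightarrow> cd f x \<le> cd f y" "x \<le> 0 \<Longrightarrow> cd f x = 0"
  using lcdf_bounds[OF real_distribution_law[OF assms]] lcdf_mono[OF real_distribution_law[OF assms]]
  by (auto simp: lcdf_law[OF assms] cd_nonpos_arg)

section \<open>Relative entropy\<close>

definition KL :: "(real \<Rightarrow> real) \<Rightarrow> real" where
  "KL f = (\<integral>x. f x * ln (f x) \<partial>Exp1)"

text \<open>
  The Legendre duality of \<open>x * ln x - x\<close> and \<open>exp\<close>. Integrated, it gives the
  variational bound on relative entropy that carries all the entropy estimates below.
\<close>

lemma young_xlnx:
  fixes x z :: real
  assumes "0 \<le> x" shows "x * z \<le> x * ln x - x + exp z"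
proof (cases "x = 0")
  case False
  with assms have x: "0 < x" by simp
  have "1 + (z - ln x) \<le> exp (z - ln x)" by (rule exp_ge_add_one_self)
  then have "x * (1 + (z - ln x)) \<le> x * exp (z - ln x)" using x by (intro mult_left_mono) auto
  also have "\<dots> = exp z" using x by (simp add: exp_diff)
  finally show ?thesis by (simp add: algebra_simps)
qed simp

lemma KL_young:
  assumes f: "dens f" and p: "bdd_meas \<phi>"
  shows "(\<integral>x. f x * \<phi> x \<partial>Exp1) \<le> KL f - 1 + (\<integral>x. exp (\<phi> x) \<partial>Exp1)"
proof -
  note d = densD[OF f]
  have b: "bdd_meas (\<lambda>x. f x * ln (f x))" "bdd_meas (\<lambda>x. exp (\<phi> x))" "bdd_meas (\<lambda>x. f x * \<phi> x)"
    using d p by auto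
  have "(\<integral>x. f x * \<phi> x \<partial>Exp1) \<le> (\<integral>x. f x * ln (f x) - f x + exp (\<phi> x) \<partial>Exp1)"
    by (rule integral_mono)
       (use b d in \<open>auto intro!: young_xlnx Bochner_Integration.integrable_add Bochner_Integration.integrable_diff\<close>)
  also have "\<dots> = KL f - 1 + (\<integral>x. exp (\<phi> x) \<partial>Exp1)"
    using b d by (simp add: KL_def)
  finally show ?thesis .
qed

lemma KL_nonneg: "dens f \<Longrightarrow> 0 \<le> KL f"
  using KL_young[of f "\<lambda>_. 0"] Exp1.prob_space by simp

lemma xlnx_tangent:
  fixes x z :: real
  assumes "0 \<le> x" "0 < z" shows "x * ln z + x - z \<le> x * ln x"
  using young_xlnx[OF assms(1), of "ln z"] assms(2) by simp

lemma xlnx_convex: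
  fixes x y :: real
  assumes "0 \<le> x" "0 \<le> y" "0 \<le> a" "0 \<le> b" "a + b = 1"
  shows "(a * x + b * y) * ln (a * x + b * y) \<le> a * (x * ln x) + b * (y * ln y)"
proof (cases "a * x + b * y = 0")
  case True
  then have "a * x = 0" "b * y = 0" using assms by (smt (verit) mult_nonneg_nonneg)+
  then show ?thesis by auto
next
  case False
  define z where "z = a * x + b * y"
  have z: "0 < z" using False assms by (smt (verit) mult_nonneg_nonneg z_def)
  have "a * (x * ln z + x - z) + b * (y * ln z + y - z) \<le> a * (x * ln x) + b * (y * ln y)"
    using assms z by (intro add_mono mult_left_mono xlnx_tangent)
  moreover have "a * (x * ln z + x - z) + b * (y * ln z + y - z) = z * ln z + z - (a + b) * z"
    by (simp add: z_def algebra_simps)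
  ultimately show ?thesis using assms(5) by (simp add: z_def[symmetric])
qed

lemma dens_mix:
  assumes "dens f" "dens g" "0 \<le> a" "0 \<le> b" "a + b = 1"
  shows "dens (\<lambda>x. a * f x + b * g x)"
  using assms densD[OF assms(1)] densD[OF assms(2)] bdd_meas_lin[of f g a b]
  by (simp add: dens_def)

lemma KL_mix:
  assumes "dens f" "dens g" "0 \<le> a" "0 \<le> b" "a + b = 1"
  shows "KL (\<lambda>x. a * f x + b * g x) \<le> a * KL f + b * KL g"
proof -
  note d = densD[OF assms(1)] densD[OF assms(2)] densD[OF dens_mix[OF assms]]
  have b: "bdd_meas (\<lambda>x. f x * ln (f x))" "bdd_meas (\<lambda>x. g x * ln (g x))"
    "bdd_meas (\<lambda>x. (a * f x + b * g x) * ln (a * f x + b * g x))"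
    using d by (auto intro!: bdd_meas_xlnx)
  have "KL (\<lambda>x. a * f x + b * g x) \<le> (\<integral>x. a * (f x * ln (f x)) + b * (g x * ln (g x)) \<partial>Exp1)"
    unfolding KL_def using b d assms by (intro integral_mono) (auto intro!: xlnx_convex)
  also have "\<dots> = a * KL f + b * KL g" using b by (simp add: KL_def)
  finally show ?thesis .
qed

section \<open>Strict improvement of the functional at small entropy cost\<close>

lemma integral_interval:
  assumes f: "bdd_meas f" and "a \<le> b"
  shows "(\<integral>x. f x * indicator {a..<b} x \<partial>Exp1) = cd f b - cd f a"
proof -
  have i: "integrable Exp1 (\<lambda>y. f y * indicator {..<x} y)" for x
    by (intro integrable_bdd_meas bdd_meas_mult bdd_meas_indicator f) simp
  have "cd f b - cd f a = (\<integral>y. f y * indicator {..<b} y - f y * indicator {..<a} y \<partial>Exp1)"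
    unfolding cd_def by (rule Bochner_Integration.integral_diff[symmetric]; rule i)
  also have "\<dots> = (\<integral>x. f x * indicator {a..<b} x \<partial>Exp1)"
    using assms(2) by (intro Bochner_Integration.integral_cong) (auto simp: indicator_def)
  finally show ?thesis by simp
qed

lemma cd_one: "cd (\<lambda>_. 1) x = (if 0 \<le> x then 1 - exp (- x) else 0)"
  using lcdf_Exp1[of x] Exp1.space_eq_univ by (simp add: cd_def lcdf_def)

lemma dens_one: "dens (\<lambda>_. 1)"
  using Exp1.prob_space by (simp add: dens_def)

lemma KL_one: "KL (\<lambda>_. 1) = 0"
  by (simp add: KL_def)

lemma measure_Exp1_interval:
  assumes "0 \<le> a" "a \<le> b"
  shows "measure Exp1 {a..<b} = exp (- a) - exp (- b)"
proof -
  have "measure Exp1 {a..<b} = (\<integral>x. 1 * indicator {a..<b} x \<partial>Exp1)"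
    using Exp1.space_eq_univ by simp
  also have "\<dots> = cd (\<lambda>_. 1) b - cd (\<lambda>_. 1) a" by (rule integral_interval) (use assms in auto)
  finally show ?thesis using assms by (simp add: cd_one)
qed

lemma exp_diff_bounds:
  fixes a b :: real
  assumes "a \<le> b"
  shows "(b - a) * exp (- b) \<le> exp (- a) - exp (- b)" "exp (- a) - exp (- b) \<le> (b - a) * exp (- a)"
proof -
  have "(1 + (b - a)) * exp (- b) \<le> exp (b - a) * exp (- b)"
    by (intro mult_right_mono) auto
  also have "\<dots> = exp (- a)" by (simp add: exp_add[symmetric])
  finally show "(b - a) * exp (- b) \<le> exp (- a) - exp (- b)" by (simp add: algebra_simps)
  have "(1 + (a - b)) * exp (- a) \<le> exp (a - b) * exp (- a)"
    by (intro mult_right_mono) auto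
  also have "\<dots> = exp (- b)" by (simp add: exp_add[symmetric])
  finally show "exp (- a) - exp (- b) \<le> (b - a) * exp (- a)" by (simp add: algebra_simps)
qed

text \<open>
  Young's inequality for \<open>\<theta> * indicator A\<close>: a set of tiny exponential mass has small
  mass under every density of bounded entropy.
\<close>

lemma mass_le:
  assumes f: "dens f" and A: "A \<in> sets borel" and th: "0 \<le> \<theta>" and le: "measure Exp1 A \<le> exp (- \<theta>)"
  shows "\<theta> * (\<integral>x. f x * indicator A x \<partial>Exp1) \<le> KL f + 1"
proof -
  have b: "bdd_meas (\<lambda>x. \<theta> * indicator A x)"
    by (intro bdd_meas_mult bdd_meas_const bdd_meas_indicator A)
  have iA: "integrable Exp1 (indicator A :: real \<Rightarrow> real)" by (intro integrable_bdd_meas bdd_meas_indicator A)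
  have "\<theta> * (\<integral>x. f x * indicator A x \<partial>Exp1) = (\<integral>x. f x * (\<theta> * indicator A x) \<partial>Exp1)"
    by (subst integral_mult_right_zero[symmetric]) (simp add: mult.left_commute)
  also have "\<dots> \<le> KL f - 1 + (\<integral>x. exp (\<theta> * indicator A x) \<partial>Exp1)"
    by (rule KL_young[OF f b])
  also have "(\<integral>x. exp (\<theta> * indicator A x) \<partial>Exp1) = (\<integral>x. 1 + (exp \<theta> - 1) * indicator A x \<partial>Exp1)"
    by (rule Bochner_Integration.integral_cong) (auto simp: indicator_def)
  also have "\<dots> = 1 + (exp \<theta> - 1) * measure Exp1 A"
    using iA Exp1.space_eq_univ Exp1.prob_space by simp
  also have "(exp \<theta> - 1) * measure Exp1 A \<le> exp \<theta> * exp (- \<theta>)"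
    using th le by (intro mult_mono) auto
  also have "exp \<theta> * exp (- \<theta>) = 1" by (simp add: exp_add[symmetric])
  finally show ?thesis by simp
qed

text \<open>
  The contrapositive of \<open>mass_le\<close> with \<open>\<theta> = (K + 2) / a\<close>. It
  confines the relevant \<open>t\<close> to a compact interval that depends on the entropy bound only.
\<close>

lemma mass_ge:
  assumes f: "dens f" and A: "A \<in> sets borel" and K: "KL f \<le> K" and a: "0 < a"
    and m: "a \<le> (\<integral>x. f x * indicator A x \<partial>Exp1)"
  shows "exp (- ((K + 2) / a)) \<le> measure Exp1 A"
proof (rule ccontr)
  assume "\<not> ?thesis"
  then have le: "measure Exp1 A \<le> exp (- ((K + 2) / a))" by simp
  have K0: "0 \<le> K" using KL_nonneg[OF f] K by simp
  have "(K + 2) / a * a \<le> (K + 2) / a * (\<integral>x. f x * indicator A x \<partial>Exp1)"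
    using m K0 a by (intro mult_left_mono) auto
  also have "\<dots> \<le> KL f + 1" using K0 a by (intro mass_le f A le) auto
  finally show False using a K by simp
qed

definition cond_dens :: "real set \<Rightarrow> (real \<Rightarrow> real) \<Rightarrow> real \<Rightarrow> real" where
  "cond_dens A g x = g x * indicator A x / (\<integral>x. g x * indicator A x \<partial>Exp1)"

text \<open>
  Conditioning keeps the entropy under control: on \<open>A\<close> the density is multiplied by
  \<open>1 / M\<close>, which adds \<open>ln (1 / M)\<close>, and dropping the complement of
  \<open>A\<close> loses at most 1 because \<open>x * ln x \<ge> - 1\<close>.
\<close>

lemma cond_dens:
  assumes g: "dens g" and A: "A \<in> sets borel" and m0: "0 < m0"
    and m: "m0 \<le> (\<integral>x. g x * indicator A x \<partial>Exp1)"
  shows "dens (cond_dens A g)" "KL (cond_dens A g) \<le> (KL g + 1) / m0 + ln (1 / m0)"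
proof -
  define M where "M = (\<integral>x. g x * indicator A x \<partial>Exp1)"
  note d = densD[OF g]
  have M: "0 < M" "m0 \<le> M" using m m0 by (auto simp: M_def)
  have b: "bdd_meas (\<lambda>x. g x * indicator A x)"
    by (intro bdd_meas_mult bdd_meas_indicator d A)
  have c: "cond_dens A g x = g x * indicator A x / M" for x by (simp add: cond_dens_def M_def)
  have bc: "bdd_meas (cond_dens A g)" unfolding c[abs_def] by (intro bdd_meas_divide b)
  show D: "dens (cond_dens A g)"
    unfolding dens_def
  proof (intro conjI allI bc)
    show "0 \<le> cond_dens A g x" for x using d(3) M by (simp add: c)
    have "(\<integral>x. cond_dens A g x \<partial>Exp1) = (\<integral>x. g x * indicator A x \<partial>Exp1) / M"
      unfolding c by (rule integral_divide_zero)
    then show "(\<integral>x. cond_dens A g x \<partial>Exp1) = 1" using M by (simp add: M_def[symmetric])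
  qed
  have "cond_dens A g x * ln (cond_dens A g x) \<le> (g x * ln (g x) + 1) / M + ln (1 / M) * cond_dens A g x" for x
  proof -
    have p: "- 1 \<le> g x * ln (g x)" using xlnx_tangent[of "g x" 1] d(3)[of x] by simp
    consider "x \<notin> A" | "g x = 0" | "x \<in> A" "0 < g x" using d(3)[of x] by fastforce
    then show ?thesis
    proof cases
      case 1 then show ?thesis using p M by (simp add: c)
    next
      case 2 then show ?thesis using M by (simp add: c)
    next
      case 3
      then have "cond_dens A g x * ln (cond_dens A g x) = g x * ln (g x) / M + ln (1 / M) * cond_dens A g x"
        using M by (simp add: c ln_div field_simps)
      then show ?thesis using M by (simp add: add_divide_distrib)
    qed
  qed
  then have "KL (cond_dens A g) \<le> (\<integral>x. (g x * ln (g x) + 1) / M + ln (1 / M) * cond_dens A g x \<partial>Exp1)"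
    unfolding KL_def
    by (intro integral_mono integrable_bdd_meas bdd_meas_xlnx bdd_meas_add bdd_meas_divide
        bdd_meas_mult bdd_meas_const bc d densD(3)[OF D]) auto
  also have "\<dots> = (KL g + 1) / M + ln (1 / M)"
    using integrable_bdd_meas[OF bdd_meas_xlnx[OF d(1) d(3)]] densD[OF D] Exp1.prob_space
    by (simp add: KL_def)
  also have "\<dots> \<le> (KL g + 1) / m0 + ln (1 / m0)"
    using M m0 KL_nonneg[OF g] by (intro add_mono divide_left_mono) (auto simp: field_simps)
  finally show "KL (cond_dens A g) \<le> (KL g + 1) / m0 + ln (1 / m0)" .
qed

lemma Bil_cond_dens_ge:
  assumes f: "dens f" and g: "dens g" and A: "A \<in> sets borel"
    and M: "0 < (\<integral>x. g x * indicator A x \<partial>Exp1)"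
    and ge: "\<And>s. s \<in> A \<Longrightarrow> \<beta> \<le> \<sigma> * Xi t f s"
  shows "\<beta> \<le> \<sigma> * Bil t f (cond_dens A g)"
proof -
  define r where "r = cond_dens A g"
  note D = cond_dens(1)[OF g A M order_refl, folded r_def]
  note d = densD[OF D]
  have bX: "bdd_meas (\<lambda>x. r x * (\<sigma> * Xi t f x))"
    by (intro bdd_meas_mult bdd_meas_const bdd_meas_Xi d densD[OF f])
  have "\<beta> = (\<integral>x. r x * \<beta> \<partial>Exp1)" using d by simp
  also have "\<dots> \<le> (\<integral>x. r x * (\<sigma> * Xi t f x) \<partial>Exp1)"
  proof (intro integral_mono integrable_bdd_meas bX bdd_meas_mult d bdd_meas_const)
    fix x show "r x * \<beta> \<le> r x * (\<sigma> * Xi t f x)"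
    proof (cases "x \<in> A")
      case True then show ?thesis using d(3)[of x] ge[of x] by (intro mult_left_mono)
    qed (simp add: r_def cond_dens_def)
  qed
  also have "\<dots> = \<sigma> * Bil t f r"
    unfolding Bil_def by (subst integral_mult_right_zero[symmetric]) (simp add: mult.left_commute)
  finally show ?thesis by (simp add: r_def)
qed

lemma cd_cond_dens:
  assumes g: "dens g" and A: "A \<in> sets borel" and M: "0 < (\<integral>x. g x * indicator A x \<partial>Exp1)"
  shows "(\<And>s. s \<in> A \<Longrightarrow> x \<le> s) \<Longrightarrow> cd (cond_dens A g) x = 0"
    and "(\<And>s. s \<in> A \<Longrightarrow> s < x) \<Longrightarrow> cd (cond_dens A g) x = 1"
proof -
  assume "\<And>s. s \<in> A \<Longrightarrow> x \<le> s"
  then have "(\<lambda>y. cond_dens A g y * indicator {..<x} y) = (\<lambda>y. 0)"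
    by (force simp: cond_dens_def indicator_def)
  then show "cd (cond_dens A g) x = 0" by (simp add: cd_def)
next
  assume "\<And>s. s \<in> A \<Longrightarrow> s < x"
  then have "(\<lambda>y. cond_dens A g y * indicator {..<x} y) = cond_dens A g"
    by (force simp: cond_dens_def indicator_def)
  then show "cd (cond_dens A g) x = 1"
    using densD(4)[OF cond_dens(1)[OF g A M order_refl]] by (simp add: cd_def)
qed

text \<open>
  If both points lie in \<open>[3 t / 4, t)\<close>, then their maximum is below \<open>t\<close> while
  \<open>x + y / 2\<close> is not: the largest possible value of \<open>Psi\<close> is attained.
\<close>

lemma Bil_cond_dens_self:
  assumes g: "dens g" and M: "0 < (\<integral>x. g x * indicator {3 * t / 4..<t} x \<partial>Exp1)" and t: "0 \<le> t"
  shows "Bil t (cond_dens {3 * t / 4..<t} g) (cond_dens {3 * t / 4..<t} g) = 1"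
proof -
  define r where "r = cond_dens {3 * t / 4..<t} g"
  have "{3 * t / 4..<t} \<in> sets borel" by simp
  note D = cond_dens(1)[OF g this M order_refl, folded r_def]
  note c = cd_cond_dens[OF g _ M, folded r_def]
  have "r s * Xi t r s = r s" for s
  proof (cases "s \<in> {3 * t / 4..<t}")
    case True
    then have "cd r (2 * (t - s)) = 0" "cd r (t - s / 2) = 0" "cd r t = 1"
      using t by (intro c; auto)+
    then show ?thesis using True by (simp add: Xi_def)
  qed (simp add: r_def cond_dens_def)
  then have "Bil t r r = 1" unfolding Bil_def using densD(4)[OF D] by presburger
  then show ?thesis by (simp add: r_def)
qed

lemma Bil_self:
  assumes "bdd_meas f"
  shows "Bil t f f = (cd f t)\<^sup>2 - (\<integral>y. f y * cd f (t - y / 2) \<partial>Exp1)"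
  unfolding Bil_expand[OF assms assms] cd_swap[OF assms assms] by (simp add: power2_eq_square)

lemma Xi_dens_mono:
  assumes f: "dens f" shows "s \<le> s' \<Longrightarrow> s' < t \<Longrightarrow> Xi t f s \<le> Xi t f s'"
  using cd_dens(3)[OF f, of "2 * (t - s')" "2 * (t - s)"] cd_dens(3)[OF f, of "t - s' / 2" "t - s / 2"]
  by (simp add: Xi_def)

lemma Xi_dens_nonpos:
  assumes f: "dens f" shows "t \<le> s \<Longrightarrow> Xi t f s \<le> 0"
  using cd_dens(1)[OF f, of "2 * (t - s)"] cd_dens(1)[OF f, of "t - s / 2"] by (simp add: Xi_def)

lemma Xi_dens_le_1:
  assumes f: "dens f" shows "\<bar>Xi t f s\<bar> \<le> 1"
  using cd_dens(1,2)[OF f, of t] cd_dens(1,2)[OF f, of "2 * (t - s)"] cd_dens(1,2)[OF f, of "t - s / 2"]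
  by (auto simp: Xi_def indicator_def abs_le_iff)


text \<open>
  Lower bounds for the convolution term: pairs with \<open>x < t / 2\<close> and \<open>y < t\<close>
  have \<open>x + y / 2 < t\<close>, and so have pairs with
  \<open>t / 2 \<le> x < 5 t / 8\<close> and \<open>y < 3 t / 4\<close>.
\<close>

lemma Bil_self_le:
  assumes f: "dens f" and t: "0 \<le> t"
  shows "Bil t f f \<le> cd f t * (cd f t - cd f (t / 2))"
    and "Bil t f f \<le> cd f t * (cd f t - cd f (t / 2))
          - (cd f (5 * t / 8) - cd f (t / 2)) * cd f (3 * t / 4)"
proof -
  note d = densD[OF f] and m = cd_dens[OF f]
  define q h m2 v where "q = cd f t" and "h = cd f (t / 2)"
    and "m2 = cd f (5 * t / 8) - cd f (t / 2)" and "v = cd f (3 * t / 4)"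
  have i: "integrable Exp1 (\<lambda>y. f y * indicator {..<x} y)" for x
    by (intro integrable_bdd_meas bdd_meas_mult bdd_meas_indicator d) simp
  have "(\<integral>y. f y * indicator {..<t} y * h + f y * indicator {..<3 * t / 4} y * m2 \<partial>Exp1)
      \<le> (\<integral>y. f y * cd f (t - y / 2) \<partial>Exp1)"
  proof (intro integral_mono Bochner_Integration.integrable_add integrable_mult_left i)
    show "integrable Exp1 (\<lambda>y. f y * cd f (t - y / 2))"
      by (intro integrable_bdd_meas bdd_meas_mult d bdd_meas_cd_compose) simp
    fix y
    have "indicator {..<t} y * h + indicator {..<3 * t / 4} y * m2 \<le> cd f (t - y / 2)"
      using m(1)[of "t - y / 2"] m(3)[of "t / 2" "t - y / 2"] m(3)[of "5 * t / 8" "t - y / 2"] t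
      by (auto simp: indicator_def h_def m2_def)
    then have "f y * (indicator {..<t} y * h + indicator {..<3 * t / 4} y * m2) \<le> f y * cd f (t - y / 2)"
      using d(3) by (intro mult_left_mono)
    then show "f y * indicator {..<t} y * h + f y * indicator {..<3 * t / 4} y * m2 \<le> f y * cd f (t - y / 2)"
      by (simp add: algebra_simps)
  qed
  also have "(\<integral>y. f y * indicator {..<t} y * h + f y * indicator {..<3 * t / 4} y * m2 \<partial>Exp1)
      = q * h + v * m2"
    using i by (simp add: q_def v_def cd_def)
  finally have S: "q * h + v * m2 \<le> (\<integral>y. f y * cd f (t - y / 2) \<partial>Exp1)" .
  show 1: "Bil t f f \<le> cd f t * (cd f t - cd f (t / 2))
          - (cd f (5 * t / 8) - cd f (t / 2)) * cd f (3 * t / 4)"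
    using S unfolding Bil_self[OF d(1)] q_def h_def m2_def v_def
    by (simp add: power2_eq_square algebra_simps)
  have "0 \<le> m2 * v" using m(1) m(3)[of "t / 2" "5 * t / 8"] t by (simp add: m2_def v_def)
  with 1 show "Bil t f f \<le> cd f t * (cd f t - cd f (t / 2))" by (simp add: m2_def v_def)
qed

text \<open>
  For \<open>f' = (1 - \<epsilon>) * f + \<epsilon> * r\<close> the value is
  \<open>(1 - \<epsilon>)^2 * Psi f + 2 * \<epsilon> * (1 - \<epsilon>) * Bil t f r + \<epsilon>^2 * Bil t r r\<close>.
  A density \<open>r\<close> with \<open>Bil t f r \<ge> Psi f\<close> and
  \<open>Bil t r r = 1\<close> therefore gains \<open>\<epsilon>^2 * (1 - Psi f)\<close>. The
  first-order inequality must hold exactly: when the mean of \<open>Xi t f\<close> cannot be exceeded,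
  the whole gain is of second order. Any \<open>r\<close> carried by \<open>[3 t / 4, t)\<close> meets
  the second condition, and there are two candidates. With \<open>q\<close>, \<open>h\<close>,
  \<open>v\<close> the masses below \<open>t\<close>, \<open>t / 2\<close>, \<open>3 t / 4\<close> and
  \<open>m2\<close> the mass of \<open>[t / 2, 5 t / 8)\<close>:

  \<^item> If \<open>f\<close> gives \<open>[3 t / 4, t)\<close> noticeable mass, condition
    \<open>f\<close> on it. \<open>Xi t f\<close> increases below \<open>t\<close> and is nonpositive
    beyond, so its mean over the right end of \<open>[0, t)\<close> is at least its overall mean, which is
    \<open>Psi f\<close>.

  \<^item> Otherwise condition the exponential law. If \<open>v \<ge> 1 / 2\<close>, the bounds of
    \<open>Bil_self_le\<close> show
    \<open>Xi t f s - Psi f \<ge> (1 - q) * (q - h) + m2 * (v - 1 / 2) \<ge> 0\<close>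
    for \<open>s\<close> in the interval. If \<open>v < 1 / 2\<close>, the points below
    \<open>3 t / 4\<close> have at least half of \<open>Psi f\<close> to contribute with less than half
    of the mass, so \<open>Xi t f (3 t / 4) \<ge> Psi f\<close>.
\<close>

lemma ascent_direction_pos:
  fixes a K :: real
  assumes a: "0 < a" and K: "0 \<le> K"
  shows "\<exists>C\<ge>0. \<forall>f t. dens f \<longrightarrow> 0 \<le> t \<longrightarrow> KL f \<le> K \<longrightarrow> a \<le> Bil t f f \<longrightarrow>
    (\<exists>r. dens r \<and> KL r \<le> C \<and> Bil t f f \<le> Bil t f r \<and> Bil t r r = 1)"
proof -
  define \<theta> where "\<theta> = (K + 2) / a"
  \<comment> \<open>a lower bound for the normalizing masses of both candidates; the second entry comes from
     \<open>2 * exp (- \<theta>) \<le> t \<le> 2 * \<theta>\<close>\<close>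
  define m0 where "m0 = min (a / 2) (exp (- \<theta>) / 2 * exp (- (2 * \<theta>)))"
  define C where "C = (K + 1) / m0 + ln (1 / m0)"
  have m0: "0 < m0" using a by (simp add: m0_def)
  have key: "\<exists>r. dens r \<and> KL r \<le> C \<and> Bil t f f \<le> Bil t f r \<and> Bil t r r = 1"
    if f: "dens f" and t: "0 \<le> t" and Kf: "KL f \<le> K" and ab: "a \<le> Bil t f f" for f t
  proof -
    note d = densD[OF f] and m = cd_dens[OF f]
    define q h m2 v b where "q = cd f t" and "h = cd f (t / 2)"
      and "m2 = cd f (5 * t / 8) - cd f (t / 2)" and "v = cd f (3 * t / 4)" and "b = Bil t f f"
    define A where "A = {3 * t / 4..<t}"
    have A: "A \<in> sets borel" by (simp add: A_def)
    have q: "0 \<le> h" "h \<le> v" "v \<le> q" "q \<le> 1" "0 \<le> m2" "m2 \<le> v - h"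
      unfolding q_def h_def v_def m2_def using m t by auto
    have b1: "b \<le> q * (q - h)" using Bil_self_le(1)[OF f t] by (simp add: b_def q_def h_def)
    also have "\<dots> \<le> 1 * (q - h)" using q by (intro mult_right_mono) auto
    finally have "a \<le> (\<integral>x. f x * indicator {t / 2..<t} x \<partial>Exp1)"
      using ab integral_interval[OF d(1), of "t / 2" t] t by (simp add: b_def q_def h_def)
    from mass_ge[OF f _ Kf a this] have P: "exp (- \<theta>) \<le> measure Exp1 {t / 2..<t}"
      by (simp add: \<theta>_def)
    have Q: "measure Exp1 {t / 2..<t} = exp (- (t / 2)) - exp (- t)"
      using t measure_Exp1_interval[of "t / 2" t] by simp
    have t1: "2 * exp (- \<theta>) \<le> t"
    proof -
      have "(t - t / 2) * exp (- (t / 2)) \<le> (t - t / 2) * 1" using t by (intro mult_left_mono) auto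
      then show ?thesis using P Q exp_diff_bounds(2)[of "t / 2" t] t by simp
    qed
    have "exp (- \<theta>) \<le> exp (- (t / 2))" using P Q exp_gt_zero[of "- t"] by linarith
    then have t2: "t \<le> 2 * \<theta>" by simp
    have "m0 \<le> exp (- \<theta>) / 2 * exp (- (2 * \<theta>))" by (simp add: m0_def)
    also have "\<dots> \<le> (t / 4) * exp (- t)" using t1 t2 t by (intro mult_mono) auto
    also have "\<dots> \<le> measure Exp1 A"
      using exp_diff_bounds(1)[of "3 * t / 4" t] measure_Exp1_interval[of "3 * t / 4" t] t
      by (simp add: A_def)
    finally have mA: "m0 \<le> (\<integral>x. 1 * indicator A x \<partial>Exp1)"
      using A Exp1.space_eq_univ by simp
    have witness_one: ?thesis if ge: "\<And>s. s \<in> A \<Longrightarrow> b \<le> Xi t f s"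
    proof -
      have M: "0 < (\<integral>x. 1 * indicator A x \<partial>Exp1 :: real)" using mA m0 by linarith
      have "KL (cond_dens A (\<lambda>_. 1)) \<le> 1 / m0 + ln (1 / m0)"
        using cond_dens(2)[OF dens_one A m0 mA] by (simp add: KL_one)
      also have "\<dots> \<le> C" unfolding C_def using K m0 by (simp add: divide_right_mono)
      finally have "KL (cond_dens A (\<lambda>_. 1)) \<le> C" .
      then show ?thesis
        using cond_dens(1)[OF dens_one A m0 mA] Bil_cond_dens_ge[OF f dens_one A M, of b 1 t] ge
          Bil_cond_dens_self[OF dens_one _ t] M
        by (intro exI[of _ "cond_dens A (\<lambda>_. 1)"]) (simp add: b_def A_def)
    qed
    have XA: "Xi t f (3 * t / 4) \<le> Xi t f s" if "s \<in> A" for s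
      using Xi_dens_mono[OF f, of "3 * t / 4" s t] that by (auto simp: A_def)
    have t0: "0 < t" using t1 exp_gt_zero[of "- \<theta>"] by linarith
    have bpos: "0 < b" using a ab by (simp add: b_def)
    define r0 where "r0 = (\<integral>x. f x * indicator A x \<partial>Exp1)"
    have r0: "r0 = q - v" using integral_interval[OF d(1), of "3 * t / 4" t] t
      by (simp add: r0_def A_def q_def v_def)
    have bX: "bdd_meas (\<lambda>s. f s * Xi t f s)" using d by (intro bdd_meas_mult bdd_meas_Xi)
    define R where "R = (\<integral>s. (f s * Xi t f s) * indicator A s \<partial>Exp1)"
    \<comment> \<open>below \<open>3 t / 4\<close> the function \<open>Xi t f\<close> is at most its value there,
       beyond \<open>t\<close> it is nonpositive\<close>
    have split: "b \<le> v * Xi t f (3 * t / 4) + R"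
    proof -
      have "b = (\<integral>s. f s * Xi t f s \<partial>Exp1)" by (simp add: b_def Bil_def)
      also have "\<dots> \<le> (\<integral>s. (f s * indicator {..<3 * t / 4} s) * Xi t f (3 * t / 4)
          + (f s * Xi t f s) * indicator A s \<partial>Exp1)"
      proof (intro integral_mono integrable_bdd_meas bX bdd_meas_add bdd_meas_mult bdd_meas_indicator A
          bdd_meas_const d)
        fix s
        consider "s < 3 * t / 4" | "s \<in> A" | "t \<le> s" by (force simp: A_def)
        then show "f s * Xi t f s \<le> (f s * indicator {..<3 * t / 4} s) * Xi t f (3 * t / 4)
          + (f s * Xi t f s) * indicator A s"
        proof cases
          case 1
          then have "f s * Xi t f s \<le> f s * Xi t f (3 * t / 4)"
            using Xi_dens_mono[OF f, of s "3 * t / 4" t] t0 d(3) by (intro mult_left_mono) auto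
          then show ?thesis using 1 by (simp add: A_def)
        next
          case 2 then show ?thesis by (simp add: A_def)
        next
          case 3
          then have "f s * Xi t f s \<le> 0"
            using Xi_dens_nonpos[OF f, of t s] d(3)[of s] by (simp add: mult_le_0_iff)
          then show ?thesis using 3 t0 by (simp add: A_def)
        qed
      qed (auto)
      also have "\<dots> = (\<integral>s. (f s * indicator {..<3 * t / 4} s) * Xi t f (3 * t / 4) \<partial>Exp1) + R"
        unfolding R_def
        by (intro Bochner_Integration.integral_add integrable_bdd_meas bX bdd_meas_mult
            bdd_meas_indicator A bdd_meas_const d) auto
      also have "(\<integral>s. (f s * indicator {..<3 * t / 4} s) * Xi t f (3 * t / 4) \<partial>Exp1)
          = v * Xi t f (3 * t / 4)"
        unfolding v_def cd_def by (rule integral_mult_left_zero)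
      finally show ?thesis .
    qed
    consider "r0 > b / 2" | "1 / 2 \<le> v" | "r0 \<le> b / 2" "v < 1 / 2" by linarith
    then show ?thesis
    proof cases
      case 1
      have M: "0 < r0" "m0 \<le> r0" using 1 bpos ab by (auto simp: m0_def b_def)
      define r where "r = cond_dens A f"
      have r: "dens r" "KL r \<le> (KL f + 1) / m0 + ln (1 / m0)"
        unfolding r_def using M by (intro cond_dens f A m0; simp add: r0_def)+
      have "KL r \<le> C" unfolding C_def
        by (rule order_trans[OF r(2)]) (use Kf m0 in \<open>simp add: divide_right_mono\<close>)
      moreover have BR: "Bil t f r = R / r0"
      proof -
        have "Bil t f r = (\<integral>s. (f s * Xi t f s) * indicator A s / r0 \<partial>Exp1)"
          unfolding Bil_def
          by (rule Bochner_Integration.integral_cong) (simp_all add: r_def cond_dens_def r0_def[symmetric])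
        also have "\<dots> = R / r0" unfolding R_def by (rule integral_divide_zero)
        finally show ?thesis .
      qed
      moreover have "b \<le> R / r0"
      proof -
        have "Xi t f (3 * t / 4) \<le> 1 * Bil t f r"
          unfolding r_def by (rule Bil_cond_dens_ge[OF f f A]) (use XA M in \<open>auto simp: r0_def\<close>)
        then have X: "Xi t f (3 * t / 4) \<le> R / r0" using BR by simp
        have "b \<le> v * (R / r0) + r0 * (R / r0)"
          using split mult_left_mono[OF X, of v] q M by simp
        also have "\<dots> = (v + r0) * (R / r0)" by (simp only: distrib_right)
        also have "v + r0 = q" using r0 by simp
        finally have le: "b \<le> q * (R / r0)" .
        then have "0 < q * (R / r0)" using bpos by linarith
        moreover have "0 \<le> q" using q by linarith
        ultimately have "0 < R / r0" using zero_less_mult_pos[of q "R / r0"] by (cases "q = 0") auto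
        then have "q * (R / r0) \<le> 1 * (R / r0)" using q by (intro mult_right_mono) auto
        then show ?thesis using le by simp
      qed
      ultimately show ?thesis
        using r(1) Bil_cond_dens_self[OF f _ t] M
        by (intro exI[of _ r]) (simp add: b_def r_def A_def r0_def)
    next
      case 2
      show ?thesis
      proof (rule witness_one)
        fix s assume s: "s \<in> A"
        have "q - h / 2 - (m2 + h) / 2 \<le> Xi t f s"
          using s t m(3)[of "2 * (t - s)" "t / 2"] m(3)[of "t - s / 2" "5 * t / 8"]
          by (auto simp: Xi_def A_def q_def h_def m2_def)
        moreover have "b \<le> q * (q - h) - m2 * v"
          using Bil_self_le(2)[OF f t] by (simp add: b_def q_def h_def m2_def v_def)
        moreover have "0 \<le> (1 - q) * (q - h) + m2 * (v - 1 / 2)"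
          using q 2 by (intro add_nonneg_nonneg mult_nonneg_nonneg) auto
        moreover have "(1 - q) * (q - h) + m2 * (v - 1 / 2)
            = (q - h / 2 - (m2 + h) / 2) - (q * (q - h) - m2 * v)" by (simp add: field_simps)
        ultimately show "b \<le> Xi t f s" by linarith
      qed
    next
      case 3
      have "R \<le> r0"
        unfolding R_def r0_def
      proof (intro integral_mono integrable_bdd_meas bX bdd_meas_mult bdd_meas_indicator A d)
        fix s
        have "f s * Xi t f s \<le> f s * 1"
          using Xi_dens_le_1[OF f, of t s] d(3) by (intro mult_left_mono) auto
        then show "f s * Xi t f s * indicator A s \<le> f s * indicator A s"
          by (auto simp: indicator_def)
      qed
      then have le: "b / 2 \<le> v * Xi t f (3 * t / 4)" using split 3 by linarith
      have "0 < v * Xi t f (3 * t / 4)" using le bpos by linarith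
      then have "0 < Xi t f (3 * t / 4)" using q by (simp add: zero_less_mult_iff)
      then have "v * Xi t f (3 * t / 4) \<le> 1 / 2 * Xi t f (3 * t / 4)"
        using 3 by (intro mult_right_mono) auto
      then have "b \<le> Xi t f (3 * t / 4)" using le by simp
      then show ?thesis by (intro witness_one) (use XA in force)
    qed
  qed
  have "m0 \<le> 1"
  proof -
    have "exp (- \<theta>) * exp (- (2 * \<theta>)) \<le> 1 * 1"
      unfolding \<theta>_def using K a by (intro mult_mono) auto
    then show ?thesis by (simp add: m0_def)
  qed
  then have "0 \<le> C" unfolding C_def using m0 K by (simp add: ln_ge_zero)
  then show ?thesis using key by blast
qed

text \<open>
  By \<open>neg_Psi_le\<close>, \<open>- Psi f \<le> h * u\<close> with
  \<open>h = f[0, t / 2)\<close> and \<open>u = f[t, 2 t)\<close>. Mass added next to 0 gives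
  \<open>- Xi t f\<close> close to \<open>u / 2\<close>, mass added just above \<open>t\<close> gives
  nearly \<open>h / 2\<close>. As \<open>h + u \<le> 1\<close>, the product \<open>h * u\<close> is
  at most half of the larger factor, with equality only for \<open>h = u = 1 / 2\<close>; then
  \<open>h * u = 1 / 4\<close>, which the assumption \<open>a' < 1 / 4\<close> separates from
  \<open>- Psi f\<close>. So there is a gain of first order, and small errors are harmless here, in
  contrast to the positive sign.
\<close>

lemma ascent_direction_neg:
  fixes a a' K :: real
  assumes a: "0 < a" and a': "a' < 1 / 4" and K: "0 \<le> K"
  shows "\<exists>C\<ge>0. \<exists>\<gamma>>0. \<forall>f t. dens f \<longrightarrow> 0 \<le> t \<longrightarrow> KL f \<le> K \<longrightarrow> a \<le> - Bil t f f \<longrightarrow>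
    - Bil t f f \<le> a' \<longrightarrow> (\<exists>r. dens r \<and> KL r \<le> C \<and> - Bil t f f + \<gamma> \<le> - Bil t f r)"
proof -
  define \<gamma> where "\<gamma> = a * (1 / 4 - a') / 2"
  define \<theta> where "\<theta> = (K + 2) / a"
  define \<theta>' where "\<theta>' = (K + 1) / \<gamma>"
  \<comment> \<open>relative length of the interval that receives mass: since \<open>t \<le> \<theta>\<close>,
     intervals of length \<open>2 * \<kappa> * t\<close> have exponential mass at most
     \<open>exp (- \<theta>')\<close>, hence mass at most \<open>\<gamma>\<close> under
     \<open>f\<close>\<close>
  define \<kappa> where "\<kappa> = min (1 / 2) (exp (- \<theta>') / (2 * \<theta>))"
  define m0 where "m0 = \<kappa> * exp (- \<theta>) * exp (- (2 * \<theta>))"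
  define C where "C = 1 / m0 + ln (1 / m0)"
  have \<gamma>: "0 < \<gamma>" using a a' by (simp add: \<gamma>_def)
  have \<theta>: "0 < \<theta>" using a K by (simp add: \<theta>_def)
  have \<theta>': "0 < \<theta>'" using \<gamma> K by (simp add: \<theta>'_def)
  have \<kappa>: "0 < \<kappa>" "\<kappa> \<le> 1 / 2" "\<kappa> \<le> exp (- \<theta>') / (2 * \<theta>)" using \<theta> by (auto simp: \<kappa>_def)
  have m0: "0 < m0" using \<kappa> by (simp add: m0_def)
  have key: "\<exists>r. dens r \<and> KL r \<le> C \<and> - Bil t f f + \<gamma> \<le> - Bil t f r"
    if f: "dens f" and t: "0 \<le> t" and Kf: "KL f \<le> K" and ab: "a \<le> - Bil t f f"
      and ba: "- Bil t f f \<le> a'" for f t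
  proof -
    note d = densD[OF f] and m = cd_dens[OF f]
    define q h u b where "q = cd f t" and "h = cd f (t / 2)"
      and "u = cd f (2 * t) - cd f t" and "b = - Bil t f f"
    have hu: "0 \<le> h" "0 \<le> u" "h \<le> 1" "u \<le> 1"
      using m(1,2)[of "t/2"] m(1,2)[of "2*t"] m(1,2)[of t] m(3)[of t "2*t"] t by (auto simp: h_def u_def)
    have bhu: "b \<le> h * u"
      using neg_Psi_le[OF real_distribution_law[OF f] _ t] m(4)
      by (simp add: Psi_law[OF f] lcdf_law[OF f] b_def h_def u_def)
    have "h * u \<le> 1 * u" "h * u \<le> h * 1"
      using mult_right_mono[OF hu(3,2)] mult_left_mono[OF hu(4,1)] by simp_all
    then have ahu: "a \<le> h" "a \<le> u" using bhu ab by (auto simp: b_def)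
    \<comment> \<open>half of the gain is spent on the error terms of \<open>slack\<close>\<close>
    have gain: "b + 2 * \<gamma> \<le> max u h / 2"
    proof -
      define M where "M = max u h"
      have M: "a \<le> M" using ahu by (simp add: M_def)
      have bM: "b \<le> M * M"
        by (rule order_trans[OF bhu], rule mult_mono) (use hu in \<open>auto simp: M_def\<close>)
      have a4: "a \<le> 1 / 2" using ab ba a' by simp
      show ?thesis
      proof (cases "M \<ge> 1 / 4 + a'")
        case True
        have "a * (1 / 4 - a') \<le> 1 / 2 * (1 / 4 - a')" using a4 a' by (intro mult_right_mono) auto
        then show ?thesis using True ba unfolding M_def[symmetric] by (simp add: \<gamma>_def b_def)
      next
        case False
        have "a * (1 / 4 - a') \<le> M * (1 / 2 - M)" using False M a a' by (intro mult_mono) auto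
        moreover have "M * (1 / 2 - M) = M / 2 - M * M" by (simp add: field_simps)
        moreover have "2 * \<gamma> = a * (1 / 4 - a')" by (simp add: \<gamma>_def)
        ultimately show ?thesis using bM unfolding M_def[symmetric] by linarith
      qed
    qed
    have "a \<le> (\<integral>x. f x * indicator {t..<2 * t} x \<partial>Exp1)"
      using ahu(2) integral_interval[OF d(1), of t "2 * t"] t by (simp add: u_def)
    from mass_ge[OF f _ Kf a this] have P: "exp (- \<theta>) \<le> exp (- t) - exp (- (2 * t))"
      using t measure_Exp1_interval[of t "2 * t"] by (simp add: \<theta>_def)
    have "exp (- \<theta>) \<le> exp (- t)" using P exp_gt_zero[of "- (2 * t)"] by linarith
    then have t2: "t \<le> \<theta>" by simp
    have t1: "exp (- \<theta>) \<le> t"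
    proof -
      have "(2 * t - t) * exp (- t) \<le> (2 * t - t) * 1" using t by (intro mult_left_mono) auto
      then show ?thesis using P exp_diff_bounds(2)[of t "2 * t"] t by simp
    qed
    have t0: "0 < t" using t1 exp_gt_zero[of "- \<theta>"] by linarith
    have kt: "2 * \<kappa> * t \<le> exp (- \<theta>')"
    proof -
      have "\<kappa> * t \<le> exp (- \<theta>') / (2 * \<theta>) * \<theta>" using \<kappa> t2 t \<theta> by (intro mult_mono) auto
      then show ?thesis using \<theta> by simp
    qed
    have slack: "cd f y - cd f x \<le> \<gamma>" if "0 \<le> x" "x \<le> y" "y - x \<le> 2 * \<kappa> * t" for x y
    proof -
      have "(y - x) * exp (- x) \<le> (y - x) * 1" using that by (intro mult_left_mono) auto
      then have "measure Exp1 {x..<y} \<le> exp (- \<theta>')"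
        using measure_Exp1_interval[of x y] exp_diff_bounds(2)[of x y] that kt by simp
      from mass_le[OF f _ _ this] have "\<theta>' * (cd f y - cd f x) \<le> K + 1"
        using integral_interval[OF d(1), of x y] that \<theta>' Kf by simp
      also have "K + 1 = \<theta>' * \<gamma>" using \<gamma> by (simp add: \<theta>'_def)
      finally show ?thesis using \<theta>' by simp
    qed
    have witness: ?thesis if A: "A = {x..<y}" and xy: "0 \<le> x" "y - x = \<kappa> * t" "y \<le> 2 * t"
      and ge: "\<And>s. s \<in> A \<Longrightarrow> b + \<gamma> \<le> (-1) * Xi t f s" for A x y
    proof -
      have kt0: "0 \<le> \<kappa> * t" using \<kappa> t by simp
      have AB: "A \<in> sets borel" by (simp add: A)
      have "m0 \<le> (\<kappa> * t) * exp (- y)"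
        unfolding m0_def using t1 t2 \<kappa> t xy by (intro mult_mono) auto
      also have "\<dots> \<le> measure Exp1 A"
        using exp_diff_bounds(1)[of x y] measure_Exp1_interval[of x y] xy kt0 by (simp add: A)
      finally have mA: "m0 \<le> (\<integral>x. 1 * indicator A x \<partial>Exp1)"
        using AB Exp1.space_eq_univ by simp
      have M: "0 < (\<integral>x. 1 * indicator A x \<partial>Exp1 :: real)" using mA m0 by linarith
      have "KL (cond_dens A (\<lambda>_. 1)) \<le> C"
        using cond_dens(2)[OF dens_one AB m0 mA] by (simp add: KL_one C_def)
      then show ?thesis
        using cond_dens(1)[OF dens_one AB m0 mA] Bil_cond_dens_ge[OF f dens_one AB M, of "b + \<gamma>" "-1" t] ge
        by (intro exI[of _ "cond_dens A (\<lambda>_. 1)"]) (simp add: b_def)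
    qed
    have kt2: "0 < \<kappa> * t" "\<kappa> * t \<le> t / 2" using \<kappa> t0 mult_right_mono[OF \<kappa>(2), of t] by auto
    show ?thesis
    proof (cases "h \<le> u")
      case True
      show ?thesis
      proof (rule witness[of _ 0 "\<kappa> * t", OF refl])
        fix s assume s: "s \<in> {0..<\<kappa> * t}"
        have "cd f (2 * t) - cd f (2 * (t - s)) \<le> \<gamma>" "cd f t - cd f (t - s / 2) \<le> \<gamma>"
          using s kt2 by (intro slack; auto)+
        then show "b + \<gamma> \<le> (-1) * Xi t f s"
          using s kt2 gain True by (auto simp: Xi_def u_def)
      qed (use kt2 t0 in \<open>linarith+\<close>)
    next
      case False
      show ?thesis
      proof (rule witness[of _ t "t + \<kappa> * t", OF refl])
        fix s assume s: "s \<in> {t..<t + \<kappa> * t}"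
        have "cd f (t / 2) - cd f (t - s / 2) \<le> \<gamma>"
          using s kt2 by (intro slack; auto)
        moreover have "0 \<le> cd f (2 * (t - s))" by (rule m)
        ultimately show "b + \<gamma> \<le> (-1) * Xi t f s"
          using s kt2 gain False \<gamma> by (auto simp: Xi_def h_def)
      qed (use kt2 t0 in \<open>linarith+\<close>)
    qed
  qed
  have "m0 \<le> 1 * 1 * 1"
    unfolding m0_def using \<theta> \<kappa> by (intro mult_mono) auto
  then have "0 \<le> C" unfolding C_def using m0 by (simp add: ln_ge_zero)
  then show ?thesis using key \<gamma> by blast
qed

lemma Bil_abs_le_1: "dens f \<Longrightarrow> \<bar>Bil t f f\<bar> \<le> 1"
  using Psi_le_1[OF real_distribution_law, of f t] by (simp add: Psi_law)

text \<open>
  The largest possible values of \<open>Psi\<close> (sign 1) and of \<open>- Psi\<close> (sign -1).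
\<close>

definition level_cap :: "real \<Rightarrow> real" where
  "level_cap \<sigma> = (if \<sigma> = 1 then 1 else 1 / 4)"

text \<open>
  The amount \<open>d\<close> depends only on the bounds, not on the density. This uniformity replaces a
  compactness argument for the entropy minimizers.
\<close>

lemma raise_level:
  fixes a a' K \<eta> \<sigma> :: real
  assumes \<sigma>: "\<sigma> \<in> {1, -1}" and a: "0 < a" and a': "a' < level_cap \<sigma>" and K: "0 \<le> K" and \<eta>: "0 < \<eta>"
  shows "\<exists>d>0. \<forall>f t. dens f \<longrightarrow> 0 \<le> t \<longrightarrow> KL f \<le> K \<longrightarrow> a \<le> \<sigma> * Bil t f f \<longrightarrow> \<sigma> * Bil t f f \<le> a' \<longrightarrow>
    (\<exists>f'. dens f' \<and> KL f' \<le> KL f + \<eta> \<and> \<sigma> * Bil t f f + d \<le> \<sigma> * Bil t f' f')"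
proof -
  have mix: "dens (\<lambda>x. (1 - e) * f x + e * r x) \<and> KL (\<lambda>x. (1 - e) * f x + e * r x) \<le> KL f + \<eta> \<and>
     (\<sigma> * Bil t f f + 2 * ((1 - e) * e) * (\<sigma> * Bil t f r - \<sigma> * Bil t f f)
        + e\<^sup>2 * (\<sigma> * Bil t r r - \<sigma> * Bil t f f)
       = \<sigma> * Bil t (\<lambda>x. (1 - e) * f x + e * r x) (\<lambda>x. (1 - e) * f x + e * r x))"
    if "dens f" "dens r" "KL r \<le> C" "0 \<le> C" "0 < e" "e \<le> 1 / 2" "e \<le> \<eta> / (C + 1)" for f r e C t
  proof -
    have "e * KL r \<le> \<eta> / (C + 1) * (C + 1)"
      using that KL_nonneg[OF that(2)] by (intro mult_mono) auto
    then have "e * KL r \<le> \<eta>" using that by simp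
    moreover have "(1 - e) * KL f \<le> 1 * KL f" using that KL_nonneg by (intro mult_right_mono) auto
    moreover have "KL (\<lambda>x. (1 - e) * f x + e * r x) \<le> (1 - e) * KL f + e * KL r"
      using that by (intro KL_mix) auto
    ultimately have "KL (\<lambda>x. (1 - e) * f x + e * r x) \<le> KL f + \<eta>" by linarith
    moreover have "\<sigma> * Bil t f f + 2 * ((1 - e) * e) * (\<sigma> * Bil t f r - \<sigma> * Bil t f f)
        + e\<^sup>2 * (\<sigma> * Bil t r r - \<sigma> * Bil t f f)
       = \<sigma> * ((1 - e)\<^sup>2 * Bil t f f + 2 * (1 - e) * e * Bil t f r + e\<^sup>2 * Bil t r r)"
      by (simp add: power2_eq_square algebra_simps)
    ultimately show ?thesis
      using dens_mix[OF that(1,2), of "1 - e" e] that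
      by (simp only: Bil_quad[OF densD(1)[OF that(1)] densD(1)[OF that(2)]])
  qed
  show ?thesis
  proof (cases "\<sigma> = 1")
    case True
    obtain C where C: "0 \<le> C" "\<And>f t. dens f \<Longrightarrow> 0 \<le> t \<Longrightarrow> KL f \<le> K \<Longrightarrow> a \<le> Bil t f f \<Longrightarrow>
      (\<exists>r. dens r \<and> KL r \<le> C \<and> Bil t f f \<le> Bil t f r \<and> Bil t r r = 1)"
      using ascent_direction_pos[OF a K] by blast
    define e where "e = min (1 / 2) (\<eta> / (C + 1))"
    have e: "0 < e" "e \<le> 1 / 2" "e \<le> \<eta> / (C + 1)"
      unfolding e_def by (use C \<eta> in simp, rule min.cobounded1, rule min.cobounded2)
    show ?thesis
    proof (intro exI[of _ "e\<^sup>2 * (1 - a')"] conjI allI impI)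
      show "0 < e\<^sup>2 * (1 - a')" using e a' True by (simp add: level_cap_def)
      fix f t assume h: "dens f" "0 \<le> t" "KL f \<le> K" "a \<le> \<sigma> * Bil t f f" "\<sigma> * Bil t f f \<le> a'"
      with C(2)[of f t] True obtain r where r: "dens r" "KL r \<le> C" "Bil t f f \<le> Bil t f r" "Bil t r r = 1"
        by auto
      have "0 \<le> 2 * ((1 - e) * e) * (Bil t f r - Bil t f f)" using e r by auto
      moreover have "e\<^sup>2 * (1 - a') \<le> e\<^sup>2 * (Bil t r r - Bil t f f)"
        using h True r by (intro mult_left_mono) auto
      ultimately show "\<exists>f'. dens f' \<and> KL f' \<le> KL f + \<eta> \<and> \<sigma> * Bil t f f + e\<^sup>2 * (1 - a') \<le> \<sigma> * Bil t f' f'"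
        using mix[OF h(1) r(1,2) C(1) e, of t] unfolding True mult_1
        by (intro exI[of _ "\<lambda>x. (1 - e) * f x + e * r x"] conjI; (elim conjE)?; linarith?)
    qed
  next
    case False
    then have s: "\<sigma> = -1" using \<sigma> by auto
    obtain C \<gamma> where C: "0 \<le> C" "0 < \<gamma>" "\<And>f t. dens f \<Longrightarrow> 0 \<le> t \<Longrightarrow> KL f \<le> K \<Longrightarrow> a \<le> - Bil t f f \<Longrightarrow>
      - Bil t f f \<le> a' \<Longrightarrow> (\<exists>r. dens r \<and> KL r \<le> C \<and> - Bil t f f + \<gamma> \<le> - Bil t f r)"
      using ascent_direction_neg[OF a _ K, of a'] a' s by (auto simp: level_cap_def)
    define e where "e = min (min (1 / 2) (\<gamma> / 4)) (\<eta> / (C + 1))"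
    have e: "0 < e" "e \<le> 1 / 2" "e \<le> \<eta> / (C + 1)" and e4: "e \<le> \<gamma> / 4"
      using C \<eta> by (simp add: e_def, unfold e_def, linarith+)
    show ?thesis
    proof (intro exI[of _ "e * \<gamma> / 2"] conjI allI impI)
      show "0 < e * \<gamma> / 2" using e C by simp
      fix f t assume h: "dens f" "0 \<le> t" "KL f \<le> K" "a \<le> \<sigma> * Bil t f f" "\<sigma> * Bil t f f \<le> a'"
      with C(3)[of f t] s obtain r where r: "dens r" "KL r \<le> C" "- Bil t f f + \<gamma> \<le> - Bil t f r"
        by auto
      have "2 * ((1 / 2) * e) * \<gamma> \<le> 2 * ((1 - e) * e) * (- Bil t f r - - Bil t f f)"
        using e r C by (intro mult_mono) auto
      then have A: "e * \<gamma> \<le> 2 * ((1 - e) * e) * (- Bil t f r - - Bil t f f)" by simp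
      have "e\<^sup>2 * (- 2) \<le> e\<^sup>2 * (- Bil t r r - - Bil t f f)"
        using Bil_abs_le_1[OF h(1), of t] Bil_abs_le_1[OF r(1), of t] by (intro mult_left_mono) auto
      moreover have "e\<^sup>2 * 2 \<le> e * \<gamma> / 2"
        using mult_left_mono[OF e4, of e] e by (simp add: power2_eq_square)
      ultimately have B: "- (e * \<gamma> / 2) \<le> e\<^sup>2 * (- Bil t r r - - Bil t f f)" by simp
      show "\<exists>f'. dens f' \<and> KL f' \<le> KL f + \<eta> \<and> \<sigma> * Bil t f f + e * \<gamma> / 2 \<le> \<sigma> * Bil t f' f'"
        using mix[OF h(1) r(1,2) C(1) e, of t] A B unfolding s mult_minus1
        by (intro exI[of _ "\<lambda>x. (1 - e) * f x + e * r x"] conjI; (elim conjE)?; linarith?)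
    qed
  qed
qed

section \<open>Quantile cells\<close>

text \<open>
  The index of the \<open>Exp1\<close>-quantile interval \<open>[j / k, (j + 1) / k)\<close> that
  contains the value of the distribution function. Negative numbers land in cell 0, so the cells partition
  the whole line.
\<close>

definition cell :: "nat \<Rightarrow> real \<Rightarrow> nat" where
  "cell k x = nat \<lfloor>real k * (1 - exp (- x))\<rfloor>"

lemma cell_mono: "x \<le> y \<Longrightarrow> cell k x \<le> cell k y"
  unfolding cell_def by (intro nat_mono floor_mono mult_left_mono) auto

lemma nat_floor_less_iff:
  fixes z :: real
  assumes "0 < j" shows "nat \<lfloor>z\<rfloor> < j \<longleftrightarrow> z < real j"
proof -
  have "nat \<lfloor>z\<rfloor> < j \<longleftrightarrow> \<lfloor>z\<rfloor> < int j" using assms by linarith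
  then show ?thesis by (simp add: floor_less_iff)
qed

lemma cell_less:
  assumes "0 < k" shows "cell k x < k"
proof -
  have "real k * (1 - exp (- x)) < real k * 1" using assms by (intro mult_strict_left_mono) auto
  then show ?thesis unfolding cell_def using assms by (simp add: nat_floor_less_iff)
qed

lemma cell_measurable [measurable]: "cell k \<in> measurable borel (count_space UNIV)"
  unfolding cell_def[abs_def] by measurable

lemma cell_less_iff:
  assumes "0 < j" "j < k"
  shows "cell k x < j \<longleftrightarrow> x < - ln (1 - real j / real k)"
proof -
  have p: "0 < 1 - real j / real k" using assms by simp
  have "cell k x < j \<longleftrightarrow> real k * (1 - exp (- x)) < real j"
    using assms unfolding cell_def by (simp add: nat_floor_less_iff)
  also have "\<dots> \<longleftrightarrow> 1 - real j / real k < exp (- x)" using assms by (simp add: field_simps)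
  also have "\<dots> \<longleftrightarrow> ln (1 - real j / real k) < - x"
    by (metis exp_less_cancel_iff exp_ln p)
  finally show ?thesis by linarith
qed

lemma measure_cell_less:
  assumes "j \<le> k" "0 < k"
  shows "measure Exp1 {x. cell k x < j} = real j / real k"
proof -
  consider "j = 0" | "j = k" | "0 < j" "j < k" using assms by linarith
  then show ?thesis
  proof cases
    case 2
    then have "{x. cell k x < j} = space Exp1" using cell_less[of k] assms by auto
    then show ?thesis using Exp1.prob_space 2 assms by simp
  next
    case 3
    then have "{x. cell k x < j} = {..< - ln (1 - real j / real k)}"
      by (auto simp: cell_less_iff)
    then have "measure Exp1 {x. cell k x < j} = lcdf Exp1 (- ln (1 - real j / real k))"
      by (simp add: lcdf_def)
    also have "\<dots> = real j / real k" using 3 by (simp add: lcdf_Exp1 field_simps)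
    finally show ?thesis .
  qed auto
qed

lemma measure_cells_less:
  assumes "real_distribution \<mu>"
  shows "measure \<mu> {x. cell k x < m} = (\<Sum>j<m. measure \<mu> {x. cell k x = j})"
proof -
  interpret real_distribution \<mu> by fact
  have "{x. cell k x < m} = (\<Union>j<m. {x. cell k x = j})" by auto
  also have "measure \<mu> \<dots> = (\<Sum>j<m. measure \<mu> {x. cell k x = j})"
    by (rule finite_measure_finite_Union) (auto simp: disjoint_family_on_def)
  finally show ?thesis .
qed

lemma measure_cell:
  assumes "j < k"
  shows "measure Exp1 {x. cell k x = j} = 1 / real k"
proof -
  have "measure Exp1 {x. cell k x < Suc j} = measure Exp1 {x. cell k x < j} + measure Exp1 {x. cell k x = j}"
    by (simp add: measure_cells_less[OF real_distribution_Exp1])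
  then show ?thesis using assms by (simp add: measure_cell_less add_divide_distrib)
qed

text \<open>
  A half-line \<open>{..<x}\<close> consists of complete cells, fewer than \<open>k\<close> of them, and a
  part of the cell of \<open>x\<close>.
\<close>

lemma lcdf_diff_cells:
  assumes \<mu>: "real_distribution \<mu>" and \<nu>: "real_distribution \<nu>" and k: "0 < k"
    and d: "\<And>j. j < k \<Longrightarrow> \<bar>measure \<mu> {x. cell k x = j} - measure \<nu> {x. cell k x = j}\<bar> \<le> \<rho>"
    and e: "\<And>j. j < k \<Longrightarrow> measure \<nu> {x. cell k x = j} \<le> \<eta>"
  shows "\<bar>lcdf \<mu> x - lcdf \<nu> x\<bar> \<le> real k * \<rho> + \<eta>"
proof -
  define m where "m = cell k x"
  have m: "m < k" using cell_less[OF k] by (simp add: m_def)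
  have \<rho>: "0 \<le> \<rho>" using d[OF k] by linarith
  have split: "lcdf \<xi> x = (\<Sum>j<m. measure \<xi> {x. cell k x = j}) + measure \<xi> {y. y < x \<and> cell k y = m}"
    and part: "measure \<xi> {y. y < x \<and> cell k y = m} \<le> measure \<xi> {x. cell k x = m}"
    if "real_distribution \<xi>" for \<xi>
  proof -
    interpret real_distribution \<xi> by fact
    have "{..<x} = {y. cell k y < m} \<union> {y. y < x \<and> cell k y = m}"
    proof (intro equalityI subsetI)
      fix y assume "y \<in> {..<x}"
      then show "y \<in> {y. cell k y < m} \<union> {y. y < x \<and> cell k y = m}"
        using cell_mono[of y x k] by (auto simp: m_def)
    next
      fix y assume "y \<in> {y. cell k y < m} \<union> {y. y < x \<and> cell k y = m}"
      then show "y \<in> {..<x}" using cell_mono[of x y k] by (auto simp: m_def not_le[symmetric])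
    qed
    then have "lcdf \<xi> x = measure \<xi> ({y. cell k y < m} \<union> {y. y < x \<and> cell k y = m})"
      by (simp add: lcdf_def)
    also have "\<dots> = measure \<xi> {y. cell k y < m} + measure \<xi> {y. y < x \<and> cell k y = m}"
      by (rule finite_measure_Union) auto
    finally show "lcdf \<xi> x = (\<Sum>j<m. measure \<xi> {x. cell k x = j}) + measure \<xi> {y. y < x \<and> cell k y = m}"
      by (simp add: measure_cells_less[OF that])
    show "measure \<xi> {y. y < x \<and> cell k y = m} \<le> measure \<xi> {x. cell k x = m}"
      by (rule finite_measure_mono) auto
  qed
  have "\<bar>(\<Sum>j<m. measure \<mu> {x. cell k x = j}) - (\<Sum>j<m. measure \<nu> {x. cell k x = j})\<bar>
      \<le> (\<Sum>j<m. \<bar>measure \<mu> {x. cell k x = j} - measure \<nu> {x. cell k x = j}\<bar>)"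
    by (subst sum_subtractf[symmetric]) (rule sum_abs)
  also have "\<dots> \<le> (\<Sum>j<m. \<rho>)" using m d by (intro sum_mono) auto
  finally have A: "\<bar>(\<Sum>j<m. measure \<mu> {x. cell k x = j}) - (\<Sum>j<m. measure \<nu> {x. cell k x = j})\<bar> \<le> real m * \<rho>"
    by simp
  have "(real m + 1) * \<rho> \<le> real k * \<rho>" using m \<rho> by (intro mult_right_mono) auto
  then have B: "real m * \<rho> + \<rho> \<le> real k * \<rho>" by (simp add: distrib_right)
  show ?thesis
    using A B split[OF \<mu>] split[OF \<nu>] part[OF \<mu>] part[OF \<nu>] d[OF m] e[OF m]
      measure_nonneg[of \<mu> "{y. y < x \<and> cell k y = m}"] measure_nonneg[of \<nu> "{y. y < x \<and> cell k y = m}"]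
    by linarith
qed

lemma integral_cell:
  fixes g :: "nat \<Rightarrow> real"
  assumes "0 < k"
  shows "(\<integral>x. g (cell k x) \<partial>Exp1) = (\<Sum>j<k. g j) / real k"
proof -
  have i: "integrable Exp1 (\<lambda>x. g j * indicator {x. cell k x = j} x)" for j
    by (intro integrable_bdd_meas bdd_meas_mult bdd_meas_const bdd_meas_indicator) simp
  have "(\<integral>x. g (cell k x) \<partial>Exp1) = (\<integral>x. (\<Sum>j<k. g j * indicator {x. cell k x = j} x) \<partial>Exp1)"
  proof (rule Bochner_Integration.integral_cong)
    fix x
    have "(\<Sum>j<k. g j * indicator {x. cell k x = j} x) = (\<Sum>j<k. if j = cell k x then g j else 0)"
      by (rule sum.cong) (auto simp: indicator_def)
    also have "\<dots> = g (cell k x)" using cell_less[OF assms, of x] by simp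
    finally show "g (cell k x) = (\<Sum>j<k. g j * indicator {x. cell k x = j} x)" ..
  qed simp
  also have "\<dots> = (\<Sum>j<k. \<integral>x. g j * indicator {x. cell k x = j} x \<partial>Exp1)"
    by (rule Bochner_Integration.integral_sum) (rule i)
  also have "\<dots> = (\<Sum>j<k. g j * (1 / real k))"
    using Exp1.space_eq_univ by (intro sum.cong refl) (simp add: measure_cell)
  finally show ?thesis by (simp add: sum_divide_distrib)
qed

section \<open>Empirical measures\<close>

definition emp :: "nat \<Rightarrow> (nat \<Rightarrow> real) \<Rightarrow> real measure" where
  "emp n y = distr (measure_pmf (pmf_of_set {..<n})) borel y"

lemma real_distribution_emp: "real_distribution (emp n y)"
  unfolding emp_def by (rule prob_space.real_distribution_distr) (auto intro: prob_space_measure_pmf)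

lemma integral_emp:
  assumes "0 < n" "h \<in> borel_measurable borel"
  shows "(\<integral>x. h x \<partial>emp n y) = (\<Sum>i<n. h (y i)) / real n"
proof -
  have "(\<integral>x. h x \<partial>emp n y) = measure_pmf.expectation (pmf_of_set {..<n}) (\<lambda>i. h (y i))"
    unfolding emp_def using assms by (subst integral_distr) auto
  also have "\<dots> = (\<Sum>i<n. h (y i)) / real n"
    using assms by (subst integral_pmf_of_set) auto
  finally show ?thesis .
qed

lemma measure_emp:
  assumes "0 < n" "A \<in> sets borel"
  shows "measure (emp n y) A = (\<Sum>i<n. indicator A (y i)) / real n"
proof -
  interpret real_distribution "emp n y" by (rule real_distribution_emp)
  show ?thesis using integral_emp[OF assms(1), of "indicator A" y] assms(2) by simp
qed

lemma Psi_emp: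
  assumes n: "0 < n"
  shows "Psi (emp n y) t = H2 n y t - G2 n y t"
proof -
  have L: "lcdf (emp n y) x = (\<Sum>i<n. of_bool (y i < x)) / real n" for x
    unfolding lcdf_def using n by (simp add: measure_emp indicator_def)
  have "(lcdf (emp n y) t)\<^sup>2 = (\<Sum>i<n. \<Sum>j<n. of_bool (y i < t) * of_bool (y j < t)) / (real n)\<^sup>2"
    unfolding L power2_eq_square times_divide_times_eq sum_product ..
  also have "(\<Sum>i<n. \<Sum>j<n. of_bool (y i < t) * of_bool (y j < t))
     = (\<Sum>i<n. \<Sum>j<n. of_bool (max (y i) (y j) < t) :: real)"
    by (intro sum.cong refl) auto
  finally have H: "(lcdf (emp n y) t)\<^sup>2 = H2 n y t" by (simp add: H2_def)
  have "(\<integral>x. lcdf (emp n y) (t - x / 2) \<partial>emp n y) = (\<Sum>j<n. lcdf (emp n y) (t - y j / 2)) / real n"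
    using n lcdf_measurable[OF real_distribution_emp] by (intro integral_emp) (auto intro: measurable_compose)
  also have "\<dots> = (\<Sum>j<n. \<Sum>i<n. of_bool (y i < t - y j / 2)) / (real n)\<^sup>2"
    unfolding L by (simp add: power2_eq_square sum_divide_distrib)
  also have "(\<Sum>j<n. \<Sum>i<n. of_bool (y i < t - y j / 2) :: real) = (\<Sum>j<n. \<Sum>i<n. of_bool (y j / 2 + y i < t))"
    by (intro sum.cong refl) auto
  finally have S: "(\<integral>x. lcdf (emp n y) (t - x / 2) \<partial>emp n y)
     = (\<Sum>j<n. \<Sum>i<n. of_bool (y j / 2 + y i < t)) / (real n)\<^sup>2" .
  have "(\<Sum>j<n. \<Sum>i<n. of_bool (y j / 2 + y i < t) :: real) = (\<Sum>i<n. \<Sum>j<n. of_bool (y j / 2 + y i < t))"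
    by (rule sum.swap)
  also have "\<dots> = (\<Sum>i<n. \<Sum>j<n. of_bool (y i + y j / 2 < t))" by (simp add: add.commute)
  finally have "G2 n y t = (\<Sum>j<n. \<Sum>i<n. of_bool (y j / 2 + y i < t)) / (real n)\<^sup>2"
    by (simp add: G2_def sum.distrib)
  with S H show ?thesis by (simp add: Psi_def)
qed

lemma D2_gt_iff:
  assumes n: "0 < n"
  shows "D2 n y > a \<longleftrightarrow> (\<exists>t\<ge>0. \<bar>Psi (emp n y) t\<bar> > a)"
proof -
  have "bdd_above ((\<lambda>t. \<bar>H2 n y t - G2 n y t\<bar>) ` {0..})"
    using Psi_le_1[OF real_distribution_emp] by (intro bdd_aboveI2[where M=1]) (simp add: Psi_emp[OF n, symmetric])
  then show ?thesis
    unfolding D2_def by (subst less_cSUP_iff) (auto simp: Psi_emp[OF n])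
qed

lemma H2_G2_scale:
  assumes "0 < l"
  shows "H2 n (\<lambda>i. l * x i) (l * t) = H2 n x t" "G2 n (\<lambda>i. l * x i) (l * t) = G2 n x t"
proof -
  have "max (l * a) (l * b) < l * t \<longleftrightarrow> max a b < t" for a b
    using assms by (simp add: max_def)
  then show "H2 n (\<lambda>i. l * x i) (l * t) = H2 n x t" by (simp add: H2_def)
  have "l * a + l * b / 2 < l * t \<longleftrightarrow> a + b / 2 < t" "l * a / 2 + l * b < l * t \<longleftrightarrow> a / 2 + b < t" for a b
  proof -
    have "l * a + l * b / 2 = l * (a + b / 2)" "l * a / 2 + l * b = l * (a / 2 + b)"
      by (simp_all add: algebra_simps)
    then show "l * a + l * b / 2 < l * t \<longleftrightarrow> a + b / 2 < t" "l * a / 2 + l * b < l * t \<longleftrightarrow> a / 2 + b < t"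
      using assms by (simp_all only: mult_less_cancel_left_pos)
  qed
  then show "G2 n (\<lambda>i. l * x i) (l * t) = G2 n x t" by (simp add: G2_def)
qed

text \<open>
  All the inequalities in \<open>H2\<close> and \<open>G2\<close> are homogeneous.
\<close>

lemma D2_scale:
  assumes n: "0 < n" and l: "0 < l"
  shows "D2 n (\<lambda>i. l * x i) = D2 n x"
proof -
  have "(\<lambda>t. \<bar>H2 n (\<lambda>i. l * x i) t - G2 n (\<lambda>i. l * x i) t\<bar>) ` {0..} = (\<lambda>t. \<bar>H2 n x t - G2 n x t\<bar>) ` {0..}"
    (is "?f ` _ = ?g ` _")
  proof -
    have "?f ` {0..} = ?f ` ((\<lambda>t. l * t) ` {0..})"
      using l by (intro arg_cong[of _ _ "image ?f"]) (auto intro!: image_eqI[of _ _ "_ / l"])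
    also have "\<dots> = ?g ` {0..}" by (simp add: image_image H2_G2_scale[OF l])
    finally show ?thesis .
  qed
  then show ?thesis by (simp add: D2_def)
qed

text \<open>
  As a function of \<open>t\<close>, the statistic is constant on a left neighbourhood of every point,
  because the finitely many thresholds enter through strict inequalities. Restricting to rational
  \<open>t\<close> makes the supremum measurable.
\<close>

lemma Psi_emp_rational:
  assumes n: "0 < n"
  shows "(\<exists>t\<ge>0. a < \<sigma> * Psi (emp n y) t) \<longleftrightarrow>
    (\<exists>q::rat. 0 \<le> q \<and> a < \<sigma> * (H2 n y (of_rat q) - G2 n y (of_rat q)))"
proof safe
  fix t :: real assume t: "0 \<le> t" "a < \<sigma> * Psi (emp n y) t"
  define C where "C = (\<lambda>(i, j). max (y i) (y j)) ` ({..<n} \<times> {..<n}) \<union> (\<lambda>(i, j). y i + y j / 2) ` ({..<n} \<times> {..<n})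
    \<union> (\<lambda>(i, j). y i / 2 + y j) ` ({..<n} \<times> {..<n})"
  define u where "u = Max (insert (t - 1) {c \<in> C. c < t})"
  have fin: "finite (insert (t - 1) {c \<in> C. c < t})" by (simp add: C_def)
  have u: "u < t" unfolding u_def using fin by (subst Max_less_iff) auto
  have le: "c \<le> u" if "c \<in> C" "c < t" for c unfolding u_def using fin that by (intro Max_ge) auto
  obtain q :: rat where q: "0 \<le> q" "u < of_rat q" "of_rat q \<le> t"
  proof (cases "t = 0")
    case True
    then show thesis using that[of 0] u by simp
  next
    case False
    then have "max u 0 < t" using u t by simp
    then obtain q :: rat where "max u 0 < of_rat q" "of_rat q < t" using of_rat_dense by blast
    then show thesis using that[of q] by simp
  qed
  have eq: "c < of_rat q \<longleftrightarrow> c < t" if "c \<in> C" for c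
    using le[OF that] q by force
  have "H2 n y (of_rat q) = H2 n y t"
    unfolding H2_def by (intro arg_cong2[of _ _ _ _ "(*)"] sum.cong refl arg_cong[of _ _ of_bool] eq) (auto simp: C_def)
  moreover have "G2 n y (of_rat q) = G2 n y t"
    unfolding G2_def by (intro arg_cong2[of _ _ _ _ "(*)"] arg_cong2[of _ _ _ _ "(+)"] sum.cong refl arg_cong[of _ _ of_bool] eq) (auto simp: C_def)
  ultimately show "\<exists>q::rat. 0 \<le> q \<and> a < \<sigma> * (H2 n y (of_rat q) - G2 n y (of_rat q))"
    using t q by (intro exI[of _ q]) (simp add: Psi_emp[OF n])
next
  fix q :: rat assume "0 \<le> q" "a < \<sigma> * (H2 n y (of_rat q) - G2 n y (of_rat q))"
  then show "\<exists>t\<ge>0. a < \<sigma> * Psi (emp n y) t"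
    by (intro exI[of _ "of_rat q"]) (simp add: Psi_emp[OF n])
qed

section \<open>Counting words\<close>

text \<open>
  A sample is recorded as the word of the cells it visits. Words are functions restricted to
  \<open>{..<n}\<close>, so that sums of products over them factorize.
\<close>

definition words :: "nat \<Rightarrow> nat \<Rightarrow> (nat \<Rightarrow> nat) set" where
  "words k n = PiE {..<n} (\<lambda>_. {..<k})"

definition cnt :: "nat \<Rightarrow> (nat \<Rightarrow> nat) \<Rightarrow> nat \<Rightarrow> nat" where
  "cnt n w j = card {i. i < n \<and> w i = j}"

lemma finite_words [simp]: "finite (words k n)"
  unfolding words_def by (intro finite_PiE) auto

lemma wordsD: "w \<in> words k n \<Longrightarrow> i < n \<Longrightarrow> w i < k"
  by (auto simp: words_def PiE_def Pi_def)

lemma cnt_le: "cnt n w j \<le> n"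
proof -
  have "card {i. i < n \<and> w i = j} \<le> card {..<n}" by (rule card_mono) auto
  then show ?thesis by (simp add: cnt_def)
qed

lemma cnt_eq_sum: "real (cnt n w j) = (\<Sum>i<n. of_bool (w i = j))"
proof -
  have "(\<Sum>i<n. of_bool (w i = j) :: real) = real (card ({..<n} \<inter> {i. w i = j}))"
    by (simp add: sum.If_cases of_bool_def)
  also have "{..<n} \<inter> {i. w i = j} = {i. i < n \<and> w i = j}" by auto
  finally show ?thesis by (simp add: cnt_def)
qed

lemma sum_word:
  fixes \<phi> :: "nat \<Rightarrow> real"
  assumes "\<And>i. i < n \<Longrightarrow> w i < k"
  shows "(\<Sum>i<n. \<phi> (w i)) = (\<Sum>j<k. real (cnt n w j) * \<phi> j)"
proof -
  have "(\<Sum>j<k. real (cnt n w j) * \<phi> j) = (\<Sum>j<k. \<Sum>i<n. of_bool (w i = j) * \<phi> j)"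
    unfolding cnt_eq_sum sum_distrib_right ..
  also have "\<dots> = (\<Sum>i<n. \<Sum>j<k. of_bool (w i = j) * \<phi> j)" by (rule sum.swap)
  also have "\<dots> = (\<Sum>i<n. \<phi> (w i))"
  proof (rule sum.cong[OF refl])
    fix i assume "i \<in> {..<n}"
    have "(\<Sum>j<k. of_bool (w i = j) * \<phi> j) = (\<Sum>j<k. if w i = j then \<phi> j else 0)"
      by (rule sum.cong) auto
    also have "\<dots> = \<phi> (w i)" using assms \<open>i \<in> {..<n}\<close> by simp
    finally show "(\<Sum>j<k. of_bool (w i = j) * \<phi> j) = \<phi> (w i)" .
  qed
  finally show ?thesis ..
qed

lemma sum_cnt:
  assumes "\<And>i. i < n \<Longrightarrow> w i < k"
  shows "(\<Sum>j<k. real (cnt n w j)) = real n"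
  using sum_word[of n w k "\<lambda>_. 1"] assms by simp

lemma sum_words_prod:
  fixes q :: "nat \<Rightarrow> real"
  shows "(\<Sum>w\<in>words k n. \<Prod>i<n. q (w i)) = (\<Sum>j<k. q j) ^ n"
  using prod_sum_PiE[of "{..<n}" "\<lambda>_. {..<k}" "\<lambda>_ j. q j"] by (simp add: words_def)

text \<open>
  Bound the product for the word's own letter frequencies by the sum over all types; for each fixed type
  the products are probabilities of words and sum to 1. There are at most \<open>(n + 1)^k\<close> types.
\<close>

lemma sum_words_own_type:
  assumes n: "0 < n"
  shows "(\<Sum>w\<in>words k n. \<Prod>i<n. real (cnt n w (w i)) / real n) \<le> (real n + 1) ^ k"
proof -
  define T where "T = {\<tau> \<in> PiE {..<k} (\<lambda>_. {..n}). (\<Sum>j<k. real (\<tau> j)) = real n}"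
  have finP: "finite (PiE {..<k} (\<lambda>_. {..n}))" by (intro finite_PiE) auto
  then have fin: "finite T" by (simp add: T_def)
  have "(\<Prod>i<n. real (cnt n w (w i)) / real n) \<le> (\<Sum>\<tau>\<in>T. \<Prod>i<n. real (\<tau> (w i)) / real n)"
    if w: "w \<in> words k n" for w
  proof -
    have "restrict (cnt n w) {..<k} \<in> T"
      using sum_cnt[OF wordsD[OF w]] cnt_le by (auto simp: T_def)
    then have "(\<Prod>i<n. real (restrict (cnt n w) {..<k} (w i)) / real n) \<le> (\<Sum>\<tau>\<in>T. \<Prod>i<n. real (\<tau> (w i)) / real n)"
      by (rule member_le_sum[where f="\<lambda>\<tau>. \<Prod>i<n. real (\<tau> (w i)) / real n"]) (auto intro: prod_nonneg fin)
    then show ?thesis using wordsD[OF w] by simp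
  qed
  then have "(\<Sum>w\<in>words k n. \<Prod>i<n. real (cnt n w (w i)) / real n)
      \<le> (\<Sum>w\<in>words k n. \<Sum>\<tau>\<in>T. \<Prod>i<n. real (\<tau> (w i)) / real n)" by (rule sum_mono)
  also have "\<dots> = (\<Sum>\<tau>\<in>T. \<Sum>w\<in>words k n. \<Prod>i<n. real (\<tau> (w i)) / real n)" by (rule sum.swap)
  also have "\<dots> = (\<Sum>\<tau>\<in>T. 1)"
  proof (rule sum.cong[OF refl])
    fix \<tau> assume \<tau>: "\<tau> \<in> T"
    have "(\<Sum>w\<in>words k n. \<Prod>i<n. real (\<tau> (w i)) / real n) = (\<Sum>j<k. real (\<tau> j) / real n) ^ n"
      by (rule sum_words_prod)
    also have "(\<Sum>j<k. real (\<tau> j) / real n) = 1"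
      using \<tau> n by (simp add: sum_divide_distrib[symmetric] T_def)
    finally show "(\<Sum>w\<in>words k n. \<Prod>i<n. real (\<tau> (w i)) / real n) = 1" by simp
  qed
  also have "\<dots> \<le> real (card (PiE {..<k} (\<lambda>_. {..n})))"
    using card_mono[OF finP, of T] by (auto simp: T_def)
  also have "\<dots> = (real n + 1) ^ k" by (simp add: card_PiE add.commute)
  finally show ?thesis .
qed

text \<open>
  The density, constant on cells, whose cell masses are the letter frequencies of the word.
\<close>

definition word_dens :: "nat \<Rightarrow> nat \<Rightarrow> (nat \<Rightarrow> nat) \<Rightarrow> real \<Rightarrow> real" where
  "word_dens k n w x = real k * real (cnt n w (cell k x)) / real n"

lemma word_dens_bdd:
  assumes "0 < n" shows "bdd_meas (word_dens k n w)"
proof (rule bdd_measI)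
  show "word_dens k n w \<in> borel_measurable borel"
    unfolding word_dens_def[abs_def]
    by (intro borel_measurable_divide borel_measurable_times) auto
  fix x
  have "real k * real (cnt n w (cell k x)) \<le> real k * real n"
    using cnt_le by (intro mult_left_mono) auto
  then show "\<bar>word_dens k n w x\<bar> \<le> real k" using assms by (simp add: word_dens_def field_simps)
qed

lemma word_dens:
  assumes k: "0 < k" and n: "0 < n" and w: "w \<in> words k n"
  shows "dens (word_dens k n w)"
    and "KL (word_dens k n w) = (\<Sum>j<k. real (cnt n w j) * ln (real k * real (cnt n w j) / real n)) / real n"
    and "j < k \<Longrightarrow> (\<integral>x. word_dens k n w x * indicator {x. cell k x = j} x \<partial>Exp1) = real (cnt n w j) / real n"
proof -
  have "(\<integral>x. word_dens k n w x \<partial>Exp1) = 1"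
    unfolding word_dens_def integral_cell[OF k, of "\<lambda>j. real k * real (cnt n w j) / real n"]
    using sum_cnt[OF wordsD[OF w]] k n
    by (simp add: sum_divide_distrib[symmetric] sum_distrib_left[symmetric])
  then show "dens (word_dens k n w)" using word_dens_bdd[OF n]
    by (simp add: dens_def) (simp add: word_dens_def)
  show "KL (word_dens k n w) = (\<Sum>j<k. real (cnt n w j) * ln (real k * real (cnt n w j) / real n)) / real n"
  proof -
    have "KL (word_dens k n w) = (\<Sum>j<k. real k * real (cnt n w j) / real n * ln (real k * real (cnt n w j) / real n)) / real k"
      unfolding KL_def word_dens_def by (rule integral_cell[OF k])
    also have "\<dots> = (\<Sum>j<k. real k * real (cnt n w j) / real n * ln (real k * real (cnt n w j) / real n) / real k)"
      by (rule sum_divide_distrib)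
    also have "\<dots> = (\<Sum>j<k. real (cnt n w j) * ln (real k * real (cnt n w j) / real n) / real n)"
      using k by (intro sum.cong) auto
    finally show ?thesis by (simp add: sum_divide_distrib)
  qed
  assume j: "j < k"
  have "(\<integral>x. word_dens k n w x * indicator {x. cell k x = j} x \<partial>Exp1)
     = (\<integral>x. real k * real (cnt n w (cell k x)) / real n * of_bool (cell k x = j) \<partial>Exp1)"
    by (rule Bochner_Integration.integral_cong) (auto simp: word_dens_def indicator_def)
  also have "\<dots> = (\<Sum>i<k. real k * real (cnt n w i) / real n * of_bool (i = j)) / real k"
    by (rule integral_cell[OF k])
  also have "(\<Sum>i<k. real k * real (cnt n w i) / real n * of_bool (i = j))
      = (\<Sum>i<k. if i = j then real k * real (cnt n w i) / real n else 0)"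
    by (rule sum.cong) auto
  also have "\<dots> / real k = real (cnt n w j) / real n" using j k by simp
  finally show "(\<integral>x. word_dens k n w x * indicator {x. cell k x = j} x \<partial>Exp1) = real (cnt n w j) / real n" .
qed

text \<open>
  The word has likelihood \<open>exp (n * KL)\<close> under its own letter frequencies, relative to
  uniform letters.
\<close>

lemma prod_own_type:
  assumes k: "0 < k" and n: "0 < n" and w: "w \<in> words k n"
  shows "(\<Prod>i<n. real (cnt n w (w i)) / real n) = exp (real n * KL (word_dens k n w)) / real k ^ n"
proof -
  have pos: "0 < cnt n w (w i)" if "i < n" for i
    using that unfolding cnt_def by (subst card_gt_0_iff) auto
  have "exp (real n * KL (word_dens k n w)) = exp (\<Sum>j<k. real (cnt n w j) * ln (real k * real (cnt n w j) / real n))"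
    using n by (simp add: word_dens(2)[OF k n w])
  also have "\<dots> = exp (\<Sum>i<n. ln (real k * real (cnt n w (w i)) / real n))"
    by (subst sum_word[OF wordsD[OF w]]) auto
  also have "\<dots> = (\<Prod>i<n. exp (ln (real k * real (cnt n w (w i)) / real n)))" by (rule exp_sum) simp
  also have "\<dots> = (\<Prod>i<n. real k * (real (cnt n w (w i)) / real n))"
    using pos k n by (intro prod.cong) auto
  also have "\<dots> = real k ^ n * (\<Prod>i<n. real (cnt n w (w i)) / real n)"
    by (simp only: prod.distrib prod_constant card_lessThan)
  finally show ?thesis using k by simp
qed

lemma card_words_le:
  assumes k: "0 < k" and n: "0 < n" and G: "G \<subseteq> words k n"
    and L: "\<And>w. w \<in> G \<Longrightarrow> L \<le> KL (word_dens k n w)"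
  shows "real (card G) / real k ^ n \<le> (real n + 1) ^ k * exp (- (real n * L))"
proof -
  have "real (card G) / real k ^ n = (\<Sum>w\<in>G. 1 / real k ^ n)" by simp
  also have "\<dots> \<le> (\<Sum>w\<in>G. (\<Prod>i<n. real (cnt n w (w i)) / real n) * exp (- (real n * L)))"
  proof (rule sum_mono)
    fix w assume w: "w \<in> G"
    have "1 \<le> exp (real n * KL (word_dens k n w)) * exp (- (real n * L))"
      using L[OF w] n by (simp add: exp_add[symmetric])
    then have "1 / real k ^ n \<le> exp (real n * KL (word_dens k n w)) * exp (- (real n * L)) / real k ^ n"
      by (rule divide_right_mono) simp
    then show "1 / real k ^ n \<le> (\<Prod>i<n. real (cnt n w (w i)) / real n) * exp (- (real n * L))"
      using prod_own_type[OF k n, of w] w G by auto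
  qed
  also have "\<dots> \<le> (\<Sum>w\<in>words k n. (\<Prod>i<n. real (cnt n w (w i)) / real n) * exp (- (real n * L)))"
    by (rule sum_mono2) (use G in \<open>auto intro!: mult_nonneg_nonneg prod_nonneg\<close>)
  also have "\<dots> = (\<Sum>w\<in>words k n. \<Prod>i<n. real (cnt n w (w i)) / real n) * exp (- (real n * L))"
    by (rule sum_distrib_right[symmetric])
  also have "\<dots> \<le> (real n + 1) ^ k * exp (- (real n * L))"
    by (intro mult_right_mono sum_words_own_type n) simp
  finally show ?thesis .
qed

lemma exp_quadratic_le:
  fixes x :: real
  assumes "\<bar>x\<bar> \<le> 1" shows "exp x \<le> 1 + x + x\<^sup>2"
proof (cases "0 \<le> x")
  case True then show ?thesis using exp_bound[of x] assms by simp
next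
  case False
  then have x: "- 1 \<le> x" "x < 0" using assms by auto
  have "0 < 1 - x + x\<^sup>2 / 2" using x by (simp add: add_pos_nonneg)
  have "1 - x + x\<^sup>2 / 2 \<le> exp (- x)" using exp_lower_Taylor_quadratic[of "- x"] x by simp
  then have "exp x \<le> 1 / (1 - x + x\<^sup>2 / 2)"
    using \<open>0 < 1 - x + x\<^sup>2 / 2\<close> by (simp add: exp_minus field_simps)
  also have "\<dots> \<le> 1 + x + x\<^sup>2"
  proof -
    have "(1 + x + x\<^sup>2) * (1 - x + x\<^sup>2 / 2) - 1 = x\<^sup>2 * (1 / 2 - x / 2 + x\<^sup>2 / 2)"
      by (simp add: power2_eq_square field_simps)
    moreover have "0 \<le> x\<^sup>2 * (1 / 2 - x / 2 + x\<^sup>2 / 2)" using x by (intro mult_nonneg_nonneg) auto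
    ultimately have "1 \<le> (1 + x + x\<^sup>2) * (1 - x + x\<^sup>2 / 2)" by linarith
    then show ?thesis using \<open>0 < 1 - x + x\<^sup>2 / 2\<close> by (simp add: field_simps)
  qed
  finally show ?thesis .
qed

text \<open>
  A weak law of large numbers for letters of distribution \<open>q\<close>, in the form of a Chernoff
  bound: the exponential moments factorize over the letters.
\<close>

lemma words_deviation_tendsto_0:
  fixes q \<psi> :: "nat \<Rightarrow> real"
  assumes q: "\<And>j. 0 \<le> q j" and q1: "(\<Sum>j<k. q j) = 1" and mu: "(\<Sum>j<k. q j * \<psi> j) \<le> \<mu>" and s: "0 < s"
  shows "(\<lambda>n. \<Sum>w | w \<in> words k n \<and> real n * (\<mu> + s) < (\<Sum>i<n. \<psi> (w i)). \<Prod>i<n. q (w i)) \<longlonglongrightarrow> 0"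
proof -
  define m where "m = (\<Sum>j<k. q j * \<psi> j)"
  define C where "C = s + (\<Sum>j<k. \<bar>\<psi> j - m\<bar>)"
  have sum_nn: "0 \<le> (\<Sum>j<k. \<bar>\<psi> j - m\<bar>)" by (rule sum_nonneg) auto
  have C: "0 < C" "s \<le> C" unfolding C_def using s sum_nn by linarith+
  have Cb: "\<bar>\<psi> j - m\<bar> \<le> C" if "j < k" for j
    using member_le_sum[of j "{..<k}" "\<lambda>j. \<bar>\<psi> j - m\<bar>"] that s by (auto simp: C_def)
  \<comment> \<open>minimizes the exponent \<open>\<theta>^2 * C^2 - \<theta> * s\<close>\<close>
  define \<theta> where "\<theta> = s / (2 * C\<^sup>2)"
  have \<theta>: "0 < \<theta>" using s C by (simp add: \<theta>_def)
  have \<theta>C: "\<theta> * C \<le> 1"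
  proof -
    have "\<theta> * C = s / (2 * C)" using C by (simp add: \<theta>_def power2_eq_square)
    also have "\<dots> \<le> 1" using C s by simp
    finally show ?thesis .
  qed
  define r where "r = exp (\<theta>\<^sup>2 * C\<^sup>2 - \<theta> * s)"
  have mgf: "(\<Sum>j<k. q j * exp (\<theta> * (\<psi> j - m))) \<le> exp (\<theta>\<^sup>2 * C\<^sup>2)"
  proof -
    have "(\<Sum>j<k. q j * exp (\<theta> * (\<psi> j - m))) \<le> (\<Sum>j<k. q j * (1 + \<theta> * (\<psi> j - m) + \<theta>\<^sup>2 * C\<^sup>2))"
    proof (intro sum_mono mult_left_mono q)
      fix j assume "j \<in> {..<k}"
      then have j: "\<bar>\<psi> j - m\<bar> \<le> C" using Cb by auto
      have "\<bar>\<theta> * (\<psi> j - m)\<bar> \<le> \<theta> * C" using j \<theta> by (simp add: abs_mult)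
      then have "exp (\<theta> * (\<psi> j - m)) \<le> 1 + \<theta> * (\<psi> j - m) + (\<theta> * (\<psi> j - m))\<^sup>2"
        using \<theta>C by (intro exp_quadratic_le) auto
      moreover have "(\<theta> * (\<psi> j - m))\<^sup>2 \<le> \<theta>\<^sup>2 * C\<^sup>2"
        using j abs_le_square_iff[of "\<psi> j - m" C] C by (simp add: power_mult_distrib mult_left_mono)
      ultimately show "exp (\<theta> * (\<psi> j - m)) \<le> 1 + \<theta> * (\<psi> j - m) + \<theta>\<^sup>2 * C\<^sup>2" by simp
    qed
    also have "\<dots> = (\<Sum>j<k. q j * (1 + \<theta>\<^sup>2 * C\<^sup>2 - \<theta> * m) + \<theta> * (q j * \<psi> j))"
      by (intro sum.cong refl) (simp add: algebra_simps)
    also have "\<dots> = (1 + \<theta>\<^sup>2 * C\<^sup>2 - \<theta> * m) + \<theta> * m"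
      unfolding sum.distrib sum_distrib_right[symmetric] sum_distrib_left[symmetric] q1 m_def[symmetric] by simp
    also have "\<dots> \<le> exp (\<theta>\<^sup>2 * C\<^sup>2)" using exp_ge_add_one_self[of "\<theta>\<^sup>2 * C\<^sup>2"] by simp
    finally show ?thesis .
  qed
  have bound: "(\<Sum>w | w \<in> words k n \<and> real n * (\<mu> + s) < (\<Sum>i<n. \<psi> (w i)). \<Prod>i<n. q (w i)) \<le> r ^ n" for n
  proof -
    have "(\<Sum>w | w \<in> words k n \<and> real n * (\<mu> + s) < (\<Sum>i<n. \<psi> (w i)). \<Prod>i<n. q (w i))
        \<le> (\<Sum>w | w \<in> words k n \<and> real n * (\<mu> + s) < (\<Sum>i<n. \<psi> (w i)).
             (\<Prod>i<n. q (w i) * exp (\<theta> * (\<psi> (w i) - m))) * exp (- (\<theta> * s)) ^ n)"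
    proof (rule sum_mono)
      fix w assume "w \<in> {w. w \<in> words k n \<and> real n * (\<mu> + s) < (\<Sum>i<n. \<psi> (w i))}"
      then have "real n * (\<mu> + s) < (\<Sum>i<n. \<psi> (w i))" by simp
      moreover have "real n * (m + s) \<le> real n * (\<mu> + s)" using mu by (intro mult_left_mono) (auto simp: m_def)
      moreover have "(\<Sum>i<n. \<psi> (w i) - m) = (\<Sum>i<n. \<psi> (w i)) - real n * m" by (simp add: sum_subtractf)
      ultimately have "real n * s \<le> (\<Sum>i<n. \<psi> (w i) - m)" by (simp add: algebra_simps)
      then have "\<theta> * (real n * s) \<le> \<theta> * (\<Sum>i<n. \<psi> (w i) - m)" using \<theta> by simp
      then have "1 \<le> exp (\<theta> * (\<Sum>i<n. \<psi> (w i) - m) - real n * (\<theta> * s))" by (simp add: algebra_simps)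
      also have "\<dots> = exp (\<theta> * (\<Sum>i<n. \<psi> (w i) - m)) * exp (real n * (- (\<theta> * s)))"
        by (simp add: exp_add[symmetric])
      also have "\<dots> = (\<Prod>i<n. exp (\<theta> * (\<psi> (w i) - m))) * exp (- (\<theta> * s)) ^ n"
        unfolding exp_of_nat_mult sum_distrib_left by (simp add: exp_sum)
      finally have "(\<Prod>i<n. q (w i)) * 1 \<le> (\<Prod>i<n. q (w i)) * ((\<Prod>i<n. exp (\<theta> * (\<psi> (w i) - m))) * exp (- (\<theta> * s)) ^ n)"
        using q by (intro mult_left_mono prod_nonneg) auto
      then show "(\<Prod>i<n. q (w i)) \<le> (\<Prod>i<n. q (w i) * exp (\<theta> * (\<psi> (w i) - m))) * exp (- (\<theta> * s)) ^ n"
        by (simp add: prod.distrib mult.assoc)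
    qed
    also have "\<dots> \<le> (\<Sum>w\<in>words k n. (\<Prod>i<n. q (w i) * exp (\<theta> * (\<psi> (w i) - m))) * exp (- (\<theta> * s)) ^ n)"
      by (rule sum_mono2) (auto intro!: mult_nonneg_nonneg prod_nonneg q)
    also have "\<dots> = (\<Sum>j<k. q j * exp (\<theta> * (\<psi> j - m))) ^ n * exp (- (\<theta> * s)) ^ n"
      by (simp add: sum_distrib_right[symmetric] sum_words_prod[of "\<lambda>j. q j * exp (\<theta> * (\<psi> j - m))"])
    also have "\<dots> \<le> exp (\<theta>\<^sup>2 * C\<^sup>2) ^ n * exp (- (\<theta> * s)) ^ n"
      by (intro mult_right_mono power_mono mgf sum_nonneg mult_nonneg_nonneg q) auto
    also have "\<dots> = r ^ n" by (simp add: r_def power_mult_distrib[symmetric] exp_add[symmetric])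
    finally show ?thesis .
  qed
  have "\<theta>\<^sup>2 * C\<^sup>2 = \<theta> * s / 2" using C by (simp add: \<theta>_def power2_eq_square field_simps)
  moreover have "0 < \<theta> * s" using \<theta> s by simp
  ultimately have "r < 1" by (simp add: r_def)
  then have lim: "(\<lambda>n. r ^ n) \<longlonglongrightarrow> 0" by (intro LIMSEQ_power_zero) (simp add: r_def)
  show ?thesis
  proof (rule tendsto_sandwich[OF _ _ tendsto_const lim])
    show "\<forall>\<^sub>F n in sequentially.
      0 \<le> (\<Sum>w | w \<in> words k n \<and> real n * (\<mu> + s) < (\<Sum>i<n. \<psi> (w i)). \<Prod>i<n. q (w i))"
      by (intro always_eventually allI sum_nonneg prod_nonneg q)
  qed (intro always_eventually allI bound)
qed

section \<open>Large deviations of the empirical functional\<close>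

definition std_sample :: "'a measure \<Rightarrow> (nat \<Rightarrow> 'a \<Rightarrow> real) \<Rightarrow> bool" where
  "std_sample M Y \<longleftrightarrow> prob_space M \<and> prob_space.indep_vars M (\<lambda>_. borel) Y UNIV \<and>
     (\<forall>i. Y i \<in> borel_measurable M) \<and> (\<forall>i. distr M borel (Y i) = Exp1)"

text \<open>
  One-sided versions of the event that \<open>D2\<close> exceeds \<open>a\<close>; the sign
  \<open>\<sigma>\<close> selects the side.
\<close>

definition exceed :: "'a measure \<Rightarrow> (nat \<Rightarrow> 'a \<Rightarrow> real) \<Rightarrow> real \<Rightarrow> nat \<Rightarrow> real \<Rightarrow> 'a set" where
  "exceed M Y \<sigma> n a = {\<omega> \<in> space M. \<exists>t\<ge>0. a < \<sigma> * Psi (emp n (\<lambda>i. Y i \<omega>)) t}"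

lemma exceed_measurable:
  assumes n: "0 < n" and Y: "std_sample M Y"
  shows "exceed M Y \<sigma> n a \<in> sets M"
proof -
  have [measurable]: "Y i \<in> borel_measurable M" for i using Y by (simp add: std_sample_def)
  have [measurable]: "(\<lambda>\<omega>. H2 n (\<lambda>i. Y i \<omega>) t) \<in> borel_measurable M" "(\<lambda>\<omega>. G2 n (\<lambda>i. Y i \<omega>) t) \<in> borel_measurable M" for t
    unfolding H2_def G2_def by measurable
  show ?thesis unfolding exceed_def Psi_emp_rational[OF n] by measurable
qed

definition sample_word :: "(nat \<Rightarrow> 'a \<Rightarrow> real) \<Rightarrow> nat \<Rightarrow> nat \<Rightarrow> 'a \<Rightarrow> nat \<Rightarrow> nat" where
  "sample_word Y k n \<omega> = (\<lambda>i\<in>{..<n}. cell k (Y i \<omega>))"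

lemma prob_sample_word:
  assumes Y: "std_sample M Y" and k: "0 < k" and n: "0 < n" and G: "G \<subseteq> words k n"
  shows "{\<omega> \<in> space M. sample_word Y k n \<omega> \<in> G} \<in> sets M"
    and "measure M {\<omega> \<in> space M. sample_word Y k n \<omega> \<in> G} = real (card G) / real k ^ n"
proof -
  interpret prob_space M using Y by (simp add: std_sample_def)
  have [measurable]: "Y i \<in> borel_measurable M" for i using Y by (simp add: std_sample_def)
  have ind: "indep_vars (\<lambda>_. borel) Y UNIV" using Y by (simp add: std_sample_def)
  define C where "C w = (\<Inter>i\<in>{..<n}. Y i -` {x. cell k x = w i} \<inter> space M)" for w
  have C_sets: "C w \<in> sets M" for w unfolding C_def
    using n by (intro sets.finite_INT) (auto intro!: measurable_sets[of _ M borel])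
  have in_C: "\<omega> \<in> C w \<longleftrightarrow> \<omega> \<in> space M \<and> sample_word Y k n \<omega> = w" if "w \<in> words k n" for \<omega> w
  proof -
    have "sample_word Y k n \<omega> = w \<longleftrightarrow> (\<forall>i<n. cell k (Y i \<omega>) = w i)"
      using that by (auto simp: sample_word_def words_def PiE_def extensional_def fun_eq_iff)
    then show ?thesis using n by (auto simp: C_def)
  qed
  have prob_C: "prob (C w) = 1 / real k ^ n" if w: "w \<in> words k n" for w
  proof -
    have "prob (C w) = (\<Prod>i\<in>{..<n}. prob (Y i -` {x. cell k x = w i} \<inter> space M))"
      unfolding C_def using n by (intro indep_varsD[OF ind]) auto
    also have "\<dots> = (\<Prod>i\<in>{..<n}. 1 / real k)"
    proof (rule prod.cong[OF refl])
      fix i assume i: "i \<in> {..<n}"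
      have "prob (Y i -` {x. cell k x = w i} \<inter> space M) = measure (distr M borel (Y i)) {x. cell k x = w i}"
        by (rule measure_distr[symmetric]) auto
      also have "distr M borel (Y i) = Exp1" using Y by (simp add: std_sample_def)
      also have "measure Exp1 {x. cell k x = w i} = 1 / real k"
        using wordsD[OF w] i by (intro measure_cell) auto
      finally show "prob (Y i -` {x. cell k x = w i} \<inter> space M) = 1 / real k" .
    qed
    also have "\<dots> = 1 / real k ^ n" by (simp add: power_one_over)
    finally show ?thesis .
  qed
  have fin: "finite G" using G finite_subset finite_words by blast
  have eq: "{\<omega> \<in> space M. sample_word Y k n \<omega> \<in> G} = (\<Union>w\<in>G. C w)"
  proof (rule set_eqI)
    fix \<omega>
    have "\<omega> \<in> (\<Union>w\<in>G. C w) \<longleftrightarrow> (\<exists>w\<in>G. \<omega> \<in> space M \<and> sample_word Y k n \<omega> = w)"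
      using in_C[OF subsetD[OF G]] by simp
    then show "\<omega> \<in> {\<omega> \<in> space M. sample_word Y k n \<omega> \<in> G} \<longleftrightarrow> \<omega> \<in> (\<Union>w\<in>G. C w)" by simp
  qed
  show "{\<omega> \<in> space M. sample_word Y k n \<omega> \<in> G} \<in> sets M"
    unfolding eq using fin C_sets by auto
  have "disjoint_family_on C G"
    unfolding disjoint_family_on_def
  proof (intro ballI impI equals0I)
    fix v w \<omega> assume vw: "v \<in> G" "w \<in> G" "v \<noteq> w" "\<omega> \<in> C v \<inter> C w"
    then have "sample_word Y k n \<omega> = v" "sample_word Y k n \<omega> = w"
      using in_C[OF subsetD[OF G vw(1)], of \<omega>] in_C[OF subsetD[OF G vw(2)], of \<omega>] by blast+
    then show False using vw(3) by simp
  qed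
  then have "prob (\<Union>w\<in>G. C w) = (\<Sum>w\<in>G. prob (C w))"
    using fin C_sets by (intro finite_measure_finite_Union) auto
  also have "\<dots> = (\<Sum>w\<in>G. 1 / real k ^ n)" using G prob_C by (intro sum.cong) auto
  finally show "measure M {\<omega> \<in> space M. sample_word Y k n \<omega> \<in> G} = real (card G) / real k ^ n"
    unfolding eq by simp
qed

lemma sample_word_in_words: "0 < k \<Longrightarrow> sample_word Y k n \<omega> \<in> words k n"
  using cell_less[of k] by (auto simp: sample_word_def words_def)

lemma measure_emp_cell:
  assumes "0 < n"
  shows "measure (emp n (\<lambda>i. Y i \<omega>)) {x. cell k x = j} = real (cnt n (sample_word Y k n \<omega>) j) / real n"
proof -
  have "(\<Sum>i<n. indicator {x. cell k x = j} (Y i \<omega>)) = (\<Sum>i<n. of_bool (sample_word Y k n \<omega> i = j) :: real)"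
    by (intro sum.cong) (auto simp: sample_word_def indicator_def)
  then show ?thesis using assms by (simp add: measure_emp cnt_eq_sum del: sum_of_bool_eq)
qed

text \<open>
  If no cell is visited too often, the empirical measure is close to the piecewise constant law of the
  word, which then exceeds the level \<open>b\<close> and has entropy at least \<open>L\<close>. If some
  cell has frequency above \<open>\<eta>\<close>, its tiny exponential mass \<open>1 / k\<close> forces
  an entropy of at least \<open>\<eta> * ln k - 1\<close>. So for large \<open>k\<close> all words
  compatible with the event have entropy at least \<open>L\<close>.
\<close>

lemma exceed_upper:
  fixes a b L :: real
  assumes Y: "std_sample M Y" and \<sigma>: "\<sigma> \<in> {1, -1}" and ba: "b < a"
    and L: "\<And>f t. dens f \<Longrightarrow> 0 \<le> t \<Longrightarrow> b < \<sigma> * Bil t f f \<Longrightarrow> L \<le> KL f"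
  shows "\<exists>k. \<forall>n>0. measure M (exceed M Y \<sigma> n a) \<le> (real n + 1) ^ k * exp (- (real n * L))"
proof -
  define \<eta> where "\<eta> = (a - b) / 8"
  have \<eta>: "0 < \<eta>" "4 * \<eta> < a - b" using ba by (auto simp: \<eta>_def)
  obtain k :: nat where k: "exp (max 0 ((L + 1) / \<eta>)) < real k" using reals_Archimedean2 by blast
  have k0: "0 < k" using k exp_gt_zero[of "max 0 ((L + 1) / \<eta>)"] by (cases k) (auto simp del: exp_gt_zero)
  have lk: "max 0 ((L + 1) / \<eta>) < ln (real k)" using k k0 by (metis ln_less_cancel_iff exp_gt_zero ln_exp of_nat_0_less_iff)
  then have lnk: "0 \<le> ln (real k)" "(L + 1) / \<eta> < ln (real k)" by linarith+
  then have lnk2: "L + 1 < \<eta> * ln (real k)" using \<eta> by (simp add: pos_divide_less_eq mult.commute)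
  show ?thesis
  proof (intro exI[of _ k] allI impI)
    fix n :: nat assume n: "0 < n"
    interpret prob_space M using Y by (simp add: std_sample_def)
    define G where "G = {w \<in> words k n. L \<le> KL (word_dens k n w)}"
    have G: "G \<subseteq> words k n" by (auto simp: G_def)
    have "exceed M Y \<sigma> n a \<subseteq> {\<omega> \<in> space M. sample_word Y k n \<omega> \<in> G}"
    proof
      fix \<omega> assume "\<omega> \<in> exceed M Y \<sigma> n a"
      then obtain t where t: "0 \<le> t" "a < \<sigma> * Psi (emp n (\<lambda>i. Y i \<omega>)) t" and \<omega>: "\<omega> \<in> space M"
        by (auto simp: exceed_def)
      define w where "w = sample_word Y k n \<omega>"
      have w: "w \<in> words k n" unfolding w_def by (rule sample_word_in_words[OF k0])
      note wd = word_dens[OF k0 n w]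
      have "L \<le> KL (word_dens k n w)"
      proof (cases "\<exists>j<k. \<eta> < real (cnt n w j) / real n")
        case True
        then obtain j where j: "j < k" "\<eta> < real (cnt n w j) / real n" by blast
        have "measure Exp1 {x. cell k x = j} \<le> exp (- ln (real k))"
          using j k0 by (simp add: measure_cell exp_minus field_simps)
        from mass_le[OF wd(1) _ lnk(1) this] have "ln (real k) * (real (cnt n w j) / real n) \<le> KL (word_dens k n w) + 1"
          using wd(3)[OF j(1)] by simp
        moreover have "ln (real k) * \<eta> \<le> ln (real k) * (real (cnt n w j) / real n)"
          using j lnk by (intro mult_left_mono) auto
        ultimately show ?thesis using lnk2 by (simp add: mult.commute)
      next
        case False
        have m: "measure (law (word_dens k n w)) {x. cell k x = j} = real (cnt n w j) / real n" if "j < k" for j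
          using wd(3)[OF that] measure_law[OF wd(1), of "{x. cell k x = j}"] by simp
        have "\<bar>lcdf (emp n (\<lambda>i. Y i \<omega>)) x - lcdf (law (word_dens k n w)) x\<bar> \<le> real k * 0 + \<eta>" for x
        proof (rule lcdf_diff_cells[OF real_distribution_emp real_distribution_law[OF wd(1)] k0])
          fix j assume j: "j < k"
          show "\<bar>measure (emp n (\<lambda>i. Y i \<omega>)) {x. cell k x = j} - measure (law (word_dens k n w)) {x. cell k x = j}\<bar> \<le> 0"
            using m[OF j] measure_emp_cell[OF n, of Y \<omega> k j] by (simp add: w_def)
          show "measure (law (word_dens k n w)) {x. cell k x = j} \<le> \<eta>"
            unfolding m[OF j] using False j by (meson not_less)
        qed
        then have "\<bar>Psi (emp n (\<lambda>i. Y i \<omega>)) t - Psi (law (word_dens k n w)) t\<bar> \<le> 4 * \<eta>"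
          by (intro Psi_lipschitz real_distribution_emp real_distribution_law[OF wd(1)]) simp
        then have "b < \<sigma> * Bil t (word_dens k n w) (word_dens k n w)"
          using \<sigma> t \<eta> unfolding Psi_law[OF wd(1)] by auto
        then show ?thesis by (rule L[OF wd(1) t(1)])
      qed
      then show "\<omega> \<in> {\<omega> \<in> space M. sample_word Y k n \<omega> \<in> G}" using \<omega> w by (simp add: G_def w_def)
    qed
    then have "measure M (exceed M Y \<sigma> n a) \<le> measure M {\<omega> \<in> space M. sample_word Y k n \<omega> \<in> G}"
      using prob_sample_word(1)[OF Y k0 n G] by (rule finite_measure_mono)
    also have "\<dots> = real (card G) / real k ^ n" by (rule prob_sample_word(2)[OF Y k0 n G])
    also have "\<dots> \<le> (real n + 1) ^ k * exp (- (real n * L))"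
      by (rule card_words_le[OF k0 n G]) (simp add: G_def)
    finally show "measure M (exceed M Y \<sigma> n a) \<le> (real n + 1) ^ k * exp (- (real n * L))" .
  qed
qed

lemma sum_cell_masses:
  assumes "real_distribution \<mu>" "0 < k"
  shows "(\<Sum>j<k. measure \<mu> {x. cell k x = j}) = 1"
proof -
  interpret real_distribution \<mu> by fact
  have "{x. cell k x < k} = space \<mu>" using cell_less[OF assms(2)] by auto
  then show ?thesis using measure_cells_less[OF assms(1), of k k] prob_space by simp
qed

text \<open>
  Coarse graining does not increase entropy. Young's inequality is applied to the logarithm of the density
  of cell masses; where a cell has mass 0 this logarithm is replaced by \<open>ln e\<close>, at a cost of
  at most \<open>e\<close>.
\<close>

lemma KL_cells_le:
  assumes f: "dens f" and k: "0 < k"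
  shows "(\<Sum>j<k. measure (law f) {x. cell k x = j} * ln (real k * measure (law f) {x. cell k x = j})) \<le> KL f"
proof (rule field_le_epsilon)
  fix e :: real assume e: "0 < e"
  define q where "q j = measure (law f) {x. cell k x = j}" for j
  interpret Q: real_distribution "law f" by (rule real_distribution_law[OF f])
  have q1: "(\<Sum>j<k. q j) = 1"
    unfolding q_def by (rule sum_cell_masses[OF real_distribution_law[OF f] k])
  define \<phi> where "\<phi> j = (if q j = 0 then ln e else ln (real k * q j))" for j
  define \<psi> where "\<psi> j = (if j < k then \<phi> j else 0)" for j
  have b: "bdd_meas (\<lambda>x. \<phi> (cell k x))"
  proof (rule bdd_measI)
    fix x
    show "\<bar>\<phi> (cell k x)\<bar> \<le> (\<Sum>j<k. \<bar>\<phi> j\<bar>)"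
      using cell_less[OF k] by (intro member_le_sum[where f="\<lambda>j. \<bar>\<phi> j\<bar>"]) auto
  qed measurable
  have df: "(\<integral>x. f x * \<phi> (cell k x) \<partial>Exp1) = (\<Sum>j<k. q j * \<phi> j)"
  proof -
    have i: "integrable Exp1 (\<lambda>x. (f x * indicator {x. cell k x = j} x) * \<phi> j)" for j
      by (intro integrable_bdd_meas bdd_meas_mult bdd_meas_const bdd_meas_indicator densD[OF f]) simp
    have "(\<integral>x. f x * \<phi> (cell k x) \<partial>Exp1) = (\<integral>x. (\<Sum>j<k. (f x * indicator {x. cell k x = j} x) * \<phi> j) \<partial>Exp1)"
    proof (rule Bochner_Integration.integral_cong)
      fix x
      have "(\<Sum>j<k. (f x * indicator {x. cell k x = j} x) * \<phi> j) = (\<Sum>j<k. if j = cell k x then f x * \<phi> j else 0)"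
        by (rule sum.cong) (auto simp: indicator_def)
      then show "f x * \<phi> (cell k x) = (\<Sum>j<k. (f x * indicator {x. cell k x = j} x) * \<phi> j)"
        using cell_less[OF k, of x] by simp
    qed simp
    also have "\<dots> = (\<Sum>j<k. \<integral>x. (f x * indicator {x. cell k x = j} x) * \<phi> j \<partial>Exp1)"
      by (rule Bochner_Integration.integral_sum) (rule i)
    also have "\<dots> = (\<Sum>j<k. q j * \<phi> j)"
      unfolding q_def by (intro sum.cong refl, subst integral_mult_left_zero) (simp add: measure_law[OF f])
    finally show ?thesis .
  qed
  have "(\<integral>x. exp (\<phi> (cell k x)) \<partial>Exp1) = (\<Sum>j<k. exp (\<phi> j)) / real k" by (rule integral_cell[OF k])
  also have "\<dots> \<le> (\<Sum>j<k. real k * q j + e) / real k"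
  proof (intro divide_right_mono sum_mono)
    fix j
    have "q j = 0 \<or> 0 < q j" unfolding q_def using zero_less_measure_iff by blast
    then show "exp (\<phi> j) \<le> real k * q j + e" using e k by (auto simp: \<phi>_def)
  qed simp
  also have "\<dots> = 1 + e" using k by (simp add: sum.distrib sum_distrib_left[symmetric] q1 field_simps)
  finally have "(\<integral>x. exp (\<phi> (cell k x)) \<partial>Exp1) \<le> 1 + e" .
  with KL_young[OF f b] have "(\<Sum>j<k. q j * \<phi> j) \<le> KL f + e" by (simp add: df)
  moreover have "(\<Sum>j<k. q j * \<phi> j) = (\<Sum>j<k. q j * ln (real k * q j))"
    by (rule sum.cong) (auto simp: \<phi>_def)
  ultimately show "(\<Sum>j<k. measure (law f) {x. cell k x = j} * ln (real k * measure (law f) {x. cell k x = j})) \<le> KL f + e"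
    by (simp add: q_def)
qed

lemma sum_UN_le:
  fixes g :: "'b \<Rightarrow> real"
  assumes "finite I" "\<And>i. i \<in> I \<Longrightarrow> finite (A i)" "\<And>x. 0 \<le> g x"
  shows "sum g (\<Union>i\<in>I. A i) \<le> (\<Sum>i\<in>I. sum g (A i))"
  using assms
proof (induction I rule: finite_induct)
  case (insert i I)
  have "sum g (\<Union>j\<in>insert i I. A j) = sum g (A i \<union> (\<Union>j\<in>I. A j))" by simp
  also have "\<dots> = sum g (A i) + sum g (\<Union>j\<in>I. A j) - sum g (A i \<inter> (\<Union>j\<in>I. A j))"
    using insert by (intro sum_Un) auto
  also have "\<dots> \<le> sum g (A i) + (\<Sum>j\<in>I. sum g (A j))"
    using insert sum_nonneg[of "A i \<inter> (\<Union>j\<in>I. A j)" g] by auto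
  finally show ?case using insert by simp
qed simp

text \<open>
  Under letters distributed like the cell masses \<open>q\<close> of \<open>f\<close>, almost all words
  have letter frequencies close to \<open>q\<close>, which puts the empirical measure near the law of
  \<open>f\<close>, and have likelihood ratio at most about \<open>exp (n * KL f)\<close> with respect
  to uniform letters.
\<close>

lemma exceed_lower:
  fixes M :: "'a measure" and a \<kappa> :: real
  assumes Y: "std_sample M Y" and \<sigma>: "\<sigma> \<in> {1, -1}" and f: "dens f" and t: "0 \<le> t"
    and a: "a < \<sigma> * Bil t f f" and \<kappa>: "0 < \<kappa>"
  shows "\<forall>\<^sub>F n in sequentially. exp (- (real n * (KL f + \<kappa>))) \<le> measure M (exceed M Y \<sigma> n a)"
proof -
  interpret prob_space M using Y by (simp add: std_sample_def)
  interpret Q: real_distribution "law f" by (rule real_distribution_law[OF f])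
  note d = densD[OF f]
  obtain B where B: "\<And>x. \<bar>f x\<bar> \<le> B" using d(1) by (auto simp: bdd_meas_def)
  define \<eta> where "\<eta> = (\<sigma> * Bil t f f - a) / 16"
  have \<eta>: "0 < \<eta>" using a by (simp add: \<eta>_def)
  \<comment> \<open>a density bounded by \<open>B\<close> gives each cell mass at most
     \<open>B / k \<le> \<eta>\<close>; with frequencies off by at most \<open>\<rho>\<close> the
     distance of the distribution functions is at most
     \<open>k * \<rho> + \<eta> = 2 * \<eta>\<close>, which moves \<open>Psi\<close> by at most
     \<open>8 * \<eta>\<close>\<close>
  obtain k :: nat where k: "max 0 (B / \<eta>) < real k" using reals_Archimedean2 by blast
  have k0: "0 < k" and Bk: "B / real k \<le> \<eta>"
  proof -
    show "0 < k" using k by (cases k) auto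
    then show "B / real k \<le> \<eta>" using k \<eta> by (simp add: field_simps)
  qed
  define \<rho> where "\<rho> = \<eta> / real k"
  have \<rho>: "0 < \<rho>" "real k * \<rho> = \<eta>" using \<eta> k0 by (auto simp: \<rho>_def)
  define q where "q j = measure (law f) {x. cell k x = j}" for j
  have q0: "0 \<le> q j" for j by (simp add: q_def)
  have q1: "(\<Sum>j<k. q j) = 1"
    unfolding q_def by (rule sum_cell_masses[OF real_distribution_law[OF f] k0])
  have qB: "q j \<le> \<eta>" if "j < k" for j
  proof -
    have "q j = (\<integral>x. f x * indicator {x. cell k x = j} x \<partial>Exp1)" by (simp add: q_def measure_law[OF f])
    also have "\<dots> \<le> (\<integral>x. B * indicator {x. cell k x = j} x \<partial>Exp1)"
      using B[THEN abs_le_D1] by (intro integral_mono integrable_bdd_meas bdd_meas_mult bdd_meas_const bdd_meas_indicator d)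
         (auto intro: mult_right_mono)
    also have "\<dots> = B / real k" using that Exp1.space_eq_univ by (simp add: measure_cell)
    finally show ?thesis using Bk by simp
  qed
  define \<phi> where "\<phi> j = ln (real k * q j)" for j
  have KLq: "(\<Sum>j<k. q j * \<phi> j) \<le> KL f" unfolding q_def \<phi>_def by (rule KL_cells_le[OF f k0])
  define wt where "wt n w = (\<Prod>i<n. q (w i))" for n and w :: "nat \<Rightarrow> nat"
  have wt0: "0 \<le> wt n w" for n w unfolding wt_def by (intro prod_nonneg q0)
  \<comment> \<open>the exceptional words: letter \<open>j\<close> too frequent, letter \<open>j\<close> too rare,
     likelihood ratio too large\<close>
  define B1 where "B1 j n = {w. w \<in> words k n \<and> real n * (q j + \<rho>) < (\<Sum>i<n. of_bool (w i = j))}" for j n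
  define B2 where "B2 j n = {w. w \<in> words k n \<and> real n * (- q j + \<rho>) < (\<Sum>i<n. - of_bool (w i = j))}" for j n
  define B3 where "B3 n = {w. w \<in> words k n \<and> real n * (KL f + \<kappa> / 2) < (\<Sum>i<n. \<phi> (w i))}" for n
  have qj: "(\<Sum>i<k. q i * of_bool (i = j)) = q j" if "j < k" for j
  proof -
    have "(\<Sum>i<k. q i * of_bool (i = j)) = (\<Sum>i<k. if i = j then q i else 0)" by (rule sum.cong) auto
    then show ?thesis using that by simp
  qed
  have l1: "(\<lambda>n. \<Sum>w\<in>B1 j n. wt n w) \<longlonglongrightarrow> 0" if "j < k" for j
    unfolding B1_def wt_def
    by (rule words_deviation_tendsto_0[OF q0 q1 _ \<rho>(1), where \<psi>="\<lambda>i. of_bool (i = j)"]) (simp only: qj[OF that] order_refl)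
  have l2: "(\<lambda>n. \<Sum>w\<in>B2 j n. wt n w) \<longlonglongrightarrow> 0" if "j < k" for j
    unfolding B2_def wt_def
    by (rule words_deviation_tendsto_0[OF q0 q1 _ \<rho>(1), where \<psi>="\<lambda>i. - of_bool (i = j)"])
       (simp only: mult_minus_right sum_negf qj[OF that] order_refl)
  have l3: "(\<lambda>n. \<Sum>w\<in>B3 n. wt n w) \<longlonglongrightarrow> 0"
    unfolding B3_def wt_def
    by (rule words_deviation_tendsto_0[OF q0 q1 KLq]) (use \<kappa> in simp)
  have "(\<lambda>n. (\<Sum>j<k. (\<Sum>w\<in>B1 j n. wt n w) + (\<Sum>w\<in>B2 j n. wt n w)) + (\<Sum>w\<in>B3 n. wt n w)) \<longlonglongrightarrow> (\<Sum>j<k. 0 + 0) + 0"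
    by (intro tendsto_add tendsto_sum l1 l2 l3) auto
  then have "\<forall>\<^sub>F n in sequentially. (\<Sum>j<k. (\<Sum>w\<in>B1 j n. wt n w) + (\<Sum>w\<in>B2 j n. wt n w)) + (\<Sum>w\<in>B3 n. wt n w) < 1 / 2"
    by (rule order_tendstoD) simp
  moreover have "\<forall>\<^sub>F n in sequentially. exp (- (real n * (\<kappa> / 2))) < 1 / 2"
  proof -
    have "(\<lambda>n. exp (- (\<kappa> / 2)) ^ n) \<longlonglongrightarrow> 0" using \<kappa> by (intro LIMSEQ_power_zero) simp
    then have "\<forall>\<^sub>F n in sequentially. exp (- (\<kappa> / 2)) ^ n < 1 / 2" by (rule order_tendstoD) simp
    then show ?thesis by (simp add: exp_of_nat_mult[symmetric])
  qed
  moreover have "\<forall>\<^sub>F n in sequentially. 0 < n" by (rule eventually_gt_at_top)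
  ultimately show ?thesis
  proof eventually_elim
    case (elim n)
    define Bad where "Bad = (\<Union>j<k. B1 j n \<union> B2 j n) \<union> B3 n"
    define G where "G = words k n - Bad"
    have fin: "finite (B1 j n)" "finite (B2 j n)" "finite (B3 n)" for j
      unfolding B1_def B2_def B3_def by simp_all
    have finG: "finite G" "G \<subseteq> words k n" by (auto simp: G_def)
    have "(\<Sum>w\<in>Bad. wt n w) \<le> (\<Sum>w\<in>(\<Union>j<k. B1 j n \<union> B2 j n). wt n w) + (\<Sum>w\<in>B3 n. wt n w)"
      unfolding Bad_def using fin wt0 by (subst sum_Un) (auto intro!: sum_nonneg)
    also have "(\<Sum>w\<in>(\<Union>j<k. B1 j n \<union> B2 j n). wt n w) \<le> (\<Sum>j<k. \<Sum>w\<in>B1 j n \<union> B2 j n. wt n w)"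
      using fin wt0 by (intro sum_UN_le) auto
    also have "\<dots> \<le> (\<Sum>j<k. (\<Sum>w\<in>B1 j n. wt n w) + (\<Sum>w\<in>B2 j n. wt n w))"
      using fin wt0 by (intro sum_mono, subst sum_Un) (auto intro!: sum_nonneg)
    finally have bad: "(\<Sum>w\<in>Bad. wt n w) < 1 / 2" using elim(1) by simp
    have "(\<Sum>w\<in>words k n. wt n w) = 1" unfolding wt_def by (simp add: sum_words_prod q1)
    moreover have "words k n \<subseteq> G \<union> Bad" by (auto simp: G_def)
    then have "(\<Sum>w\<in>words k n. wt n w) \<le> (\<Sum>w\<in>G \<union> Bad. wt n w)"
      using finG fin wt0 by (intro sum_mono2) (auto simp: Bad_def)
    moreover have "(\<Sum>w\<in>G \<union> Bad. wt n w) = (\<Sum>w\<in>G. wt n w) + (\<Sum>w\<in>Bad. wt n w)"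
      using finG fin by (intro sum.union_disjoint) (auto simp: Bad_def G_def)
    ultimately have good: "1 / 2 < (\<Sum>w\<in>G. wt n w)" using bad by linarith
    have "(\<Sum>w\<in>G. wt n w) \<le> (\<Sum>w\<in>G. exp (real n * (KL f + \<kappa> / 2)) / real k ^ n)"
    proof (rule sum_mono)
      fix w assume w: "w \<in> G"
      show "wt n w \<le> exp (real n * (KL f + \<kappa> / 2)) / real k ^ n"
      proof (cases "\<exists>i<n. q (w i) = 0")
        case True
        then have "wt n w = 0" unfolding wt_def by (intro prod_zero) auto
        then show ?thesis by simp
      next
        case False
        have "real k ^ n * wt n w = (\<Prod>i<n. real k * q (w i))"
          by (simp only: wt_def prod.distrib prod_constant card_lessThan)
        also have "\<dots> = (\<Prod>i<n. exp (\<phi> (w i)))"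
        proof (rule prod.cong[OF refl])
          fix i assume "i \<in> {..<n}"
          then have "q (w i) \<noteq> 0" using False by blast
          then have "0 < q (w i)" using q0[of "w i"] by linarith
          then have "0 < real k * q (w i)" using k0 by simp
          then show "real k * q (w i) = exp (\<phi> (w i))" by (simp add: \<phi>_def)
        qed
        also have "\<dots> = exp (\<Sum>i<n. \<phi> (w i))" by (simp add: exp_sum)
        also have "\<dots> \<le> exp (real n * (KL f + \<kappa> / 2))"
          using w by (auto simp: G_def Bad_def B3_def)
        finally show ?thesis using k0 by (simp add: pos_le_divide_eq mult.commute)
      qed
    qed
    also have "\<dots> = real (card G) / real k ^ n * exp (real n * (KL f + \<kappa> / 2))" by simp
    finally have "exp (- (real n * (\<kappa> / 2))) \<le> real (card G) / real k ^ n * exp (real n * (KL f + \<kappa> / 2))"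
      using good elim(2) by linarith
    then have "exp (- (real n * (\<kappa> / 2))) * exp (- (real n * (KL f + \<kappa> / 2)))
      \<le> real (card G) / real k ^ n * exp (real n * (KL f + \<kappa> / 2)) * exp (- (real n * (KL f + \<kappa> / 2)))"
      by (rule mult_right_mono) simp
    also have "\<dots> = real (card G) / real k ^ n" by (simp add: exp_add[symmetric] mult.assoc)
    also have "exp (- (real n * (\<kappa> / 2))) * exp (- (real n * (KL f + \<kappa> / 2))) = exp (- (real n * (KL f + \<kappa>)))"
      unfolding exp_add[symmetric] by (rule arg_cong[of _ _ exp]) (simp add: field_simps)
    also have "real (card G) / real k ^ n = measure M {\<omega> \<in> space M. sample_word Y k n \<omega> \<in> G}"
      by (rule prob_sample_word(2)[OF Y k0 elim(3) finG(2), symmetric])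
    also have "\<dots> \<le> measure M (exceed M Y \<sigma> n a)"
    proof (rule finite_measure_mono[OF _ exceed_measurable[OF elim(3) Y]], rule subsetI)
      fix \<omega> assume "\<omega> \<in> {\<omega> \<in> space M. sample_word Y k n \<omega> \<in> G}"
      then have \<omega>: "\<omega> \<in> space M" and w: "sample_word Y k n \<omega> \<in> G" by auto
      define w where "w = sample_word Y k n \<omega>"
      have dev: "\<bar>real (cnt n w j) / real n - q j\<bar> \<le> \<rho>" if "j < k" for j
      proof -
        have "w \<in> words k n" "w \<notin> B1 j n" "w \<notin> B2 j n" using w that by (auto simp: G_def Bad_def w_def)
        then have "real (cnt n w j) \<le> real n * (q j + \<rho>)" "- real (cnt n w j) \<le> real n * (- q j + \<rho>)"
          unfolding B1_def B2_def cnt_eq_sum by (auto simp: not_less sum_negf simp del: sum_of_bool_eq)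
        moreover have "0 < real n" using elim(3) by simp
        ultimately have "real (cnt n w j) / real n \<le> q j + \<rho>" "(- real (cnt n w j)) / real n \<le> - q j + \<rho>"
          by (simp_all only: pos_divide_le_eq mult.commute)
        then show ?thesis by (simp add: abs_le_iff)
      qed
      have "\<bar>lcdf (emp n (\<lambda>i. Y i \<omega>)) x - lcdf (law f) x\<bar> \<le> real k * \<rho> + \<eta>" for x
        by (rule lcdf_diff_cells[OF real_distribution_emp real_distribution_law[OF f] k0])
           (unfold measure_emp_cell[OF elim(3)] w_def[symmetric] q_def[symmetric], fact dev, fact qB)
      then have "\<bar>Psi (emp n (\<lambda>i. Y i \<omega>)) t - Psi (law f) t\<bar> \<le> 4 * (2 * \<eta>)"
        using \<rho> by (intro Psi_lipschitz real_distribution_emp real_distribution_law[OF f]) simp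
      moreover have "16 * \<eta> = \<sigma> * Bil t f f - a" by (simp add: \<eta>_def)
      ultimately have "a < \<sigma> * Psi (emp n (\<lambda>i. Y i \<omega>)) t"
        using \<sigma> \<eta> unfolding Psi_law[OF f] by auto
      then show "\<omega> \<in> exceed M Y \<sigma> n a" using t \<omega> by (auto simp: exceed_def)
    qed
    finally show ?case .
  qed
qed

section \<open>The rate function\<close>

definition rate :: "real \<Rightarrow> real \<Rightarrow> ereal" where
  "rate \<sigma> a = (INF f\<in>{f. dens f \<and> (\<exists>t\<ge>0. a < \<sigma> * Bil t f f)}. ereal (KL f))"

lemma rate_mono: "a \<le> b \<Longrightarrow> rate \<sigma> a \<le> rate \<sigma> b"
  unfolding rate_def by (rule INF_superset_mono) (auto intro: le_less_trans)

lemma rate_nonneg: "0 \<le> rate \<sigma> a"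
  unfolding rate_def by (rule INF_greatest) (auto simp: KL_nonneg)

lemma rate_le: "dens f \<Longrightarrow> 0 \<le> t \<Longrightarrow> a < \<sigma> * Bil t f f \<Longrightarrow> rate \<sigma> a \<le> ereal (KL f)"
  unfolding rate_def by (rule INF_lower) auto

lemma rate_lessD:
  assumes "rate \<sigma> a < c"
  obtains f t where "dens f" "0 \<le> t" "a < \<sigma> * Bil t f f" "ereal (KL f) < c"
  using assms unfolding rate_def INF_less_iff by auto

lemma sign_Bil_le_cap:
  assumes "\<sigma> \<in> {1, -1}" "dens f" "0 \<le> t" shows "\<sigma> * Bil t f f \<le> level_cap \<sigma>"
proof (cases "\<sigma> = 1")
  case True then show ?thesis using Bil_abs_le_1[OF assms(2), of t] by (simp add: level_cap_def)
next
  case False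
  have "lcdf (law f) 0 = 0" using cd_dens(4)[OF assms(2), of 0] by (simp add: lcdf_law[OF assms(2)])
  from neg_Psi_le_quarter[OF real_distribution_law[OF assms(2)] this assms(3)]
  show ?thesis using False assms(1) by (simp add: level_cap_def Psi_law[OF assms(2)])
qed

lemma rate_infinite:
  assumes "\<sigma> \<in> {1, -1}" "level_cap \<sigma> \<le> a" shows "rate \<sigma> a = \<infinity>"
proof -
  have "{f. dens f \<and> (\<exists>t\<ge>0. a < \<sigma> * Bil t f f)} = {}"
    using sign_Bil_le_cap[OF assms(1)] assms(2) by fastforce
  then show ?thesis unfolding rate_def by (simp only: image_empty Inf_empty top_ereal_def)
qed

text \<open>
  Sign 1: the exponential law conditioned on \<open>[3 / 4, 1)\<close>. Sign -1: half of the mass on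
  \<open>[0, 1 / 4)\<close> and half on \<open>[1, 3 / 2)\<close>, where all mixed pairs satisfy
  \<open>x + y / 2 < 1\<close>.
\<close>

lemma cap_attained:
  assumes "\<sigma> \<in> {1, -1}" shows "\<exists>f. dens f \<and> \<sigma> * Bil 1 f f = level_cap \<sigma>"
proof (cases "\<sigma> = 1")
  case True
  have m: "0 < (\<integral>x. 1 * indicator {3 * 1 / 4..<1} x \<partial>Exp1 :: real)"
    using measure_Exp1_interval[of "3/4" 1] Exp1.space_eq_univ by simp
  have "{3 * 1 / 4..<1} \<in> sets (borel :: real measure)" by simp
  then show ?thesis
    using cond_dens(1)[OF dens_one _ m order_refl] Bil_cond_dens_self[OF dens_one m] True
    by (intro exI[of _ "cond_dens {3 * 1 / 4..<1} (\<lambda>_. 1)"]) (simp add: level_cap_def)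
next
  case False
  define A B where "A = {0..<1/4::real}" and "B = {1..<3/2::real}"
  have AB: "A \<in> sets borel" "B \<in> sets borel" by (auto simp: A_def B_def)
  have mA: "0 < (\<integral>x. 1 * indicator A x \<partial>Exp1 :: real)" and mB: "0 < (\<integral>x. 1 * indicator B x \<partial>Exp1 :: real)"
    using measure_Exp1_interval[of 0 "1/4"] measure_Exp1_interval[of 1 "3/2"] Exp1.space_eq_univ
    by (simp_all add: A_def B_def)
  define p q where "p = cond_dens A (\<lambda>_. 1)" and "q = cond_dens B (\<lambda>_. 1)"
  have p: "dens p" and q: "dens q"
    unfolding p_def q_def by (rule cond_dens(1)[OF dens_one AB(1) mA order_refl] cond_dens(1)[OF dens_one AB(2) mB order_refl])+
  define f where "f x = 1 / 2 * p x + 1 / 2 * q x" for x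
  have f: "dens f" unfolding f_def[abs_def] by (rule dens_mix[OF p q]) auto
  have c: "cd f x = 1 / 2" if "1 / 4 \<le> x" "x \<le> 1" for x
  proof -
    have "cd p x = 1" unfolding p_def by (rule cd_cond_dens(2)[OF dens_one AB(1) mA]) (use that in \<open>auto simp: A_def\<close>)
    moreover have "cd q x = 0" unfolding q_def by (rule cd_cond_dens(1)[OF dens_one AB(2) mB]) (use that in \<open>auto simp: B_def\<close>)
    ultimately show ?thesis unfolding f_def[abs_def] by (subst cd_lin) (use densD[OF p] densD[OF q] in auto)
  qed
  have eq: "f y * cd f (1 - y / 2) = f y * (1 / 2)" for y
  proof (cases "y \<in> A \<union> B")
    case True
    then have "cd f (1 - y / 2) = 1 / 2" by (intro c) (auto simp: A_def B_def)
    then show ?thesis by simp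
  qed (simp add: f_def p_def q_def cond_dens_def)
  have int: "(\<integral>y. f y * cd f (1 - y / 2) \<partial>Exp1) = 1 / 2"
    unfolding eq using densD(4)[OF f] by simp
  have c1: "cd f 1 = 1 / 2" by (rule c) auto
  have "Bil 1 f f = - 1 / 4" unfolding Bil_self[OF densD(1)[OF f]] int c1 by (simp add: power2_eq_square)
  then show ?thesis using f False assms by (intro exI[of _ f]) (simp add: level_cap_def)
qed

lemma rate_bounded:
  assumes "\<sigma> \<in> {1, -1}" shows "\<exists>K\<ge>0. \<forall>a<level_cap \<sigma>. rate \<sigma> a \<le> ereal K"
proof -
  obtain f where f: "dens f" "\<sigma> * Bil 1 f f = level_cap \<sigma>" using cap_attained[OF assms] by blast
  then show ?thesis using rate_le[OF f(1), of 1 _ \<sigma>] KL_nonneg[OF f(1)] by (intro exI[of _ "KL f"]) auto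
qed

lemma rate_raise:
  assumes \<sigma>: "\<sigma> \<in> {1, -1}" and a: "0 < a" and a': "a' < level_cap \<sigma>" and \<eta>: "0 < \<eta>"
  shows "\<exists>d>0. \<forall>b. a \<le> b \<longrightarrow> b \<le> a' \<longrightarrow> rate \<sigma> (b + d) \<le> rate \<sigma> b + ereal \<eta>"
proof -
  obtain K where K: "0 \<le> K" "\<And>a. a < level_cap \<sigma> \<Longrightarrow> rate \<sigma> a \<le> ereal K" using rate_bounded[OF \<sigma>] by blast
  define a'' where "a'' = (a' + level_cap \<sigma>) / 2"
  have a'': "a' < a''" "a'' < level_cap \<sigma>" using a' by (auto simp: a''_def)
  have \<eta>2: "0 < \<eta> / 2" using \<eta> by simp
  obtain d where d: "0 < d" "\<And>f t. dens f \<Longrightarrow> 0 \<le> t \<Longrightarrow> KL f \<le> K + \<eta> \<Longrightarrow> a \<le> \<sigma> * Bil t f f \<Longrightarrow> \<sigma> * Bil t f f \<le> a'' \<Longrightarrow>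
    (\<exists>f'. dens f' \<and> KL f' \<le> KL f + \<eta> / 2 \<and> \<sigma> * Bil t f f + d \<le> \<sigma> * Bil t f' f')"
    using raise_level[OF \<sigma> a a''(2) _ \<eta>2, of "K + \<eta>"] K(1) \<eta> by (metis add_nonneg_nonneg less_imp_le)
  define d' where "d' = min d (a'' - a')"
  have d': "0 < d'" "d' \<le> d" "d' \<le> a'' - a'" using d a'' by (auto simp: d'_def)
  show ?thesis
  proof (intro exI[of _ d'] conjI d' allI impI)
    fix b assume b: "a \<le> b" "b \<le> a'"
    have "rate \<sigma> b \<le> ereal K" using b a' by (intro K(2)) simp
    then obtain r where r: "rate \<sigma> b = ereal r" "r \<le> K" using rate_nonneg[of \<sigma> b] by (cases "rate \<sigma> b") auto
    have "rate \<sigma> b < ereal (r + \<eta> / 2)" using r \<eta> by simp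
    then obtain f t where f: "dens f" "0 \<le> t" "b < \<sigma> * Bil t f f" "ereal (KL f) < ereal (r + \<eta> / 2)"
      by (rule rate_lessD)
    have "rate \<sigma> (b + d') \<le> ereal (r + \<eta>)"
    proof (cases "\<sigma> * Bil t f f \<le> a''")
      case True
      obtain f' where f': "dens f'" "KL f' \<le> KL f + \<eta> / 2" "\<sigma> * Bil t f f + d \<le> \<sigma> * Bil t f' f'"
        using d(2)[of f t] f True b r(2) \<eta> by auto
      have "rate \<sigma> (b + d') \<le> ereal (KL f')" using f f' d' by (intro rate_le[OF f'(1) f(2)]) linarith
      also have "\<dots> \<le> ereal (r + \<eta>)" using f' f by simp
      finally show ?thesis .
    next
      case False
      have "rate \<sigma> (b + d') \<le> ereal (KL f)" using f d' b False by (intro rate_le[OF f(1,2)]) linarith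
      also have "\<dots> \<le> ereal (r + \<eta>)" using f \<eta> by simp
      finally show ?thesis .
    qed
    then show "rate \<sigma> (b + d') \<le> rate \<sigma> b + ereal \<eta>" by (simp add: r)
  qed
qed

lemma rate_left:
  assumes \<sigma>: "\<sigma> \<in> {1, -1}" and a: "0 < a" "a < level_cap \<sigma>" and \<eta>: "0 < \<eta>"
  shows "\<exists>b<a. rate \<sigma> a \<le> rate \<sigma> b + ereal \<eta>"
proof -
  obtain d where d: "0 < d" "\<And>b. a / 2 \<le> b \<Longrightarrow> b \<le> a \<Longrightarrow> rate \<sigma> (b + d) \<le> rate \<sigma> b + ereal \<eta>"
    using rate_raise[OF \<sigma> _ a(2) \<eta>, of "a / 2"] a by auto
  define b where "b = max (a / 2) (a - d)"
  have b: "a / 2 \<le> b" "b < a" "a \<le> b + d" using a d by (auto simp: b_def)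
  have "rate \<sigma> a \<le> rate \<sigma> (b + d)" by (rule rate_mono) fact
  also have "\<dots> \<le> rate \<sigma> b + ereal \<eta>" using b by (intro d) auto
  finally show ?thesis using b by blast
qed

lemma rate_real:
  assumes "\<sigma> \<in> {1, -1}" "a < level_cap \<sigma>"
  shows "rate \<sigma> a = ereal (real_of_ereal (rate \<sigma> a))"
proof -
  obtain K where "rate \<sigma> a \<le> ereal K" using rate_bounded[OF assms(1)] assms(2) by blast
  then show ?thesis using rate_nonneg[of \<sigma> a] by (cases "rate \<sigma> a") auto
qed

lemma rate_continuous:
  assumes \<sigma>: "\<sigma> \<in> {1, -1}"
  shows "continuous_on {0<..<level_cap \<sigma>} (rate \<sigma>)"
proof -
  define g where "g a = real_of_ereal (rate \<sigma> a)" for a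
  have g: "rate \<sigma> a = ereal (g a)" if "a < level_cap \<sigma>" for a
    unfolding g_def by (rule rate_real[OF \<sigma> that])
  have mono: "g a \<le> g b" if "a \<le> b" "b < level_cap \<sigma>" for a b
    using rate_mono[OF that(1), of \<sigma>] g[of a] g[of b] that by simp
  have "continuous_on {0<..<level_cap \<sigma>} g"
  proof (rule continuous_onI)
    fix x e :: real assume x: "x \<in> {0<..<level_cap \<sigma>}" and e: "0 < e"
    define y where "y = (x + level_cap \<sigma>) / 2"
    have y: "x < y" "y < level_cap \<sigma>" using x by (auto simp: y_def)
    have "0 < x / 2" using x by simp
    from rate_raise[OF \<sigma> this y(2), of e] e
    obtain d where d: "0 < d" "\<And>b. x / 2 \<le> b \<Longrightarrow> b \<le> y \<Longrightarrow> rate \<sigma> (b + d) \<le> rate \<sigma> b + ereal e" by auto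
    define d' where "d' = min (min d (x / 2)) (y - x)"
    have d': "0 < d'" "d' \<le> d" "d' \<le> x / 2" "d' \<le> y - x" using d x y by (auto simp: d'_def min_def)
    have step: "g v \<le> g u + e" if "x / 2 \<le> u" "u \<le> v" "v \<le> u + d'" "v \<le> y" for u v
    proof -
      have "rate \<sigma> v \<le> rate \<sigma> (u + d)" using that d' by (intro rate_mono) auto
      also have "\<dots> \<le> rate \<sigma> u + ereal e" using that by (intro d) auto
      finally show ?thesis using g[of u] g[of v] that y by simp
    qed
    show "\<exists>d>0. \<forall>x'\<in>{0<..<level_cap \<sigma>}. dist x' x < d \<longrightarrow> dist (g x') (g x) \<le> e"
    proof (intro exI[of _ d'] conjI d' ballI impI)
      fix x' assume x': "x' \<in> {0<..<level_cap \<sigma>}" "dist x' x < d'"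
      show "dist (g x') (g x) \<le> e"
      proof (cases "x \<le> x'")
        case True
        then show ?thesis using step[of x x'] mono[of x x'] x x' d' y by (auto simp: dist_real_def)
      next
        case False
        then show ?thesis using step[of x' x] mono[of x' x] x x' d' y by (auto simp: dist_real_def)
      qed
    qed
  qed
  then have "continuous_on {0<..<level_cap \<sigma>} (\<lambda>a. ereal (g a))" by (rule continuous_on_ereal)
  then show ?thesis by (rule continuous_on_cong[THEN iffD1, rotated -1]) (auto simp: g)
qed

section \<open>The large deviation limit\<close>

text \<open>
  The bounds 1 and \<open>1 / 4\<close> hold for all nonnegative samples, not only for laws with a
  density.
\<close>

lemma exceed_null:
  assumes Y: "std_sample M Y" and \<sigma>: "\<sigma> \<in> {1, -1}" and a: "level_cap \<sigma> \<le> a" and n: "0 < n"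
  shows "measure M (exceed M Y \<sigma> n a) = 0"
proof -
  interpret prob_space M using Y by (simp add: std_sample_def)
  have Ym[measurable]: "Y i \<in> borel_measurable M" for i using Y by (simp add: std_sample_def)
  have "AE \<omega> in M. 0 < Y i \<omega>" for i
  proof -
    have "distr M borel (Y i) = Exp1" using Y by (simp add: std_sample_def)
    with AE_Exp1_pos have "AE x in distr M borel (Y i). 0 < x" by (simp only:)
    then show ?thesis by (simp add: AE_distr_iff)
  qed
  then have "AE \<omega> in M. \<forall>i. 0 < Y i \<omega>" by (simp add: AE_all_countable)
  then have "AE \<omega> in M. \<omega> \<notin> exceed M Y \<sigma> n a"
  proof eventually_elim
    case (elim \<omega>)
    have "measure (emp n (\<lambda>i. Y i \<omega>)) {..<0} = (\<Sum>i<n. indicator {..<0} (Y i \<omega>)) / real n"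
      by (rule measure_emp[OF n]) simp
    also have "(\<Sum>i<n. indicator {..<0} (Y i \<omega>)) = (\<Sum>i<n. 0 :: real)"
      by (rule sum.cong) (use elim in \<open>auto simp: indicator_def not_less less_imp_le\<close>)
    finally have z: "lcdf (emp n (\<lambda>i. Y i \<omega>)) 0 = 0" by (simp add: lcdf_def)
    have "\<sigma> * Psi (emp n (\<lambda>i. Y i \<omega>)) t \<le> level_cap \<sigma>" if "0 \<le> t" for t
    proof (cases "\<sigma> = 1")
      case True
      then show ?thesis using Psi_le_1[OF real_distribution_emp, of n "\<lambda>i. Y i \<omega>" t] by (simp add: level_cap_def)
    next
      case False
      then show ?thesis using neg_Psi_le_quarter[OF real_distribution_emp z that] \<sigma> by (simp add: level_cap_def)
    qed
    then show ?case using a by (force simp: exceed_def)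
  qed
  then have "measure M (exceed M Y \<sigma> n a) = measure M {}"
    by (intro finite_measure_eq_AE exceed_measurable[OF n Y]) auto
  then show ?thesis by simp
qed

definition ld_rate :: "real \<Rightarrow> ereal" where
  "ld_rate a = min (rate 1 a) (rate (-1) a)"

lemma poly_exp_tendsto_0:
  fixes c :: real
  assumes "0 < c" shows "(\<lambda>n. (real n + 1) ^ k * exp (- (real n * c))) \<longlonglongrightarrow> 0"
proof -
  have "((\<lambda>x::real. x ^ k / exp x) \<longlongrightarrow> 0) at_top" by (rule tendsto_power_div_exp_0)
  moreover have "filterlim (\<lambda>n. (real n + 1) * c) at_top sequentially"
  proof -
    have "filterlim (\<lambda>n. real (Suc n)) at_top sequentially"
      by (rule filterlim_compose[OF filterlim_real_sequentially filterlim_Suc])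
    from filterlim_at_top_mult_tendsto_pos[OF tendsto_const assms this]
    show ?thesis by (simp add: add.commute)
  qed
  ultimately have "(\<lambda>n. ((real n + 1) * c) ^ k / exp ((real n + 1) * c)) \<longlonglongrightarrow> 0"
    by (rule filterlim_compose)
  then have "(\<lambda>n. (exp c / c ^ k) * (((real n + 1) * c) ^ k / exp ((real n + 1) * c))) \<longlonglongrightarrow> (exp c / c ^ k) * 0"
    by (intro tendsto_mult tendsto_const)
  moreover have "(exp c / c ^ k) * (((real n + 1) * c) ^ k / exp ((real n + 1) * c)) = (real n + 1) ^ k * exp (- (real n * c))" for n
  proof -
    have "exp ((real n + 1) * c) = exp c * exp (real n * c)" by (simp add: exp_add[symmetric] algebra_simps)
    then show ?thesis unfolding power_mult_distrib using assms by (simp add: exp_minus field_simps)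
  qed
  ultimately show ?thesis by simp
qed

lemma D2_event:
  assumes "0 < n"
  shows "{\<omega> \<in> space M. D2 n (\<lambda>i. Y i \<omega>) > a} = exceed M Y 1 n a \<union> exceed M Y (-1) n a"
proof -
  have "a < \<bar>x\<bar> \<longleftrightarrow> a < 1 * x \<or> a < (-1) * x" for x :: real by linarith
  then show ?thesis unfolding D2_gt_iff[OF assms] exceed_def by blast
qed

text \<open>
  Both bounds are used with an error \<open>\<kappa>\<close> in the exponent; half of it absorbs the
  polynomial number of types and the two signs. For \<open>a \<ge> 1\<close> the probability is 0 and
  both sides are \<open>-\<infinity>\<close>.
\<close>

lemma D2_limit:
  assumes Y: "std_sample M Y" and a: "0 < a"
  shows "(\<lambda>n. ereal (1 / real n) * ln_ereal (measure M {\<omega> \<in> space M. D2 n (\<lambda>i. Y i \<omega>) > a})) \<longlonglongrightarrow> - ld_rate a"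
proof -
  interpret prob_space M using Y by (simp add: std_sample_def)
  define p where "p n = measure M {\<omega> \<in> space M. D2 n (\<lambda>i. Y i \<omega>) > a}" for n
  have p_le: "p n \<le> measure M (exceed M Y 1 n a) + measure M (exceed M Y (-1) n a)" if "0 < n" for n
    unfolding p_def D2_event[OF that] by (intro measure_Un_le exceed_measurable that Y)
  have p_ge: "measure M (exceed M Y \<sigma> n a) \<le> p n" if "0 < n" "\<sigma> \<in> {1, -1}" for n \<sigma>
    unfolding p_def D2_event[OF that(1)]
    using that by (intro finite_measure_mono sets.Un exceed_measurable Y) auto
  show ?thesis
  proof (cases "a < 1")
    case False
    have "rate 1 a = \<infinity>" "rate (-1) a = \<infinity>" using False by (auto intro!: rate_infinite simp: level_cap_def)
    then have "ld_rate a = \<infinity>" by (simp add: ld_rate_def)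
    moreover have "\<forall>\<^sub>F n in sequentially. ereal (1 / real n) * ln_ereal (p n) = -\<infinity>"
      using eventually_gt_at_top[of 0]
    proof eventually_elim
      case (elim n)
      have "measure M (exceed M Y 1 n a) = 0" "measure M (exceed M Y (-1) n a) = 0"
        using False elim by (auto intro!: exceed_null[OF Y] simp: level_cap_def)
      then have "p n = 0" using p_le[OF elim] by (simp add: p_def antisym)
      then show ?case using elim by (simp add: ln_ereal_def)
    qed
    ultimately show ?thesis unfolding p_def[symmetric] by (simp add: tendsto_eventually)
  next
    case True
    have "rate 1 a = ereal (real_of_ereal (rate 1 a))" using True by (intro rate_real) (auto simp: level_cap_def)
    then have "ld_rate a \<le> ereal (real_of_ereal (rate 1 a))" by (simp add: ld_rate_def)
    moreover have "0 \<le> ld_rate a" using rate_nonneg by (simp add: ld_rate_def)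
    ultimately obtain r where r: "ld_rate a = ereal r" by (cases "ld_rate a") auto
    have low: "\<forall>\<^sub>F n in sequentially. exp (- (real n * (r + \<kappa>))) \<le> p n" if \<kappa>: "0 < \<kappa>" for \<kappa>
    proof -
      obtain \<sigma> where \<sigma>: "\<sigma> \<in> {1, -1}" "rate \<sigma> a = ereal r" using r unfolding ld_rate_def min_def by (metis insertI1 insertI2)
      have "rate \<sigma> a < ereal (r + \<kappa> / 2)" using \<sigma> \<kappa> by simp
      then obtain f t where f: "dens f" "0 \<le> t" "a < \<sigma> * Bil t f f" "ereal (KL f) < ereal (r + \<kappa> / 2)"
        by (rule rate_lessD)
      have "\<forall>\<^sub>F n in sequentially. exp (- (real n * (KL f + \<kappa> / 2))) \<le> measure M (exceed M Y \<sigma> n a)"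
        using \<kappa> by (intro exceed_lower[OF Y \<sigma>(1) f(1-3)]) simp
      then show ?thesis using eventually_gt_at_top[of 0]
      proof eventually_elim
        case (elim n)
        have "real n * (KL f + \<kappa> / 2) \<le> real n * (r + \<kappa>)" using f(4) by (intro mult_left_mono) auto
        then show ?case using elim(1) p_ge[OF elim(2) \<sigma>(1)]
          by (intro order_trans[OF _ order_trans[OF elim(1) p_ge[OF elim(2) \<sigma>(1)]]]) simp
      qed
    qed
    have up1: "\<forall>\<^sub>F n in sequentially. measure M (exceed M Y \<sigma> n a) \<le> exp (- (real n * (r - \<kappa>))) / 2"
      if \<kappa>: "0 < \<kappa>" and \<sigma>: "\<sigma> \<in> {1, -1}" for \<kappa> \<sigma>
    proof (cases "a < level_cap \<sigma>")
      case False
      then have "level_cap \<sigma> \<le> a" by simp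
      from exceed_null[OF Y \<sigma> this] have "\<forall>\<^sub>F n in sequentially. measure M (exceed M Y \<sigma> n a) = 0"
        by (intro eventually_mono[OF eventually_gt_at_top[of 0]])
      then show ?thesis by eventually_elim simp
    next
      case True
      obtain b where b: "b < a" "rate \<sigma> a \<le> rate \<sigma> b + ereal (\<kappa> / 2)"
        using rate_left[OF \<sigma> a True, of "\<kappa> / 2"] \<kappa> by auto
      have "ereal r \<le> rate \<sigma> a" using r \<sigma> unfolding ld_rate_def by (metis insertE min.cobounded1 min.cobounded2 singletonD)
      then have rb: "ereal (r - \<kappa> / 2) \<le> rate \<sigma> b" using b(2) rate_nonneg[of \<sigma> b]
        by (cases "rate \<sigma> b"; cases "rate \<sigma> a") auto
      have "\<exists>k. \<forall>n>0. measure M (exceed M Y \<sigma> n a) \<le> (real n + 1) ^ k * exp (- (real n * (r - \<kappa> / 2)))"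
      proof (rule exceed_upper[OF Y \<sigma> b(1)])
        fix f t assume "dens f" "0 \<le> t" "b < \<sigma> * Bil t f f"
        then show "r - \<kappa> / 2 \<le> KL f" using order_trans[OF rb rate_le] by simp
      qed
      then obtain k where
        k: "\<And>n. 0 < n \<Longrightarrow> measure M (exceed M Y \<sigma> n a) \<le> (real n + 1) ^ k * exp (- (real n * (r - \<kappa> / 2)))"
        by blast
      have "0 < \<kappa> / 2" using \<kappa> by simp
      from order_tendstoD(2)[OF poly_exp_tendsto_0[OF this, of k], of "1 / 2"]
      have "\<forall>\<^sub>F n in sequentially. (real n + 1) ^ k * exp (- (real n * (\<kappa> / 2))) < 1 / 2" by simp
      then show ?thesis using eventually_gt_at_top[of 0]
      proof eventually_elim
        case (elim n)
        have "exp (- (real n * (r - \<kappa> / 2))) = exp (- (real n * (\<kappa> / 2))) * exp (- (real n * (r - \<kappa>)))"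
          unfolding exp_add[symmetric] by (rule arg_cong[of _ _ exp]) (simp add: field_simps)
        then have "measure M (exceed M Y \<sigma> n a) \<le> (real n + 1) ^ k * exp (- (real n * (\<kappa> / 2))) * exp (- (real n * (r - \<kappa>)))"
          using k[OF elim(2)] by (simp add: mult.assoc)
        also have "\<dots> \<le> 1 / 2 * exp (- (real n * (r - \<kappa>)))" using elim(1) by (intro mult_right_mono) auto
        finally show ?case by simp
      qed
    qed
    have up: "\<forall>\<^sub>F n in sequentially. p n \<le> exp (- (real n * (r - \<kappa>)))" if \<kappa>: "0 < \<kappa>" for \<kappa>
      using up1[OF \<kappa>, of 1, OF insertI1] up1[OF \<kappa>, of "-1", OF insertI2[OF insertI1]] eventually_gt_at_top[of 0]
    proof eventually_elim
      case (elim n) then show ?case using p_le[of n] by simp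
    qed
    have pos: "\<forall>\<^sub>F n in sequentially. 0 < p n \<and> 0 < n"
      using low[of 1, OF zero_less_one] eventually_gt_at_top[of 0]
    proof eventually_elim
      case (elim n) then show ?case using exp_gt_zero[of "- (real n * (r + 1))"] by linarith
    qed
    have "(\<lambda>n. ln (p n) / real n) \<longlonglongrightarrow> - r"
    proof (rule tendstoI)
      fix e :: real assume e: "0 < e"
      then have e2: "0 < e / 2" by simp
      show "\<forall>\<^sub>F n in sequentially. dist (ln (p n) / real n) (- r) < e"
        using low[OF e2] up[OF e2] pos
      proof eventually_elim
        case (elim n)
        have n: "0 < real n" and p: "0 < p n" using elim(3) by auto
        have "- (real n * (r + e / 2)) \<le> ln (p n)" using elim(1) p by (simp add: ln_ge_iff)
        moreover have "ln (p n) \<le> - (real n * (r - e / 2))" using elim(2) p by (metis exp_gt_zero ln_exp ln_le_cancel_iff)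
        ultimately have "- (r + e / 2) * real n \<le> ln (p n)" "ln (p n) \<le> - (r - e / 2) * real n"
          by (simp_all add: algebra_simps)
        then have "- (r + e / 2) \<le> ln (p n) / real n" "ln (p n) / real n \<le> - (r - e / 2)"
          using n by (simp_all only: pos_le_divide_eq pos_divide_le_eq)
        then show ?case using e by (simp add: dist_real_def abs_less_iff)
      qed
    qed
    then have "(\<lambda>n. ereal (ln (p n) / real n)) \<longlonglongrightarrow> ereal (- r)" by simp
    moreover have "\<forall>\<^sub>F n in sequentially. ereal (ln (p n) / real n) = ereal (1 / real n) * ln_ereal (p n)"
      using pos by eventually_elim (simp add: ln_ereal_def)
    ultimately have "(\<lambda>n. ereal (1 / real n) * ln_ereal (p n)) \<longlonglongrightarrow> ereal (- r)"
      by (rule Lim_transform_eventually)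
    then show ?thesis unfolding p_def r by simp
  qed
qed

lemma std_sample_scale:
  assumes "prob_space M" "0 < l" "prob_space.indep_vars M (\<lambda>_. borel) X UNIV"
    and D: "\<And>i. distributed M lborel (X i) (exponential_density l)"
  shows "std_sample M (\<lambda>i \<omega>. l * X i \<omega>)"
proof -
  interpret prob_space M by fact
  have Xm[measurable]: "X i \<in> borel_measurable M" for i using distributed_measurable[OF D, of i] by simp
  have "indep_vars (\<lambda>_. borel) (\<lambda>i \<omega>. l * X i \<omega>) UNIV"
    using indep_vars_compose2[OF assms(3), of "\<lambda>_ x. l * x" "\<lambda>_. borel"] by simp
  moreover have "distr M borel (\<lambda>\<omega>. l * X i \<omega>) = Exp1" for i
  proof -
    have "distributed M lborel (\<lambda>\<omega>. l * X i \<omega>) (exponential_density 1)"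
    proof (subst exponential_distributed_iff, simp, safe)
      show "(\<lambda>\<omega>. l * X i \<omega>) \<in> borel_measurable M" by measurable
      fix a :: real assume a: "0 \<le> a"
      have "prob {x \<in> space M. l * X i x \<le> a} = prob {x \<in> space M. X i x \<le> a / l}"
        using assms(2) by (simp add: field_simps)
      also have "\<dots> = 1 - exp (- (a / l) * l)"
        using exponential_distributedD_le[OF D[of i], of "a / l"] a assms(2) by simp
      finally show "prob {x \<in> space M. l * X i x \<le> a} = 1 - exp (- a * 1)" using assms(2) by simp
    qed
    from distributed_distr_eq_density[OF this]
    have "distr M lborel (\<lambda>\<omega>. l * X i \<omega>) = Exp1" by simp
    moreover have "distr M lborel (\<lambda>\<omega>. l * X i \<omega>) = distr M borel (\<lambda>\<omega>. l * X i \<omega>)"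
      by (rule distr_cong) auto
    ultimately show ?thesis by simp
  qed
  ultimately show ?thesis using assms(1) by (simp add: std_sample_def)
qed

lemma D2_limit_exponential:
  assumes "prob_space M" "0 < l" "prob_space.indep_vars M (\<lambda>_. borel) X UNIV"
    and "\<And>i. distributed M lborel (X i) (exponential_density l)" and a: "0 < a"
  shows "(\<lambda>n. ereal (1 / real n) * ln_ereal (measure M {\<omega> \<in> space M. D2 n (\<lambda>i. X i \<omega>) > a})) \<longlonglongrightarrow> - ld_rate a"
proof -
  have "(\<lambda>n. ereal (1 / real n) * ln_ereal (measure M {\<omega> \<in> space M. D2 n (\<lambda>i. l * X i \<omega>) > a})) \<longlonglongrightarrow> - ld_rate a"
    by (rule D2_limit[OF std_sample_scale[OF assms(1-4)] a])
  moreover have "\<forall>\<^sub>F n in sequentially.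
      ereal (1 / real n) * ln_ereal (measure M {\<omega> \<in> space M. D2 n (\<lambda>i. l * X i \<omega>) > a})
      = ereal (1 / real n) * ln_ereal (measure M {\<omega> \<in> space M. D2 n (\<lambda>i. X i \<omega>) > a})"
    using eventually_gt_at_top[of 0] by eventually_elim (simp add: D2_scale[OF _ assms(2)])
  ultimately show ?thesis by (rule Lim_transform_eventually)
qed

section \<open>The variance of the projection\<close>

text \<open>
  \<open>F\<close> is an antiderivative with respect to Lebesgue measure, hence the factor
  \<open>exp (- x)\<close> in its derivative.
\<close>

lemma Exp1_FTC:
  fixes h F :: "real \<Rightarrow> real"
  assumes ab: "0 \<le> a" "a \<le> b" and h: "\<And>x. isCont h x"
    and F: "\<And>x. (F has_real_derivative h x * exp (- x)) (at x)"
  shows "(\<integral>x. h x * indicator {a..<b} x \<partial>Exp1) = F b - F a"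
proof -
  have [measurable]: "h \<in> borel_measurable borel"
    using h by (intro borel_measurable_continuous_onI continuous_at_imp_continuous_on) auto
  have "(\<integral>x. h x * indicator {a..<b} x \<partial>Exp1)
      = (\<integral>x. exponential_density 1 x *\<^sub>R (h x * indicator {a..<b} x) \<partial>lborel)"
    by (rule integral_density) (auto simp: exponential_density_def)
  also have "\<dots> = (\<integral>x. (h x * exp (- x)) * indicator {a..b} x \<partial>lborel)"
  proof (rule integral_cong_AE)
    show "AE x in lborel. exponential_density 1 x *\<^sub>R (h x * indicator {a..<b} x) = h x * exp (- x) * indicator {a..b} x"
      using AE_lborel_singleton[of b] ab
      by (auto elim!: eventually_mono simp: exponential_density_def indicator_def)
  qed (auto simp: exponential_density_def)
  also have "\<dots> = F b - F a"
    by (rule integral_FTC_Icc_real) (use ab F in \<open>auto intro!: continuous_intros h\<close>)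
  finally show ?thesis .
qed

lemma Bil_one:
  assumes t: "0 \<le> t" shows "Bil t (\<lambda>_. 1) (\<lambda>_. 1) = 0"
proof -
  define F where "F y = - exp (- y) + 2 * exp (- t - y / 2)" for y :: real
  have "(\<integral>y. 1 * cd (\<lambda>_. 1) (t - y / 2) \<partial>Exp1)
     = (\<integral>y. (1 - exp (y / 2 - t)) * indicator {0..<2 * t} y \<partial>Exp1)"
  proof (rule integral_cong_AE)
    show "AE y in Exp1. 1 * cd (\<lambda>_. 1) (t - y / 2) = (1 - exp (y / 2 - t)) * indicator {0..<2 * t} y"
      using AE_Exp1_pos by eventually_elim (auto simp: cd_one indicator_def)
  qed measurable
  also have "\<dots> = F (2 * t) - F 0"
  proof (rule Exp1_FTC)
    fix x
    show "(F has_real_derivative (1 - exp (x / 2 - t)) * exp (- x)) (at x)"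
      unfolding F_def by (auto intro!: derivative_eq_intros simp: left_diff_distrib mult_exp_exp)
  qed (use t in \<open>auto intro!: continuous_intros\<close>)
  also have "\<dots> = (1 - exp (- t))\<^sup>2"
    by (simp add: F_def power2_eq_square algebra_simps mult_exp_exp)
  finally show ?thesis using t by (subst Bil_self) (auto simp: cd_one)
qed

lemma xi2_eq_Xi:
  assumes "0 \<le> t" shows "xi2 s t = Xi t (\<lambda>_. 1) s"
proof (cases "s < t")
  case True
  then show ?thesis using assms by (simp add: xi2_def Xi_def cd_one Let_def)
next
  case False
  then have "cd (\<lambda>_. 1) (2 * (t - s)) = 0" by (intro cd_nonpos_arg) simp
  then show ?thesis using False assms by (auto simp: xi2_def Xi_def cd_one[of "t - s / 2"] Let_def)
qed

lemma integral_Xi_one: "0 \<le> t \<Longrightarrow> (\<integral>s. Xi t (\<lambda>_. 1) s \<partial>Exp1) = 0"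
  using Bil_one[of t] by (simp add: Bil_def)

lemma delta2_sq_at_eq:
  assumes "0 \<le> t" shows "delta2_sq_at t = (\<integral>s. (Xi t (\<lambda>_. 1) s)\<^sup>2 \<partial>Exp1)"
  using integral_Xi_one[OF assms] by (simp add: delta2_sq_at_def xi2_eq_Xi[OF assms])

text \<open>
  The projection is a combination of exponentials on \<open>[0, t)\<close> and on
  \<open>[t, 2 t)\<close>, and zero beyond; the square is integrated piece by piece. The term
  \<open>t * y^4 / 2\<close> comes from the constants that arise when
  \<open>exp (s / 2 - t)\<^sup>2\<close> meets the density \<open>exp (- s)\<close>.
\<close>

lemma delta2_sq_at_formula:
  assumes t: "0 \<le> t" and y: "y = exp (- t / 2)"
  shows "delta2_sq_at t = y ^ 2 / 3 - 2 / 3 * y ^ 3 - 5 / 4 * y ^ 4 + 2 * y ^ 5 - y ^ 6 / 3 - y ^ 8 / 12 + t * y ^ 4 / 2"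
proof -
  define p1 where "p1 s = - exp (- t) + exp (2 * s - 2 * t) / 2 + exp (s / 2 - t) / 2" for s
  define p2 where "p2 s = - (1 - exp (s / 2 - t)) / 2" for s
  define F1 where "F1 s = - exp (- 2 * t - s) + exp (3 * s - 4 * t) / 12 + s * exp (- 2 * t) / 4 - exp (s - 3 * t)
    + 2 * exp (- s / 2 - 2 * t) + exp (3 * s / 2 - 3 * t) / 3" for s
  define F2 where "F2 s = (- exp (- s) + 4 * exp (- s / 2 - t) + s * exp (- 2 * t)) / 4" for s
  have b1: "bdd_meas (\<lambda>s. (p1 s)\<^sup>2 * indicator {0..<t} s)"
  proof (rule bdd_measI)
    show "(\<lambda>s. (p1 s)\<^sup>2 * indicator {0..<t} s) \<in> borel_measurable borel" unfolding p1_def by measurable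
    fix s
    show "\<bar>(p1 s)\<^sup>2 * indicator {0..<t} s\<bar> \<le> 4"
    proof (cases "s \<in> {0..<t}")
      case True
      have "exp (- t) \<le> 1" "exp (2 * s - 2 * t) \<le> 1" "exp (s / 2 - t) \<le> 1" using True t by auto
      moreover have "0 < exp (- t)" "0 < exp (2 * s - 2 * t)" "0 < exp (s / 2 - t)" by auto
      ultimately have "\<bar>p1 s\<bar> \<le> 2" unfolding p1_def by (intro abs_leI; argo)
      then have "(p1 s)\<^sup>2 \<le> 2\<^sup>2" by (rule power2_le_iff_abs_le[THEN iffD2, rotated]) simp
      then show ?thesis using True by simp
    qed simp
  qed
  have b2: "bdd_meas (\<lambda>s. (p2 s)\<^sup>2 * indicator {t..<2 * t} s)"
  proof (rule bdd_measI)
    show "(\<lambda>s. (p2 s)\<^sup>2 * indicator {t..<2 * t} s) \<in> borel_measurable borel" unfolding p2_def by measurable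
    fix s
    show "\<bar>(p2 s)\<^sup>2 * indicator {t..<2 * t} s\<bar> \<le> 4"
    proof (cases "s \<in> {t..<2 * t}")
      case True
      have "exp (s / 2 - t) \<le> 1" using True t by auto
      moreover have "0 < exp (s / 2 - t)" by auto
      ultimately have "\<bar>p2 s\<bar> \<le> 2" unfolding p2_def by (intro abs_leI; argo)
      then have "(p2 s)\<^sup>2 \<le> 2\<^sup>2" by (rule power2_le_iff_abs_le[THEN iffD2, rotated]) simp
      then show ?thesis using True by simp
    qed simp
  qed
  have "delta2_sq_at t = (\<integral>s. (p1 s)\<^sup>2 * indicator {0..<t} s + (p2 s)\<^sup>2 * indicator {t..<2 * t} s \<partial>Exp1)"
    unfolding delta2_sq_at_eq[OF t]
  proof (rule integral_cong_AE)
    show "(\<lambda>s. (Xi t (\<lambda>_. 1) s)\<^sup>2) \<in> borel_measurable Exp1"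
      using bdd_meas_measurable[OF bdd_meas_Xi[of "\<lambda>_. 1" t]] by simp
    show "(\<lambda>s. (p1 s)\<^sup>2 * indicator {0..<t} s + (p2 s)\<^sup>2 * indicator {t..<2 * t} s) \<in> borel_measurable Exp1"
      unfolding p1_def p2_def by measurable
    show "AE s in Exp1. (Xi t (\<lambda>_. 1) s)\<^sup>2 = (p1 s)\<^sup>2 * indicator {0..<t} s + (p2 s)\<^sup>2 * indicator {t..<2 * t} s"
      using AE_Exp1_pos
    proof eventually_elim
      case (elim s)
      consider "s < t" | "t \<le> s" "s < 2 * t" | "2 * t \<le> s" by linarith
      then show ?case
      proof cases
        case 1
        then have "Xi t (\<lambda>_. 1) s = p1 s" using elim t
          by (simp add: Xi_def cd_one p1_def field_simps)
        then show ?thesis using 1 elim by simp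
      next
        case 2
        then have "Xi t (\<lambda>_. 1) s = p2 s" using elim t
          by (simp add: Xi_def cd_nonpos_arg cd_one[of "t - s / 2"] p2_def diff_divide_distrib)
        then show ?thesis using 2 elim by simp
      next
        case 3
        then have "Xi t (\<lambda>_. 1) s = 0" using elim t by (simp add: Xi_def cd_nonpos_arg)
        then show ?thesis using 3 elim t by simp
      qed
    qed
  qed
  also have "\<dots> = (\<integral>s. (p1 s)\<^sup>2 * indicator {0..<t} s \<partial>Exp1) + (\<integral>s. (p2 s)\<^sup>2 * indicator {t..<2 * t} s \<partial>Exp1)"
    by (intro Bochner_Integration.integral_add integrable_bdd_meas b1 b2)
  also have "(\<integral>s. (p1 s)\<^sup>2 * indicator {0..<t} s \<partial>Exp1) = F1 t - F1 0"
  proof (rule Exp1_FTC)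
    fix x
    show "isCont (\<lambda>s. (p1 s)\<^sup>2) x" unfolding p1_def by (auto intro!: continuous_intros)
    have "(F1 has_real_derivative (exp (- 2 * t - x) + exp (3 * x - 4 * t) / 4 + exp (- 2 * t) / 4 - exp (x - 3 * t)
      - exp (- x / 2 - 2 * t) + exp (3 * x / 2 - 3 * t) / 2)) (at x)"
      unfolding F1_def by (auto intro!: derivative_eq_intros)
    moreover have "(p1 x)\<^sup>2 * exp (- x) = exp (- 2 * t - x) + exp (3 * x - 4 * t) / 4 + exp (- 2 * t) / 4 - exp (x - 3 * t)
      - exp (- x / 2 - 2 * t) + exp (3 * x / 2 - 3 * t) / 2"
    proof -
      define a b c d where "a = exp (- t)" and "b = exp (2 * x - 2 * t)" and "c = exp (x / 2 - t)" and "d = exp (- x)"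
      have "a * a * d = exp (- 2 * t - x)" "b * b * d = exp (3 * x - 4 * t)" "c * c * d = exp (- 2 * t)"
        "a * b * d = exp (x - 3 * t)" "a * c * d = exp (- x / 2 - 2 * t)" "b * c * d = exp (3 * x / 2 - 3 * t)"
        by (simp_all add: a_def b_def c_def d_def mult_exp_exp field_simps)
      moreover have "(p1 x)\<^sup>2 * d = a * a * d + b * b * d / 4 + c * c * d / 4 - a * b * d - a * c * d + b * c * d / 2"
        unfolding p1_def a_def[symmetric] b_def[symmetric] c_def[symmetric]
        by (simp add: power2_eq_square field_simps)
      ultimately show ?thesis by (simp add: d_def)
    qed
    ultimately show "(F1 has_real_derivative (p1 x)\<^sup>2 * exp (- x)) (at x)" by (simp only:)
  qed (use t in auto)
  also have "(\<integral>s. (p2 s)\<^sup>2 * indicator {t..<2 * t} s \<partial>Exp1) = F2 (2 * t) - F2 t"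
  proof (rule Exp1_FTC)
    fix x
    show "isCont (\<lambda>s. (p2 s)\<^sup>2) x" unfolding p2_def by (auto intro!: continuous_intros)
    have "(F2 has_real_derivative (exp (- x) - 2 * exp (- x / 2 - t) + exp (- 2 * t)) / 4) (at x)"
      unfolding F2_def by (auto intro!: derivative_eq_intros)
    moreover have "(p2 x)\<^sup>2 * exp (- x) = (exp (- x) - 2 * exp (- x / 2 - t) + exp (- 2 * t)) / 4"
    proof -
      define c d where "c = exp (x / 2 - t)" and "d = exp (- x)"
      have "c * d = exp (- x / 2 - t)" "c * c * d = exp (- 2 * t)"
        by (simp_all add: c_def d_def mult_exp_exp field_simps)
      moreover have "(p2 x)\<^sup>2 * d = (d - 2 * (c * d) + c * c * d) / 4"
        unfolding p2_def c_def[symmetric] by (simp add: power2_eq_square field_simps)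
      ultimately show ?thesis by (simp add: d_def)
    qed
    ultimately show "(F2 has_real_derivative (p2 x)\<^sup>2 * exp (- x)) (at x)" by (simp only:)
  qed (use t in auto)
  also have "F1 t - F1 0 + (F2 (2 * t) - F2 t) =
    y ^ 2 / 3 - 2 / 3 * y ^ 3 - 5 / 4 * y ^ 4 + 2 * y ^ 5 - y ^ 6 / 3 - y ^ 8 / 12 + t * y ^ 4 / 2"
  proof -
    have e: "y ^ k = exp (- (real k * t / 2))" for k
      unfolding y exp_of_nat_mult[symmetric] by (rule arg_cong[of _ _ exp]) simp
    show ?thesis unfolding e by (simp add: F1_def F2_def field_simps)
  qed
  finally show ?thesis .
qed

section \<open>Numerical value of the maximal variance\<close>

lemma exp_ge_sum:
  fixes x :: real
  assumes "0 \<le> x" shows "(\<Sum>k<n. x ^ k / fact k) \<le> exp x"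
proof -
  obtain t where "exp x = (\<Sum>k<n. x ^ k / fact k) + exp t / fact n * x ^ n"
    using Maclaurin_exp_le[of x n] by auto
  moreover have "0 \<le> exp t / fact n * x ^ n" using assms by simp
  ultimately show ?thesis by linarith
qed

lemma exp_le_sum:
  fixes x :: real
  assumes "0 \<le> x" "x \<le> 1" shows "exp x \<le> (\<Sum>k<n. x ^ k / fact k) + 3 / fact n * x ^ n"
proof -
  obtain t where t: "\<bar>t\<bar> \<le> \<bar>x\<bar>" "exp x = (\<Sum>k<n. x ^ k / fact k) + exp t / fact n * x ^ n"
    using Maclaurin_exp_le[of x n] by auto
  have "exp t \<le> exp 1" using t assms by simp
  then have "exp t \<le> 3" using exp_le by linarith
  then have "exp t / fact n * x ^ n \<le> 3 / fact n * x ^ n"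
    using assms by (intro mult_right_mono divide_right_mono) auto
  then show ?thesis using t by linarith
qed

text \<open>
  The tangent inequality \<open>ln z \<le> z - 1\<close> at \<open>z = b / y\<close>. It turns the
  only transcendental term of the variance into a polynomial and is sharp at \<open>y = b\<close> when
  \<open>c = - 2 * ln b\<close>.
\<close>

lemma exponent_tangent:
  fixes t y b c :: real
  assumes y: "y = exp (- t / 2)" and b: "0 < b" and c: "1 / b \<le> exp (c / 2)"
  shows "t * y ^ 4 / 2 \<le> c * y ^ 4 / 2 + b * y ^ 3 - y ^ 4"
proof -
  have y0: "0 < y" by (simp add: y)
  have "ln (1 / b) \<le> ln (exp (c / 2))" using c b by (subst ln_le_cancel_iff) auto
  then have "ln (1 / b) \<le> c / 2" by (simp only: ln_exp)
  moreover have "ln (b / y) \<le> b / y - 1" using b y0 by (intro ln_le_minus_one) simp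
  moreover have "ln (b / y) + ln (1 / b) = t / 2" using b y0 by (simp add: ln_div y)
  ultimately have "t / 2 \<le> c / 2 + b / y - 1" by linarith
  then have "t / 2 * y ^ 4 \<le> (c / 2 + b / y - 1) * y ^ 4" by (rule mult_right_mono) simp
  also have "\<dots> = c * y ^ 4 / 2 + b * y ^ 3 - y ^ 4"
    using y0 by (simp add: eval_nat_numeral field_simps)
  finally show ?thesis by simp
qed

text \<open>
  The variance is maximal near \<open>y = 0.4719\<close>, that is \<open>t = 1.502\<close>, where it
  stays below \<open>0.0223433\<close> by a relative \<open>10^-5\<close> only, so the tangent has to touch
  close to that point. The tangent point is \<open>b = 0.472\<close>, with \<open>1.501553\<close>
  slightly above \<open>- 2 * ln b\<close>. The certificate is the division of bound minus polynomial
  by \<open>(y - 0.47182)^2\<close>, the divisor being placed so that both coefficients of the linear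
  remainder are positive; the quotient is positive on \<open>[0, 14 / 25]\<close>.
\<close>

lemma variance_gap_near_max:
  fixes y :: real
  shows "223433 / 10 ^ 7 - (y ^ 2 / 3 - 2 / 3 * y ^ 3 - 5 / 4 * y ^ 4 + 2 * y ^ 5 - y ^ 6 / 3 - y ^ 8 / 12 + (1501553 / 1000000) * y ^ 4 / 2 + (59 / 125) * y ^ 3 - y ^ 4)
 = (y - (23591 / 50000)) ^ 2 * ((6272936491324506314881050429 / 62500000000000000000000000000) + (265903319904315895738951 / 625000000000000000000000) * y + (- 2171904295002251039 / 15000000000000000000) * y ^ 2 + (- 206305258728643 / 125000000000000) * y ^ 3 + (11669605843 / 30000000000) * y ^ 4 + (23591 / 300000) * y ^ 5 + (1 / 12) * y ^ 6) + ((30152105561815861400117921314451 / 156250000000000000000000000000000000000) + (66476263772081628765810077 / 390625000000000000000000000000000) * y)"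
  by (simp add: field_simps eval_nat_numeral)

text \<open>
  Away from the maximum the Taylor expansion at the left end of the interval suffices. The tangent points
  are \<open>0.65\<close> here and \<open>0.85\<close> for the last interval.
\<close>

lemma variance_gap_mid:
  fixes y z :: real
  assumes "y = (14 / 25) + z"
  shows "223433 / 10 ^ 7 - (y ^ 2 / 3 - 2 / 3 * y ^ 3 - 5 / 4 * y ^ 4 + 2 * y ^ 5 - y ^ 6 / 3 - y ^ 8 / 12 + (1077 / 1250) * y ^ 4 / 2 + (13 / 20) * y ^ 3 - y ^ 4)
 = (34335944167 / 58593750000000) + (356932961 / 6103515625) * z + (82539293 / 488281250) * z ^ 2 + (- 88188731 / 117187500) * z ^ 3 + (- 384169 / 234375) * z ^ 4 + (- 2834 / 46875) * z ^ 5 + (1997 / 1875) * z ^ 6 + (28 / 75) * z ^ 7 + (1 / 12) * z ^ 8"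
  unfolding assms by (simp add: field_simps eval_nat_numeral)

lemma variance_gap_high:
  fixes y z :: real
  assumes "y = (7 / 10) + z"
  shows "223433 / 10 ^ 7 - (y ^ 2 / 3 - 2 / 3 * y ^ 3 - 5 / 4 * y ^ 4 + 2 * y ^ 5 - y ^ 6 / 3 - y ^ 8 / 12 + (3251 / 10000) * y ^ 4 / 2 + (17 / 20) * y ^ 3 - y ^ 4)
 = (416297 / 80000000) + (73661 / 625000) * z + (4223 / 125000) * z ^ 2 + (- 26687 / 25000) * z ^ 3 + (- 31859 / 30000) * z ^ 4 + (1501 / 1500) * z ^ 5 + (443 / 300) * z ^ 6 + (7 / 15) * z ^ 7 + (1 / 12) * z ^ 8"
  unfolding assms by (simp add: field_simps eval_nat_numeral)


lemma delta2_sq_at_le: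
  assumes t: "0 \<le> t" shows "delta2_sq_at t \<le> 223433 / 10 ^ 7"
proof -
  define y where "y = exp (- t / 2)"
  have y: "0 < y" "y \<le> 1" using t by (auto simp: y_def)
  note formula = delta2_sq_at_formula[OF t y_def]
  consider "y \<le> 14 / 25" | "14 / 25 \<le> y" "y \<le> 7 / 10" | "7 / 10 \<le> y" by linarith
  then show ?thesis
  proof cases
    case 1
    have "1 / (59 / 125) \<le> (\<Sum>k<11. (1501553 / 1000000 / 2 :: real) ^ k / fact k)"
      by (simp add: eval_nat_numeral)
    also have "\<dots> \<le> exp (1501553 / 1000000 / 2)" by (rule exp_ge_sum) simp
    finally have tan: "t * y ^ 4 / 2 \<le> (1501553 / 1000000) * y ^ 4 / 2 + (59 / 125) * y ^ 3 - y ^ 4"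
      by (intro exponent_tangent y_def) simp_all
    have "y * y \<le> 14 / 25 * y" using 1 y by (intro mult_right_mono) auto
    moreover have "y ^ 3 \<le> (14 / 25) ^ 2 * y"
      using power_mono[OF 1, of 2] y mult_right_mono[of "y ^ 2" "(14 / 25) ^ 2" y] by (simp add: eval_nat_numeral)
    moreover have "0 \<le> y ^ 4" "0 \<le> y ^ 5" "0 \<le> y ^ 6" using y by auto
    ultimately have "0 \<le> (6272936491324506314881050429 / 62500000000000000000000000000) + (265903319904315895738951 / 625000000000000000000000) * y + (- 2171904295002251039 / 15000000000000000000) * y ^ 2 + (- 206305258728643 / 125000000000000) * y ^ 3 + (11669605843 / 30000000000) * y ^ 4 + (23591 / 300000) * y ^ 5 + (1 / 12) * y ^ 6"
      using 1 unfolding power2_eq_square by linarith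
    then have "0 \<le> (y - (23591 / 50000)) ^ 2 * ((6272936491324506314881050429 / 62500000000000000000000000000) + (265903319904315895738951 / 625000000000000000000000) * y + (- 2171904295002251039 / 15000000000000000000) * y ^ 2 + (- 206305258728643 / 125000000000000) * y ^ 3 + (11669605843 / 30000000000) * y ^ 4 + (23591 / 300000) * y ^ 5 + (1 / 12) * y ^ 6)"
      by (intro mult_nonneg_nonneg) auto
    then show ?thesis using variance_gap_near_max[of y] tan y unfolding formula by linarith
  next
    case 2
    have "1 / (13 / 20) \<le> (\<Sum>k<7. (1077 / 1250 / 2 :: real) ^ k / fact k)"
      by (simp add: eval_nat_numeral)
    also have "\<dots> \<le> exp (1077 / 1250 / 2)" by (rule exp_ge_sum) simp
    finally have tan: "t * y ^ 4 / 2 \<le> (1077 / 1250) * y ^ 4 / 2 + (13 / 20) * y ^ 3 - y ^ 4"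
      by (intro exponent_tangent y_def) simp_all
    define z where "z = y - 14 / 25"
    have z: "0 \<le> z" "z \<le> 7 / 50" "y = (14 / 25) + z" using 2 by (auto simp: z_def)
    have pw: "z ^ Suc k \<le> (7 / 50) ^ k * z" for k
      using power_mono[OF z(2,1), of k] z(1) mult_right_mono[of "z ^ k" "(7 / 50) ^ k" z] by (simp add: mult.commute)
    have "z ^ 3 \<le> 49 / 2500 * z" "z ^ 4 \<le> 343 / 125000 * z" "z ^ 5 \<le> 2401 / 6250000 * z"
      using pw[of 2] pw[of 3] pw[of 4] by (simp_all add: eval_nat_numeral)
    moreover have "0 \<le> z ^ 2" "0 \<le> z ^ 6" "0 \<le> z ^ 7" "0 \<le> z ^ 8" using z by auto
    ultimately show ?thesis using variance_gap_mid[OF z(3)] tan z(1) unfolding formula by linarith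
  next
    case 3
    have "1 / (17 / 20) \<le> (\<Sum>k<5. (3251 / 10000 / 2 :: real) ^ k / fact k)"
      by (simp add: eval_nat_numeral)
    also have "\<dots> \<le> exp (3251 / 10000 / 2)" by (rule exp_ge_sum) simp
    finally have tan: "t * y ^ 4 / 2 \<le> (3251 / 10000) * y ^ 4 / 2 + (17 / 20) * y ^ 3 - y ^ 4"
      by (intro exponent_tangent y_def) simp_all
    define z where "z = y - 7 / 10"
    have z: "0 \<le> z" "z \<le> 3 / 10" "y = (7 / 10) + z" using 3 y by (auto simp: z_def)
    have pw: "z ^ Suc k \<le> (3 / 10) ^ k * z" for k
      using power_mono[OF z(2,1), of k] z(1) mult_right_mono[of "z ^ k" "(3 / 10) ^ k" z] by (simp add: mult.commute)
    have "z ^ 3 \<le> 9 / 100 * z" "z ^ 4 \<le> 27 / 1000 * z"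
      using pw[of 2] pw[of 3] by (simp_all add: eval_nat_numeral)
    moreover have "0 \<le> z ^ 2" "0 \<le> z ^ 5" "0 \<le> z ^ 6" "0 \<le> z ^ 7" "0 \<le> z ^ 8" using z by auto
    ultimately show ?thesis using variance_gap_high[OF z(3)] tan z(1,2) unfolding formula by linarith
  qed
qed

lemma bdd_above_delta2_sq_at: "bdd_above (delta2_sq_at ` {0..})"
  by (rule bdd_aboveI2[where M="223433 / 10 ^ 7"]) (use delta2_sq_at_le in auto)

lemma delta2_sq_bounds: "2234 / 10 ^ 5 \<le> delta2_sq" "delta2_sq \<le> 223433 / 10 ^ 7"
proof -
  show "delta2_sq \<le> 223433 / 10 ^ 7"
    unfolding delta2_sq_def by (rule cSUP_least) (use delta2_sq_at_le in auto)
  define t where "t = - 2 * ln (59 / 125 :: real)"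
  have "exp (15015 / 20000) \<le> (\<Sum>k<8. (15015 / 20000 :: real) ^ k / fact k) + 3 / fact 8 * (15015 / 20000) ^ 8"
    by (rule exp_le_sum) auto
  also have "\<dots> \<le> 125 / 59" by (simp add: eval_nat_numeral)
  finally have "15015 / 20000 \<le> ln (125 / 59 :: real)" by (subst ln_ge_iff) auto
  also have "\<dots> = - ln (59 / 125 :: real)" by (simp add: ln_div)
  finally have t: "15015 / 10000 \<le> t" by (simp add: t_def)
  have y: "59 / 125 = exp (- t / 2)" by (simp add: t_def)
  have "2234 / 10 ^ 5 \<le> delta2_sq_at t"
    using t by (subst delta2_sq_at_formula[OF _ y]) (simp_all add: eval_nat_numeral)
  also have "\<dots> \<le> delta2_sq"
    unfolding delta2_sq_def using t by (intro cSUP_upper bdd_above_delta2_sq_at) auto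
  finally show "2234 / 10 ^ 5 \<le> delta2_sq" .
qed

lemma delta2_sq_at_le_delta2_sq:
  assumes "0 \<le> t" shows "delta2_sq_at t \<le> delta2_sq"
  unfolding delta2_sq_def
  by (intro cSUP_upper bdd_above_delta2_sq_at) (use assms in auto)

lemma delta2_sq_approx:
  assumes "v < delta2_sq" shows "\<exists>t\<ge>0. v < delta2_sq_at t"
  using assms unfolding delta2_sq_def by (subst (asm) less_cSUP_iff[OF _ bdd_above_delta2_sq_at]) auto

lemma numeric_constant: "\<bar>1 / (8 * delta2_sq) - 5.595\<bar> < 0.0005"
proof -
  have D: "0 < delta2_sq" using delta2_sq_bounds(1) by simp
  define x where "x = 1 / (8 * delta2_sq)"
  have "x < 5.5955" "5.5945 < x"
    unfolding x_def using delta2_sq_bounds D by (simp_all add: pos_divide_less_eq pos_less_divide_eq)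
  moreover have "\<bar>x - 5.595\<bar> < 0.0005 \<longleftrightarrow> x - 5.595 < 0.0005 \<and> - (x - 5.595) < 0.0005"
    by (rule abs_less_iff)
  ultimately show ?thesis unfolding x_def[symmetric] by simp
qed

section \<open>Small levels\<close>

lemma exp_cubic_le:
  fixes x :: real
  assumes "\<bar>x\<bar> \<le> 1" shows "exp x \<le> 1 + x + x\<^sup>2 / 2 + \<bar>x\<bar> ^ 3"
proof (cases "0 \<le> x")
  case True
  define h where "h u = 1 + u + u\<^sup>2 / 2 + u ^ 3 - exp u" for u :: real
  have "h 0 \<le> h x"
  proof (rule DERIV_nonneg_imp_nondecreasing[OF True])
    fix u assume u: "0 \<le> u" "u \<le> x"
    have "(h has_real_derivative 1 + u + 3 * u\<^sup>2 - exp u) (at u)"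
      unfolding h_def by (auto intro!: derivative_eq_intros simp: power2_eq_square)
    moreover have "0 \<le> 1 + u + 3 * u\<^sup>2 - exp u"
      using exp_quadratic_le[of u] u assms zero_le_power2[of u] by linarith
    ultimately show "\<exists>y. (h has_real_derivative y) (at u) \<and> 0 \<le> y" by blast
  qed
  then show ?thesis using True by (simp add: h_def)
next
  case False
  define h where "h u = 1 + u + u\<^sup>2 / 2 - exp u" for u :: real
  have "h 0 \<le> h x"
  proof (rule DERIV_nonpos_imp_nonincreasing[of x 0 h])
    show "x \<le> 0" using False by simp
    fix u assume u: "x \<le> u" "u \<le> 0"
    have "(h has_real_derivative 1 + u - exp u) (at u)"
      unfolding h_def by (auto intro!: derivative_eq_intros)
    moreover have "1 + u - exp u \<le> 0" using exp_ge_add_one_self[of u] by simp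
    ultimately show "\<exists>y. (h has_real_derivative y) (at u) \<and> y \<le> 0" by blast
  qed
  then have "exp x \<le> 1 + x + x\<^sup>2 / 2" by (simp add: h_def)
  moreover have "0 \<le> \<bar>x\<bar> ^ 3" by simp
  ultimately show ?thesis by linarith
qed

text \<open>
  Second-order expansion of the entropy with an explicit error. For negative \<open>x\<close> the
  derivative \<open>3 * x^2\<close> of the cubic term outweighs \<open>x - ln (1 + x)\<close>, which
  is at most \<open>2 * x^2\<close>.
\<close>

lemma xlnx_cubic_le:
  fixes x :: real
  assumes "\<bar>x\<bar> \<le> 1 / 2" shows "(1 + x) * ln (1 + x) \<le> x + x\<^sup>2 / 2 + \<bar>x\<bar> ^ 3"
proof (cases "0 \<le> x")
  case True
  define h where "h u = u + u\<^sup>2 / 2 - (1 + u) * ln (1 + u)" for u :: real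
  have "h 0 \<le> h x"
  proof (rule DERIV_nonneg_imp_nondecreasing[OF True])
    fix u assume u: "0 \<le> u" "u \<le> x"
    have "(h has_real_derivative u - ln (1 + u)) (at u)"
      unfolding h_def using u by (auto intro!: derivative_eq_intros)
    moreover have "0 \<le> u - ln (1 + u)" using ln_add_one_self_le_self[of u] u by simp
    ultimately show "\<exists>y. (h has_real_derivative y) (at u) \<and> 0 \<le> y" by blast
  qed
  then have "(1 + x) * ln (1 + x) \<le> x + x\<^sup>2 / 2" by (simp add: h_def)
  moreover have "0 \<le> \<bar>x\<bar> ^ 3" by simp
  ultimately show ?thesis by linarith
next
  case False
  define h where "h u = u + u\<^sup>2 / 2 - u ^ 3 - (1 + u) * ln (1 + u)" for u :: real
  have "h 0 \<le> h x"
  proof (rule DERIV_nonpos_imp_nonincreasing[of x 0 h])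
    show "x \<le> 0" using False by simp
    fix u assume u: "x \<le> u" "u \<le> 0"
    then have u2: "\<bar>u\<bar> \<le> 1 / 2" using assms by auto
    have "(h has_real_derivative u - 3 * u\<^sup>2 - ln (1 + u)) (at u)"
      unfolding h_def using u2 by (auto intro!: derivative_eq_intros)
    moreover have "u - 3 * u\<^sup>2 - ln (1 + u) \<le> 0"
      using abs_ln_one_plus_x_minus_x_bound[OF u2] zero_le_power2[of u] by (simp add: abs_le_iff)
    ultimately show "\<exists>y. (h has_real_derivative y) (at u) \<and> y \<le> 0" by blast
  qed
  then show ?thesis using False by (simp add: h_def power3_eq_cube)
qed

text \<open>
  A weak form of Pinsker's inequality: Young's inequality for the centered function, scaled to sup-norm
  \<open>sqrt K\<close>, has a quadratic error of the same order \<open>K\<close>.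
\<close>

lemma entropy_controls_means:
  assumes f: "dens f" and K: "KL f \<le> K" "0 < K" "K \<le> 1"
    and b: "bdd_meas \<phi>" and c: "0 < c" "\<And>x. \<bar>\<phi> x\<bar> \<le> c"
  shows "\<bar>\<integral>x. (f x - 1) * \<phi> x \<partial>Exp1\<bar> \<le> 4 * c * sqrt K"
proof -
  note d = densD[OF f]
  have one: "(\<integral>x. (f x - 1) * \<phi> x \<partial>Exp1) \<le> 4 * c * sqrt K"
    if b: "bdd_meas \<phi>" and \<phi>c: "\<And>x. \<bar>\<phi> x\<bar> \<le> c" for \<phi>
  proof -
    define m where "m = (\<integral>x. \<phi> x \<partial>Exp1)"
    have m: "\<bar>m\<bar> \<le> c" unfolding m_def by (rule integral_bound_bdd[OF b \<phi>c])
    define s where "s = sqrt K / (2 * c)"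
    have s: "0 < s" "s * (2 * c) = sqrt K" using K c by (auto simp: s_def)
    define \<psi> where "\<psi> x = s * \<phi> x - s * m" for x
    have b\<psi>: "bdd_meas \<psi>" unfolding \<psi>_def by (intro bdd_meas_diff bdd_meas_mult bdd_meas_const b)
    have \<psi>le: "\<bar>\<psi> x\<bar> \<le> sqrt K" for x
    proof -
      have "\<bar>\<psi> x\<bar> = s * \<bar>\<phi> x - m\<bar>" using s by (simp add: \<psi>_def right_diff_distrib[symmetric] abs_mult)
      also have "\<dots> \<le> s * (2 * c)" using s \<phi>c[of x] m by (intro mult_left_mono) auto
      finally show ?thesis using s by simp
    qed
    have sq: "(\<psi> x)\<^sup>2 \<le> K" for x
      using abs_le_square_iff[of "\<psi> x" "sqrt K"] \<psi>le[of x] K by simp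
    have I\<phi>: "integrable Exp1 \<phi>" "integrable Exp1 (\<lambda>x. f x * \<phi> x)"
      by (intro integrable_bdd_meas bdd_meas_mult d b)+
    have "(\<integral>x. exp (\<psi> x) \<partial>Exp1) \<le> (\<integral>x. (1 + K) + (s * \<phi> x - s * m) \<partial>Exp1)"
    proof (rule integral_mono)
      fix x
      have "\<bar>\<psi> x\<bar> \<le> 1" using \<psi>le[of x] K by (meson order_trans real_sqrt_le_1_iff)
      then have "exp (\<psi> x) \<le> 1 + \<psi> x + (\<psi> x)\<^sup>2" by (rule exp_quadratic_le)
      then show "exp (\<psi> x) \<le> (1 + K) + (s * \<phi> x - s * m)" using sq[of x] by (simp add: \<psi>_def)
    qed (use b\<psi> I\<phi> in auto)
    also have "\<dots> = 1 + K" using I\<phi> Exp1.prob_space by (simp add: m_def)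
    finally have "(\<integral>x. f x * \<psi> x \<partial>Exp1) \<le> 2 * K" using KL_young[OF f b\<psi>] K by simp
    moreover have "(\<integral>x. f x * \<psi> x \<partial>Exp1) = s * ((\<integral>x. f x * \<phi> x \<partial>Exp1) - m)"
    proof -
      have "(\<integral>x. f x * \<psi> x \<partial>Exp1) = (\<integral>x. s * (f x * \<phi> x) - s * m * f x \<partial>Exp1)"
        by (rule Bochner_Integration.integral_cong) (auto simp: \<psi>_def algebra_simps)
      then show ?thesis using I\<phi> d by (simp add: right_diff_distrib)
    qed
    moreover have "(\<integral>x. (f x - 1) * \<phi> x \<partial>Exp1) = (\<integral>x. f x * \<phi> x \<partial>Exp1) - m"
      using I\<phi> by (simp add: left_diff_distrib m_def)
    ultimately have "s * (\<integral>x. (f x - 1) * \<phi> x \<partial>Exp1) \<le> 2 * K" by simp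
    also have "2 * K = s * (4 * c * sqrt K)"
    proof -
      have "s * (4 * c * sqrt K) = 2 * (s * (2 * c)) * sqrt K" by simp
      also have "\<dots> = 2 * K" using K s(2) by simp
      finally show ?thesis ..
    qed
    finally show ?thesis using s(1) by simp
  qed
  have "(\<integral>x. (f x - 1) * (- \<phi> x) \<partial>Exp1) \<le> 4 * c * sqrt K"
    by (rule one) (use b c in auto)
  moreover have "(\<integral>x. (f x - 1) * (- \<phi> x) \<partial>Exp1) = - (\<integral>x. (f x - 1) * \<phi> x \<partial>Exp1)"
    by (simp only: mult_minus_right Bochner_Integration.integral_minus)
  ultimately show ?thesis using one[OF b c(2)] by (simp add: abs_le_iff)
qed

text \<open>
  With \<open>\<nu> = f - 1\<close> the constant term vanishes because the exponential law has
  \<open>Psi = 0\<close>. In the quadratic term both slots are small: \<open>cd \<nu>\<close>, hence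
  \<open>Xi t \<nu>\<close>, is of order \<open>sqrt K\<close>, and so is its mean against
  \<open>\<nu>\<close>.
\<close>

lemma Bil_linearization:
  assumes f: "dens f" and K: "KL f \<le> K" "0 < K" "K \<le> 1" and t: "0 \<le> t"
  shows "\<bar>Bil t f f - 2 * (\<integral>s. f s * Xi t (\<lambda>_. 1) s \<partial>Exp1)\<bar> \<le> 32 * K"
proof -
  note d = densD[OF f]
  define \<nu> where "\<nu> x = f x - 1" for x
  have \<nu>: "bdd_meas \<nu>" unfolding \<nu>_def by (intro bdd_meas_diff bdd_meas_const d)
  have cd\<nu>: "\<bar>cd \<nu> x\<bar> \<le> 4 * sqrt K" for x
    using entropy_controls_means[OF f K bdd_meas_indicator[of "{..<x}"], of 1]
    by (simp add: cd_def \<nu>_def indicator_def)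
  have Xi\<nu>: "\<bar>Xi t \<nu> s\<bar> \<le> 8 * sqrt K" for s
  proof -
    have "\<bar>indicator {..<t} s * cd \<nu> t\<bar> \<le> 4 * sqrt K"
      using cd\<nu>[of t] K by (simp add: indicator_def)
    then show ?thesis using cd\<nu>[of "2 * (t - s)"] cd\<nu>[of "t - s / 2"] unfolding Xi_def by linarith
  qed
  have "\<bar>Bil t \<nu> \<nu>\<bar> \<le> 4 * (8 * sqrt K) * sqrt K"
    unfolding Bil_def \<nu>_def[of "_"]
    by (rule entropy_controls_means[OF f K bdd_meas_Xi]) (use \<nu> K Xi\<nu> in \<open>auto simp: \<nu>_def[abs_def]\<close>)
  also have "\<dots> = 32 * K" using K by simp
  finally have A: "\<bar>Bil t \<nu> \<nu>\<bar> \<le> 32 * K" .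
  have X: "bdd_meas (Xi t (\<lambda>_. 1))" by (rule bdd_meas_Xi) simp
  have "Bil t (\<lambda>_. 1) \<nu> = (\<integral>s. f s * Xi t (\<lambda>_. 1) s - Xi t (\<lambda>_. 1) s \<partial>Exp1)"
    unfolding Bil_def \<nu>_def by (simp add: left_diff_distrib)
  also have "\<dots> = (\<integral>s. f s * Xi t (\<lambda>_. 1) s \<partial>Exp1)"
    using integrable_bdd_meas[OF X] integrable_bdd_meas[OF bdd_meas_mult[OF d(1) X]] integral_Xi_one[OF t] by simp
  finally have B: "Bil t (\<lambda>_. 1) \<nu> = (\<integral>s. f s * Xi t (\<lambda>_. 1) s \<partial>Exp1)" .
  have "Bil t f f = Bil t (\<lambda>x. 1 * 1 + 1 * \<nu> x) (\<lambda>x. 1 * 1 + 1 * \<nu> x)" by (simp add: \<nu>_def)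
  also have "\<dots> = 2 * Bil t (\<lambda>_. 1) \<nu> + Bil t \<nu> \<nu>"
    unfolding Bil_quad[OF bdd_meas_const \<nu>] using Bil_one[OF t] by simp
  finally show ?thesis using A B by simp
qed

text \<open>
  Young's inequality for \<open>\<theta> * \<sigma> * xi2\<close> bounds the mean of \<open>xi2\<close>
  by entropy and variance; \<open>\<theta> = a / (2 * D)\<close> is the optimal slope to first order.
\<close>

lemma entropy_lower_bound:
  assumes f: "dens f" and t: "0 \<le> t" and \<sigma>: "\<sigma> \<in> {1, -1}" and a: "0 < a" "a < \<sigma> * Bil t f f"
    and small: "a \<le> 2 * delta2_sq" "a\<^sup>2 \<le> 8 * delta2_sq"
  shows "a\<^sup>2 / (8 * delta2_sq) * ((1 - a / delta2_sq) / (1 + 8 * a / delta2_sq)) \<le> KL f"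
proof -
  define D where "D = delta2_sq"
  have D: "0 < D" using delta2_sq_bounds(1) by (simp add: D_def)
  define \<xi> where "\<xi> = Xi t (\<lambda>_. 1)"
  have b\<xi>: "bdd_meas \<xi>" unfolding \<xi>_def by (rule bdd_meas_Xi) simp
  have \<xi>1: "\<bar>\<xi> s\<bar> \<le> 1" for s unfolding \<xi>_def by (rule Xi_dens_le_1[OF dens_one])
  have I\<xi>: "integrable Exp1 \<xi>" "integrable Exp1 (\<lambda>s. (\<xi> s)\<^sup>2)"
    by (intro integrable_bdd_meas b\<xi> bdd_meas_power)+
  have V: "(\<integral>s. (\<xi> s)\<^sup>2 \<partial>Exp1) \<le> D"
    using delta2_sq_at_eq[OF t] delta2_sq_at_le_delta2_sq[OF t] by (simp add: \<xi>_def D_def)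
  have E0: "(\<integral>s. \<xi> s \<partial>Exp1) = 0" unfolding \<xi>_def by (rule integral_Xi_one[OF t])
  define \<theta> where "\<theta> = a / (2 * D)"
  have \<theta>: "0 < \<theta>" "\<theta> \<le> 1" using a small D by (auto simp: \<theta>_def D_def)
  define \<mu> where "\<mu> = \<sigma> * (\<integral>s. f s * \<xi> s \<partial>Exp1)"
  have main: "\<theta> * \<mu> \<le> KL f + \<theta>\<^sup>2 * D * (1 / 2 + \<theta>)"
  proof -
    define \<phi> where "\<phi> s = \<theta> * \<sigma> * \<xi> s" for s
    have b\<phi>: "bdd_meas \<phi>" unfolding \<phi>_def by (intro bdd_meas_mult bdd_meas_const b\<xi>)
    have "(\<integral>s. exp (\<phi> s) \<partial>Exp1) \<le> (\<integral>s. 1 + \<theta> * \<sigma> * \<xi> s + (\<theta>\<^sup>2 * (1 / 2 + \<theta>)) * (\<xi> s)\<^sup>2 \<partial>Exp1)"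
    proof (rule integral_mono)
      fix s
      have abs\<phi>: "\<bar>\<phi> s\<bar> = \<theta> * \<bar>\<xi> s\<bar>" using \<sigma> \<theta> by (auto simp: \<phi>_def abs_mult)
      have "\<theta> * \<bar>\<xi> s\<bar> \<le> \<theta> * 1" using \<xi>1[of s] \<theta> by (intro mult_left_mono) auto
      then have le: "\<bar>\<phi> s\<bar> \<le> \<theta>" using abs\<phi> by simp
      have sq: "(\<phi> s)\<^sup>2 = \<theta>\<^sup>2 * (\<xi> s)\<^sup>2" using \<sigma> by (auto simp: \<phi>_def power_mult_distrib)
      have "\<bar>\<phi> s\<bar> ^ 3 = \<bar>\<phi> s\<bar> * (\<phi> s)\<^sup>2" by (simp add: power3_eq_cube power2_eq_square abs_mult_self_eq mult.assoc)
      also have "\<dots> \<le> \<theta> * (\<phi> s)\<^sup>2" using le by (intro mult_right_mono) auto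
      finally have "\<bar>\<phi> s\<bar> ^ 3 \<le> \<theta> * (\<theta>\<^sup>2 * (\<xi> s)\<^sup>2)" by (simp add: sq)
      moreover have "exp (\<phi> s) \<le> 1 + \<phi> s + (\<phi> s)\<^sup>2 / 2 + \<bar>\<phi> s\<bar> ^ 3"
        using le \<theta> by (intro exp_cubic_le) simp
      moreover have "(\<theta>\<^sup>2 * (1 / 2 + \<theta>)) * (\<xi> s)\<^sup>2 = (\<phi> s)\<^sup>2 / 2 + \<theta> * (\<theta>\<^sup>2 * (\<xi> s)\<^sup>2)"
        by (simp add: sq algebra_simps)
      ultimately show "exp (\<phi> s) \<le> 1 + \<theta> * \<sigma> * \<xi> s + (\<theta>\<^sup>2 * (1 / 2 + \<theta>)) * (\<xi> s)\<^sup>2"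
        by (simp add: \<phi>_def)
    qed (use b\<phi> I\<xi> in auto)
    also have "\<dots> = 1 + \<theta>\<^sup>2 * (1 / 2 + \<theta>) * (\<integral>s. (\<xi> s)\<^sup>2 \<partial>Exp1)"
      using I\<xi> E0 Exp1.prob_space by simp
    also have "\<theta>\<^sup>2 * (1 / 2 + \<theta>) * (\<integral>s. (\<xi> s)\<^sup>2 \<partial>Exp1) \<le> \<theta>\<^sup>2 * (1 / 2 + \<theta>) * D"
      using V \<theta> by (intro mult_left_mono) auto
    finally have "(\<integral>s. exp (\<phi> s) \<partial>Exp1) \<le> 1 + \<theta>\<^sup>2 * (1 / 2 + \<theta>) * D" by simp
    moreover have "(\<integral>s. f s * \<phi> s \<partial>Exp1) = \<theta> * \<mu>"
    proof -
      have "(\<integral>s. f s * \<phi> s \<partial>Exp1) = (\<integral>s. (\<theta> * \<sigma>) * (f s * \<xi> s) \<partial>Exp1)"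
        by (rule Bochner_Integration.integral_cong) (auto simp: \<phi>_def)
      then show ?thesis by (simp add: \<mu>_def)
    qed
    ultimately show ?thesis using KL_young[OF f b\<phi>] by (simp add: mult.commute mult.left_commute)
  qed
  \<comment> \<open>stated for \<open>K\<close> strictly above the entropy because \<open>Bil_linearization\<close>
     needs a positive bound\<close>
  have key: "a\<^sup>2 / (8 * D) * (1 - a / D) \<le> K * (1 + 8 * a / D)" if K: "KL f < K" "K < 1" for K
  proof -
    have K0: "0 < K" using K KL_nonneg[OF f] by simp
    have "\<bar>Bil t f f - 2 * (\<integral>s. f s * \<xi> s \<partial>Exp1)\<bar> \<le> 32 * K"
      unfolding \<xi>_def using K K0 by (intro Bil_linearization f t) auto
    then have "a - 32 * K \<le> 2 * \<mu>" using \<sigma> a by (auto simp: \<mu>_def)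
    then have "\<theta> * ((a - 32 * K) / 2) \<le> \<theta> * \<mu>" using \<theta> by (intro mult_left_mono) auto
    also have "\<dots> \<le> K + \<theta>\<^sup>2 * D * (1 / 2 + \<theta>)" using main K by simp
    finally show ?thesis using D by (simp add: \<theta>_def power2_eq_square field_simps)
  qed
  have le1: "a\<^sup>2 / (8 * D) * ((1 - a / D) / (1 + 8 * a / D)) \<le> 1"
  proof -
    have "0 < a / D" using a D by simp
    then have "(1 - a / D) / (1 + 8 * a / D) \<le> 1" by (simp add: divide_le_eq_1)
    moreover have "a\<^sup>2 / (8 * D) \<le> 1" "0 \<le> a\<^sup>2 / (8 * D)" using small D by (auto simp: D_def)
    ultimately show ?thesis using mult_left_mono[of "(1 - a / D) / (1 + 8 * a / D)" 1 "a\<^sup>2 / (8 * D)"] by linarith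
  qed
  have p: "0 < 1 + 8 * a / D" using a D by (simp add: add_pos_pos)
  show ?thesis
  proof (cases "KL f < 1")
    case False then show ?thesis using le1 by (simp add: D_def)
  next
    case True
    show ?thesis
    proof (rule dense_ge_bounded[OF True])
      fix K assume "KL f < K" "K < 1"
      from key[OF this] show "a\<^sup>2 / (8 * delta2_sq) * ((1 - a / delta2_sq) / (1 + 8 * a / delta2_sq)) \<le> K"
        unfolding D_def[symmetric] times_divide_eq_right[of "a\<^sup>2 / (8 * D)"] pos_divide_le_eq[OF p] .
    qed
  qed
qed

lemma ld_rate_ge:
  assumes a: "0 < a" and small: "a \<le> 2 * delta2_sq" "a\<^sup>2 \<le> 8 * delta2_sq"
  shows "ereal (a\<^sup>2 / (8 * delta2_sq) * ((1 - a / delta2_sq) / (1 + 8 * a / delta2_sq))) \<le> ld_rate a"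
proof -
  have "ereal (a\<^sup>2 / (8 * delta2_sq) * ((1 - a / delta2_sq) / (1 + 8 * a / delta2_sq))) \<le> rate \<sigma> a"
    if "\<sigma> \<in> {1, -1}" for \<sigma>
    unfolding rate_def using entropy_lower_bound[OF _ _ that a _ small] by (intro INF_greatest) auto
  then show ?thesis by (simp add: ld_rate_def)
qed

text \<open>
  The density \<open>1 + \<epsilon> * xi2\<close> has
  \<open>Psi = 2 * \<epsilon> * V + O(\<epsilon>^2)\<close> and entropy
  \<open>\<epsilon>^2 * V / 2 + O(\<epsilon>^3)\<close>. The choice
  \<open>\<epsilon> = a / (2 * V)\<close> would reach the level \<open>a\<close> to first order; the
  factor \<open>1 + 4 / V^2 * a\<close> pays for the quadratic error.
\<close>

lemma ld_rate_le:
  assumes t: "0 \<le> t" and V: "V = delta2_sq_at t" "0 < V" and a: "0 < a" "4 / V\<^sup>2 * a \<le> 1"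
    and e: "\<epsilon> = a / (2 * V) * (1 + 4 / V\<^sup>2 * a)" "\<epsilon> \<le> 1 / 2"
  shows "ld_rate a \<le> ereal (\<epsilon>\<^sup>2 * V * (1 / 2 + \<epsilon>))"
proof -
  define \<xi> where "\<xi> = Xi t (\<lambda>_. 1)"
  have b\<xi>: "bdd_meas \<xi>" unfolding \<xi>_def by (rule bdd_meas_Xi) simp
  have \<xi>1: "\<bar>\<xi> s\<bar> \<le> 1" for s unfolding \<xi>_def by (rule Xi_dens_le_1[OF dens_one])
  have I\<xi>: "integrable Exp1 \<xi>" "integrable Exp1 (\<lambda>s. (\<xi> s)\<^sup>2)"
    by (intro integrable_bdd_meas b\<xi> bdd_meas_power)+
  have EV: "(\<integral>s. (\<xi> s)\<^sup>2 \<partial>Exp1) = V" using delta2_sq_at_eq[OF t] V by (simp add: \<xi>_def)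
  have E0: "(\<integral>s. \<xi> s \<partial>Exp1) = 0" unfolding \<xi>_def by (rule integral_Xi_one[OF t])
  have e0: "0 < \<epsilon>" using e a V by (simp add: add_pos_nonneg)
  define f where "f s = 1 * 1 + \<epsilon> * \<xi> s" for s
  have small: "\<bar>\<epsilon> * \<xi> s\<bar> \<le> \<epsilon>" for s using mult_left_mono[OF \<xi>1[of s], of \<epsilon>] e0 by (simp add: abs_mult)
  have f: "dens f"
    unfolding dens_def
  proof (intro conjI allI)
    show "bdd_meas f" unfolding f_def by (intro bdd_meas_add bdd_meas_mult bdd_meas_const b\<xi>)
    show "0 \<le> f s" for s using small[of s] e(2) by (simp add: f_def abs_le_iff)
    show "(\<integral>x. f x \<partial>Exp1) = 1" using I\<xi> E0 Exp1.prob_space by (simp add: f_def)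
  qed
  have "KL f \<le> (\<integral>s. \<epsilon> * \<xi> s + (\<epsilon>\<^sup>2 * (1 / 2 + \<epsilon>)) * (\<xi> s)\<^sup>2 \<partial>Exp1)"
    unfolding KL_def
  proof (rule integral_mono)
    show "integrable Exp1 (\<lambda>x. f x * ln (f x))"
      by (intro integrable_bdd_meas bdd_meas_xlnx densD[OF f])
    show "integrable Exp1 (\<lambda>s. \<epsilon> * \<xi> s + (\<epsilon>\<^sup>2 * (1 / 2 + \<epsilon>)) * (\<xi> s)\<^sup>2)" using I\<xi> by auto
    fix s
    define u where "u = \<epsilon> * \<xi> s"
    have u: "\<bar>u\<bar> \<le> \<epsilon>" using small[of s] by (simp add: u_def)
    have sq: "u\<^sup>2 = \<epsilon>\<^sup>2 * (\<xi> s)\<^sup>2" by (simp add: u_def power_mult_distrib)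
    have "\<bar>u\<bar> ^ 3 = \<bar>u\<bar> * u\<^sup>2" by (simp add: power3_eq_cube power2_eq_square abs_mult_self_eq mult.assoc)
    also have "\<dots> \<le> \<epsilon> * u\<^sup>2" using u by (intro mult_right_mono) auto
    finally have "\<bar>u\<bar> ^ 3 \<le> \<epsilon> * (\<epsilon>\<^sup>2 * (\<xi> s)\<^sup>2)" by (simp add: sq)
    moreover have "(1 + u) * ln (1 + u) \<le> u + u\<^sup>2 / 2 + \<bar>u\<bar> ^ 3" using u e(2) by (intro xlnx_cubic_le) simp
    moreover have "(\<epsilon>\<^sup>2 * (1 / 2 + \<epsilon>)) * (\<xi> s)\<^sup>2 = u\<^sup>2 / 2 + \<epsilon> * (\<epsilon>\<^sup>2 * (\<xi> s)\<^sup>2)"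
      by (simp add: sq algebra_simps)
    ultimately show "f s * ln (f s) \<le> \<epsilon> * \<xi> s + (\<epsilon>\<^sup>2 * (1 / 2 + \<epsilon>)) * (\<xi> s)\<^sup>2"
      by (simp add: f_def u_def)
  qed
  also have "\<dots> = \<epsilon>\<^sup>2 * V * (1 / 2 + \<epsilon>)" using I\<xi> E0 EV by simp
  finally have KL: "KL f \<le> \<epsilon>\<^sup>2 * V * (1 / 2 + \<epsilon>)" .
  have "Bil t f f = 2 * \<epsilon> * Bil t (\<lambda>_. 1) \<xi> + \<epsilon>\<^sup>2 * Bil t \<xi> \<xi>"
    unfolding f_def[abs_def] Bil_quad[OF bdd_meas_const b\<xi>] using Bil_one[OF t] by simp
  also have "Bil t (\<lambda>_. 1) \<xi> = V"
    using EV by (simp add: Bil_def \<xi>_def[symmetric] power2_eq_square)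
  finally have Bf: "Bil t f f = 2 * \<epsilon> * V + \<epsilon>\<^sup>2 * Bil t \<xi> \<xi>" .
  have "\<bar>Bil t \<xi> \<xi>\<bar> \<le> 2"
    unfolding Bil_def
  proof (rule integral_bound_bdd)
    show "bdd_meas (\<lambda>s. \<xi> s * Xi t \<xi> s)" by (intro bdd_meas_mult bdd_meas_Xi b\<xi>)
    fix s
    have c: "\<bar>cd \<xi> x\<bar> \<le> 1" for x by (rule cd_bound[OF b\<xi> \<xi>1])
    have "\<bar>indicator {..<t} s * cd \<xi> t\<bar> \<le> 1" using c[of t] by (simp add: indicator_def)
    then have "\<bar>Xi t \<xi> s\<bar> \<le> 2" using c[of "2 * (t - s)"] c[of "t - s / 2"] unfolding Xi_def by linarith
    then have "\<bar>\<xi> s\<bar> * \<bar>Xi t \<xi> s\<bar> \<le> 1 * 2" using \<xi>1[of s] by (intro mult_mono) auto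
    then show "\<bar>\<xi> s * Xi t \<xi> s\<bar> \<le> 2" by (simp add: abs_mult)
  qed
  then have "\<epsilon>\<^sup>2 * (- 2) \<le> \<epsilon>\<^sup>2 * Bil t \<xi> \<xi>" by (intro mult_left_mono) auto
  then have "2 * \<epsilon> * V - 2 * \<epsilon>\<^sup>2 \<le> Bil t f f" using Bf by simp
  moreover have "a < 2 * \<epsilon> * V - 2 * \<epsilon>\<^sup>2"
  proof -
    have eV: "2 * \<epsilon> * V = a + 4 / V\<^sup>2 * a\<^sup>2" using V(2) by (simp add: e(1) power2_eq_square field_simps)
    have "\<epsilon> \<le> a / (2 * V) * 2" unfolding e(1) using a V by (intro mult_left_mono) auto
    then have "\<epsilon> \<le> a / V" by simp
    then have "\<epsilon>\<^sup>2 \<le> (a / V)\<^sup>2" using e0 by (intro power_mono) auto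
    then have "2 * \<epsilon>\<^sup>2 \<le> 2 / V\<^sup>2 * a\<^sup>2" by (simp add: power_divide)
    moreover have "2 / V\<^sup>2 * a\<^sup>2 < 4 / V\<^sup>2 * a\<^sup>2" using a V by (intro mult_strict_right_mono divide_strict_right_mono) auto
    ultimately show ?thesis using eV by linarith
  qed
  ultimately have "rate 1 a \<le> ereal (KL f)" by (intro rate_le[OF f t]) simp
  then show ?thesis using KL unfolding ld_rate_def by (meson ereal_less_eq(3) min.coboundedI1 order_trans)
qed

lemma ld_rate_real:
  assumes "a < 1" shows "ld_rate a = ereal (real_of_ereal (ld_rate a))"
proof -
  have "rate 1 a = ereal (real_of_ereal (rate 1 a))" using assms by (intro rate_real) (auto simp: level_cap_def)
  then have "ld_rate a \<le> ereal (real_of_ereal (rate 1 a))" unfolding ld_rate_def by (metis min.cobounded1)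
  moreover have "0 \<le> ld_rate a" using rate_nonneg by (simp add: ld_rate_def)
  ultimately show ?thesis by (cases "ld_rate a") auto
qed

lemma ld_rate_asymptotics: "((\<lambda>a. real_of_ereal (ld_rate a) * (8 * delta2_sq) / a\<^sup>2) \<longlongrightarrow> 1) (at_right 0)"
proof (rule order_tendstoI)
  define D where "D = delta2_sq"
  have D: "0 < D" using delta2_sq_bounds(1) by (simp add: D_def)
  have ev: "\<forall>\<^sub>F a in at_right 0. 0 < a \<and> a < c" if "0 < c" for c :: real
    unfolding eventually_at_right_field using that by auto
  fix x :: real
  {
    assume x: "x < 1"
    have "((\<lambda>a. (1 - a / D) / (1 + 8 * a / D)) \<longlongrightarrow> (1 - 0 / D) / (1 + 8 * 0 / D)) (at_right 0)"
      using D by (intro tendsto_intros) auto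
    then have "\<forall>\<^sub>F a in at_right 0. x < (1 - a / D) / (1 + 8 * a / D)" using x by (intro order_tendstoD) auto
    moreover have "\<forall>\<^sub>F a in at_right 0. 0 < a \<and> a < min (min 1 (2 * D)) (8 * D)" using D by (intro ev) auto
    ultimately show "\<forall>\<^sub>F a in at_right 0. x < real_of_ereal (ld_rate a) * (8 * delta2_sq) / a\<^sup>2"
    proof eventually_elim
      case (elim a)
      have "a\<^sup>2 \<le> 1 * a" using elim(2) by (simp add: power2_eq_square)
      then have "ereal (a\<^sup>2 / (8 * D) * ((1 - a / D) / (1 + 8 * a / D))) \<le> ld_rate a"
        using elim(2) unfolding D_def by (intro ld_rate_ge) auto
      then have le: "a\<^sup>2 / (8 * D) * ((1 - a / D) / (1 + 8 * a / D)) \<le> real_of_ereal (ld_rate a)"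
        using ld_rate_real[of a] elim(2) by (metis ereal_less_eq(3) min_less_iff_conj)
      have "a\<^sup>2 / (8 * D) * x < a\<^sup>2 / (8 * D) * ((1 - a / D) / (1 + 8 * a / D))"
        using elim D by (intro mult_strict_left_mono) auto
      then have "a\<^sup>2 / (8 * D) * x < real_of_ereal (ld_rate a)" using le by linarith
      then show ?case using D elim(2) by (simp add: D_def[symmetric] field_simps)
    qed
  next
    assume x: "1 < x"
    have "D / x < D" using D x by (simp add: field_simps)
    then obtain t where t: "0 \<le> t" "D / x < delta2_sq_at t" using delta2_sq_approx[of "D / x"] by (auto simp: D_def)
    define V where "V = delta2_sq_at t"
    have "0 < D / x" using D x by simp
    then have V0: "0 < V" using t by (simp add: V_def)
    moreover have "D / V < x" using t(2) V0 x by (simp add: V_def field_simps)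
    ultimately have V: "0 < V" "D / V < x" by auto
    define \<epsilon> where "\<epsilon> a = a / (2 * V) * (1 + 4 / V\<^sup>2 * a)" for a
    have "(\<epsilon> \<longlongrightarrow> 0 / (2 * V) * (1 + 4 / V\<^sup>2 * 0)) (at_right 0)"
      unfolding \<epsilon>_def using V by (intro tendsto_intros) auto
    then have \<epsilon>0: "(\<epsilon> \<longlongrightarrow> 0) (at_right 0)" by simp
    have "((\<lambda>a. D / V * ((1 + 4 / V\<^sup>2 * a)\<^sup>2 * (1 + 2 * \<epsilon> a))) \<longlongrightarrow> D / V * ((1 + 4 / V\<^sup>2 * 0)\<^sup>2 * (1 + 2 * 0))) (at_right 0)"
      by (intro tendsto_intros \<epsilon>0)
    then have "\<forall>\<^sub>F a in at_right 0. D / V * ((1 + 4 / V\<^sup>2 * a)\<^sup>2 * (1 + 2 * \<epsilon> a)) < x"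
      using V by (intro order_tendstoD) auto
    moreover have "\<forall>\<^sub>F a in at_right 0. \<epsilon> a < 1 / 2" using \<epsilon>0 by (rule order_tendstoD) simp
    moreover have "\<forall>\<^sub>F a in at_right 0. 0 < a \<and> a < min 1 (V\<^sup>2 / 4)" using V by (intro ev) auto
    ultimately show "\<forall>\<^sub>F a in at_right 0. real_of_ereal (ld_rate a) * (8 * delta2_sq) / a\<^sup>2 < x"
    proof eventually_elim
      case (elim a)
      have "4 / V\<^sup>2 * a \<le> 1" using elim(3) V by (simp add: field_simps)
      then have "ld_rate a \<le> ereal ((\<epsilon> a)\<^sup>2 * V * (1 / 2 + \<epsilon> a))"
        using elim V t by (intro ld_rate_le[OF t(1)]) (auto simp: V_def \<epsilon>_def)
      then have "real_of_ereal (ld_rate a) \<le> (\<epsilon> a)\<^sup>2 * V * (1 / 2 + \<epsilon> a)"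
        using ld_rate_real[of a] elim(3) by (metis ereal_less_eq(3) min_less_iff_conj)
      then have "real_of_ereal (ld_rate a) * (8 * D) / a\<^sup>2 \<le> (\<epsilon> a)\<^sup>2 * V * (1 / 2 + \<epsilon> a) * (8 * D) / a\<^sup>2"
        using D by (intro divide_right_mono mult_right_mono) auto
      also have "\<dots> = D / V * ((1 + 4 / V\<^sup>2 * a)\<^sup>2 * (1 + 2 * \<epsilon> a))"
      proof -
        have "(\<epsilon> a)\<^sup>2 = a\<^sup>2 / (4 * V\<^sup>2) * (1 + 4 / V\<^sup>2 * a)\<^sup>2"
          unfolding \<epsilon>_def by (simp add: power_mult_distrib power_divide)
        moreover have "a\<^sup>2 / (4 * V\<^sup>2) * p * V * (1 / 2 + q) * (8 * D) / a\<^sup>2 = D / V * (p * (1 + 2 * q))" for p q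
          using elim(3) V by (simp add: power2_eq_square field_simps)
        ultimately show ?thesis by (simp only:)
      qed
      also have "\<dots> < x" by (rule elim(1))
      finally show ?case by (simp add: D_def)
    qed
  }
qed

lemma ld_rate_continuous: "continuous_on {0<..<1 / 4} ld_rate"
proof -
  have "continuous_on {0<..<1 / 4} (rate \<sigma>)" if "\<sigma> \<in> {1, -1}" for \<sigma>
    by (rule continuous_on_subset[OF rate_continuous[OF that]]) (auto simp: level_cap_def)
  then show ?thesis unfolding ld_rate_def[abs_def] by (intro continuous_on_min) auto
qed

theorem theorem3:
  shows "\<exists>f2 :: real \<Rightarrow> ereal.
    (\<forall>(M :: 'a measure) (X :: nat \<Rightarrow> 'a \<Rightarrow> real) (l :: real).
       prob_space M \<longrightarrow> l > 0 \<longrightarrow>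
       prob_space.indep_vars M (\<lambda>_. borel) X UNIV \<longrightarrow>
       (\<forall>i. distributed M lborel (X i) (exponential_density l)) \<longrightarrow>
       (\<forall>a>0. (\<lambda>n. ereal (1 / real n) *
                  ln_ereal (measure M {\<omega> \<in> space M. D2 n (\<lambda>i. X i \<omega>) > a}))
              \<longlonglongrightarrow> - f2 a)) \<and>
    (\<exists>\<epsilon>>0. continuous_on {0<..<\<epsilon>} f2) \<and>
    (\<exists>r :: real \<Rightarrow> real. r \<in> o[at_right 0](\<lambda>_. 1) \<and>
       (\<forall>\<^sub>F a in at_right 0. f2 a = ereal (1 / (8 * delta2_sq) * a\<^sup>2 * (1 + r a)))) \<and>
    \<bar>1 / (8 * delta2_sq) - 5.595\<bar> < 0.0005"
proof (intro exI[of _ ld_rate] conjI allI impI)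
  fix M :: "'a measure" and X :: "nat \<Rightarrow> 'a \<Rightarrow> real" and l a :: real
  assume "prob_space M" "l > 0" "prob_space.indep_vars M (\<lambda>_. borel) X UNIV"
    "\<forall>i. distributed M lborel (X i) (exponential_density l)" "0 < a"
  then show "(\<lambda>n. ereal (1 / real n) * ln_ereal (measure M {\<omega> \<in> space M. D2 n (\<lambda>i. X i \<omega>) > a}))
      \<longlonglongrightarrow> - ld_rate a"
    by (intro D2_limit_exponential) auto
next
  show "\<exists>\<epsilon>>0. continuous_on {0<..<\<epsilon>} ld_rate" using ld_rate_continuous by (intro exI[of _ "1 / 4"]) simp
next
  define r where "r a = real_of_ereal (ld_rate a) * (8 * delta2_sq) / a\<^sup>2 - 1" for a
  have "(r \<longlongrightarrow> 1 - 1) (at_right 0)" unfolding r_def by (intro tendsto_diff ld_rate_asymptotics tendsto_const)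
  then have "r \<in> o[at_right 0](\<lambda>_. 1)" by (intro smalloI_tendsto) simp_all
  moreover have "\<forall>\<^sub>F a in at_right 0. ld_rate a = ereal (1 / (8 * delta2_sq) * a\<^sup>2 * (1 + r a))"
  proof -
    have "\<forall>\<^sub>F a :: real in at_right 0. 0 < a \<and> a < 1"
      unfolding eventually_at_right_field by (intro exI[of _ 1]) auto
    then show ?thesis
    proof eventually_elim
      case (elim a)
      have "1 / (8 * delta2_sq) * a\<^sup>2 * (1 + r a) = real_of_ereal (ld_rate a)"
        using elim delta2_sq_bounds(1) by (simp add: r_def)
      then show ?case using ld_rate_real[of a] elim by simp
    qed
  qed
  ultimately show "\<exists>r :: real \<Rightarrow> real. r \<in> o[at_right 0](\<lambda>_. 1) \<and>
       (\<forall>\<^sub>F a in at_right 0. ld_rate a = ereal (1 / (8 * delta2_sq) * a\<^sup>2 * (1 + r a)))"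
    by blast
next
  show "\<bar>1 / (8 * delta2_sq) - 5.595\<bar> < 0.0005" by (rule numeric_constant)
qed

end
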